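(* Let $G$ be a locally compact group, $N$ a closed normal subgroup of $G$, and $\xi\in\chi(N)$ a character of $N$. Then the Banach space $L^1_\xi(G,N)$ is isometrically isomorphic to the quotient Banach space $L^1(G)/\mathcal{N}^1_\xi(G,N)$ (with the quotient norm).
   Context: Locally compact groups are Hausdorff. $\mathbb{T}=\{z\in\mathbb{C}:|z|=1\}$, and $\chi(N)$ is the set of characters of $N$, i.e. continuous group homomorphisms $\xi:N\to\mathbb{T}$. Fix left Haar measures $\lambda_G$ on $G$ and $\lambda_N$ on $N$, and let $\lambda_{G/N}$ be the left Haar measure on $G/N$ normalized by Weil's formula $\int_{G/N}\left(\int_N f(xs)\,d\lambda_N(s)\right)d\lambda_{G/N}(xN)=\int_G f(x)\,d\lambda_G(x)$ for all $f\in L^1(G)=L^1(G,\lambda_G)$. Let $\mathrm{q}:G\to G/N$, $\mathrm{q}(x)=xN$. $\mathcal{C}_\xi(G,N)$ is the space of continuous functions $\psi:G\to\mathbb{C}$ such that $\mathrm{q}(\mathrm{supp}(\psi))$ is compact in $G/N$ and $\psi(xk)=\xi(k)\psi(x)$ for all $x\in G$, $k\in N$. For $\psi\in\mathcal{C}_\xi(G,N)$ the function $|\psi|$ is constant on cosets of $N$ and $\|\psi\|_{(1)}:=\int_{G/N}|\psi(y)|\,d\lambda_{G/N}(yN)$. $L^1_\xi(G,N)$ is the Banach completion of $(\mathcal{C}_\xi(G,N),\|\cdot\|_{(1)})$. For $f\in\mathcal{C}_c(G)$ (continuous, compactly supported, complex valued), $T_\xi(f)(x):=\int_N f(xs)\overline{\xi(s)}\,d\lambda_N(s)$,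 $x\in G$; this maps $\mathcal{C}_c(G)$ into $\mathcal{C}_\xi(G,N)$ and is a contraction from $\|\cdot\|_{L^1(G)}$ to $\|\cdot\|_{(1)}$, so it has a unique extension to a bounded linear operator $T_\xi:L^1(G)\to L^1_\xi(G,N)$. $\mathcal{N}^1_\xi(G,N):=\{f\in L^1(G):T_\xi(f)=0\text{ in }L^1_\xi(G,N)\}$ is the kernel of this extension. *)

theory Defs
  imports "HOL-Analysis.Analysis" "HOL-Algebra.AbelCoset" "HOL-Algebra.Module"
begin

section \<open>Locally compact groups\<close>

locale topological_group = group G for G (structure) +
  fixes T :: "'a topology"
  assumes topspace_eq: "topspace T = carrier G"
    and continuous_mult: "continuous_map (prod_topology T T) T (\<lambda>(x, y). x \<otimes> y)"
    and continuous_inv: "continuous_map T T (\<lambda>x. inv x)"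

locale locally_compact_group = topological_group +
  assumes locally_compact: "locally_compact_space T"
    and Hausdorff: "Hausdorff_space T"

text \<open>The quotient topology on \<open>G/N\<close>, i.e. the final topology for \<open>x \<mapsto> xN\<close>.\<close>

definition coset_topology :: "('a, 'm) monoid_scheme \<Rightarrow> 'a topology \<Rightarrow> 'a set \<Rightarrow> 'a set topology"
  where "coset_topology G T N =
    topology (\<lambda>U. U \<subseteq> carrier (G Mod N) \<and> openin T {x \<in> carrier G. x <#\<^bsub>G\<^esub> N \<in> U})"

lemma openin_coset_topology:
  "openin (coset_topology G T N) U \<longleftrightarrow>
    U \<subseteq> carrier (G Mod N) \<and> openin T {x \<in> carrier G. x <#\<^bsub>G\<^esub> N \<in> U}"
proof -
  have "istopology (\<lambda>U. U \<subseteq> carrier (G Mod N) \<and> openin T {x \<in> carrier G. x <#\<^bsub>G\<^esub> N \<in> U})"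
    unfolding istopology_def
  proof (intro conjI allI impI)
    fix U V
    assume "U \<subseteq> carrier (G Mod N) \<and> openin T {x \<in> carrier G. x <#\<^bsub>G\<^esub> N \<in> U}"
      and "V \<subseteq> carrier (G Mod N) \<and> openin T {x \<in> carrier G. x <#\<^bsub>G\<^esub> N \<in> V}"
    moreover have "{x \<in> carrier G. x <#\<^bsub>G\<^esub> N \<in> U \<inter> V} =
        {x \<in> carrier G. x <#\<^bsub>G\<^esub> N \<in> U} \<inter> {x \<in> carrier G. x <#\<^bsub>G\<^esub> N \<in> V}"
      by blast
    ultimately show "U \<inter> V \<subseteq> carrier (G Mod N)"
      and "openin T {x \<in> carrier G. x <#\<^bsub>G\<^esub> N \<in> U \<inter> V}"
      by auto
  next
    fix \<U>
    assume U: "\<forall>U\<in>\<U>. U \<subseteq> carrier (G Mod N) \<and> openin T {x \<in> carrier G. x <#\<^bsub>G\<^esub> N \<in> U}"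
    then show "\<Union>\<U> \<subseteq> carrier (G Mod N)"
      by blast
    have "{x \<in> carrier G. x <#\<^bsub>G\<^esub> N \<in> \<Union>\<U>} = (\<Union>U\<in>\<U>. {x \<in> carrier G. x <#\<^bsub>G\<^esub> N \<in> U})"
      by blast
    then show "openin T {x \<in> carrier G. x <#\<^bsub>G\<^esub> N \<in> \<Union>\<U>}"
      using U by (auto intro: openin_Union)
  qed
  then show ?thesis
    unfolding coset_topology_def by simp
qed

lemma quotient_map_coset_topology:
  assumes "topological_group G T" "N \<lhd> G"
  shows "quotient_map T (coset_topology G T N) (\<lambda>x. x <#\<^bsub>G\<^esub> N)"
proof -
  interpret topological_group G T by fact
  interpret N: normal N G by fact
  have im: "(\<lambda>x. x <#\<^bsub>G\<^esub> N) ` carrier G = carrier (G Mod N)"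
    using N.coset_eq unfolding FactGroup_def RCOSETS_def by auto
  then have "{x \<in> carrier G. x <#\<^bsub>G\<^esub> N \<in> carrier (G Mod N)} = topspace T"
    by (auto simp: topspace_eq)
  then have "openin (coset_topology G T N) (carrier (G Mod N))"
    by (simp add: openin_coset_topology)
  moreover have "topspace (coset_topology G T N) \<subseteq> carrier (G Mod N)"
    using openin_coset_topology openin_topspace by blast
  ultimately have "topspace (coset_topology G T N) = carrier (G Mod N)"
    by (simp add: openin_subset subset_antisym)
  then show ?thesis
    by (simp add: quotient_map_def openin_coset_topology im topspace_eq)
qed

definition circle_group :: "complex monoid"
  where "circle_group = \<lparr>carrier = {z. norm z = 1}, mult = (*), one = 1\<rparr>"

definition characters :: "('a, 'm) monoid_scheme \<Rightarrow> 'a topology \<Rightarrow> ('a \<Rightarrow> complex) set"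
  where "characters H S = {\<xi> \<in> hom H circle_group. continuous_map S euclidean \<xi>}"


section \<open>Haar measures\<close>

text \<open>Regularity convention: locally finite, outer regular on Borel sets, inner regular on open
  sets. Inner regularity on all Borel sets is not required, and may fail if the group is not
  \<open>\<sigma>\<close>-compact.\<close>

definition left_haar_measure :: "('a, 'm) monoid_scheme \<Rightarrow> 'a topology \<Rightarrow> 'a measure \<Rightarrow> bool"
  where "left_haar_measure G T M \<longleftrightarrow>
    sets M = sets (sigma (topspace T) {U. openin T U}) \<and>
    emeasure M (space M) \<noteq> 0 \<and>
    (\<forall>x\<in>carrier G. \<forall>A\<in>sets M. emeasure M (x <#\<^bsub>G\<^esub> A) = emeasure M A) \<and>
    (\<forall>K. compactin T K \<longrightarrow> emeasure M K < \<infinity>) \<and>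
    (\<forall>A\<in>sets M. emeasure M A = (INF U\<in>{U. openin T U \<and> A \<subseteq> U}. emeasure M U)) \<and>
    (\<forall>U. openin T U \<longrightarrow> emeasure M U = (SUP K\<in>{K. compactin T K \<and> K \<subseteq> U}. emeasure M K))"

text \<open>For \<open>F\<close> constant on the cosets of \<open>N\<close>, the function \<open>xN \<mapsto> F x\<close> on \<open>G/N\<close>.\<close>

definition on_cosets :: "('a \<Rightarrow> 'b) \<Rightarrow> 'a set \<Rightarrow> 'b"
  where "on_cosets F C = F (SOME x. x \<in> C)"

definition weil_formula ::
  "('a, 'm) monoid_scheme \<Rightarrow> 'a measure \<Rightarrow> 'a measure \<Rightarrow> 'a set measure \<Rightarrow> bool"
  where "weil_formula G \<mu>G \<mu>N \<mu>Q \<longleftrightarrow>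
    (\<forall>f :: 'a \<Rightarrow> complex. integrable \<mu>G f \<longrightarrow>
      (\<integral>C. on_cosets (\<lambda>x. \<integral>s. f (x \<otimes>\<^bsub>G\<^esub> s) \<partial>\<mu>N) C \<partial>\<mu>Q) = (\<integral>x. f x \<partial>\<mu>G))"


section \<open>Complex seminormed spaces, quotients and completions\<close>

text \<open>The ring multiplication and unit inherited from the record \<open>module\<close> play no role.\<close>

record 'v seminormed = "(complex, 'v) module" +
  seminorm :: "'v \<Rightarrow> real"

definition function_space :: "('a \<Rightarrow> complex) set \<Rightarrow> (('a \<Rightarrow> complex) \<Rightarrow> real) \<Rightarrow> ('a \<Rightarrow> complex) seminormed"
  where "function_space F p =
    \<lparr>carrier = F, mult = undefined, one = undefined, zero = (\<lambda>x. 0), add = (\<lambda>f g x. f x + g x),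
     smult = (\<lambda>c f x. c * f x), seminorm = p\<rparr>"

definition quotient_space :: "'v seminormed \<Rightarrow> 'v set \<Rightarrow> 'v set seminormed"
  where "quotient_space V W =
    \<lparr>carrier = a_rcosets\<^bsub>V\<^esub> W, mult = undefined, one = undefined, zero = W, add = set_add V,
     smult = (\<lambda>c A. \<Union>a\<in>A. W +>\<^bsub>V\<^esub> (c \<odot>\<^bsub>V\<^esub> a)),
     seminorm = (\<lambda>A. INF a\<in>A. seminorm V a)\<rparr>"

definition null_space :: "'v seminormed \<Rightarrow> 'v set"
  where "null_space V = {v \<in> carrier V. seminorm V v = 0}"

text \<open>The normed space associated with a seminormed space.\<close>

definition separation :: "'v seminormed \<Rightarrow> 'v set seminormed"
  where "separation V = quotient_space V (null_space V)"

definition sep_class :: "'v seminormed \<Rightarrow> 'v \<Rightarrow> 'v set"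
  where "sep_class V v = null_space V +>\<^bsub>V\<^esub> v"

definition cauchy_space :: "'v seminormed \<Rightarrow> (nat \<Rightarrow> 'v) seminormed"
  where "cauchy_space V =
    \<lparr>carrier = {u. (\<forall>n. u n \<in> carrier V) \<and>
        (\<forall>e>0. \<exists>k. \<forall>m\<ge>k. \<forall>n\<ge>k. seminorm V (u m \<ominus>\<^bsub>V\<^esub> u n) < e)},
     mult = undefined, one = undefined, zero = (\<lambda>n. \<zero>\<^bsub>V\<^esub>), add = (\<lambda>u v n. u n \<oplus>\<^bsub>V\<^esub> v n),
     smult = (\<lambda>c u n. c \<odot>\<^bsub>V\<^esub> u n), seminorm = (\<lambda>u. lim (\<lambda>n. seminorm V (u n)))\<rparr>"

definition completion :: "'v seminormed \<Rightarrow> (nat \<Rightarrow> 'v) set seminormed"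
  where "completion V = separation (cauchy_space V)"

definition to_completion :: "'v seminormed \<Rightarrow> 'v \<Rightarrow> (nat \<Rightarrow> 'v) set"
  where "to_completion V v = sep_class (cauchy_space V) (\<lambda>n. v)"

definition linear_maps :: "'v seminormed \<Rightarrow> 'w seminormed \<Rightarrow> ('v \<Rightarrow> 'w) set"
  where "linear_maps V W = {S \<in> carrier V \<rightarrow> carrier W.
    (\<forall>x\<in>carrier V. \<forall>y\<in>carrier V. S (x \<oplus>\<^bsub>V\<^esub> y) = S x \<oplus>\<^bsub>W\<^esub> S y) \<and>
    (\<forall>c. \<forall>x\<in>carrier V. S (c \<odot>\<^bsub>V\<^esub> x) = c \<odot>\<^bsub>W\<^esub> S x)}"

definition bounded_linear_maps :: "'v seminormed \<Rightarrow> 'w seminormed \<Rightarrow> ('v \<Rightarrow> 'w) set"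
  where "bounded_linear_maps V W = {S \<in> linear_maps V W.
    \<exists>B. \<forall>x\<in>carrier V. seminorm W (S x) \<le> B * seminorm V x}"

definition isometrically_isomorphic :: "'v seminormed \<Rightarrow> 'w seminormed \<Rightarrow> bool"
  where "isometrically_isomorphic V W \<longleftrightarrow>
    (\<exists>\<phi>\<in>linear_maps V W. bij_betw \<phi> (carrier V) (carrier W) \<and>
      (\<forall>x\<in>carrier V. seminorm W (\<phi> x) = seminorm V x))"


section \<open>The function spaces\<close>

definition L1_functions :: "'a measure \<Rightarrow> ('a \<Rightarrow> complex) seminormed"
  where "L1_functions M = function_space {f. integrable M f} (\<lambda>f. \<integral>x. norm (f x) \<partial>M)"

definition L1 :: "'a measure \<Rightarrow> ('a \<Rightarrow> complex) set seminormed"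
  where "L1 M = separation (L1_functions M)"

definition topological_support :: "'a topology \<Rightarrow> ('a \<Rightarrow> complex) \<Rightarrow> 'a set"
  where "topological_support T f = T closure_of {x \<in> topspace T. f x \<noteq> 0}"

text \<open>A continuous function on the group is represented by its extension by zero to the whole type
  \<^typ>\<open>'a\<close>, so that equality of functions is equality on the group.\<close>

definition C_c :: "'a topology \<Rightarrow> ('a \<Rightarrow> complex) set"
  where "C_c T = {f. continuous_map T euclidean f \<and> compactin T (topological_support T f) \<and>
    (\<forall>x. x \<notin> topspace T \<longrightarrow> f x = 0)}"

definition C_xi_functions ::
  "('a, 'm) monoid_scheme \<Rightarrow> 'a topology \<Rightarrow> 'a set \<Rightarrow> ('a \<Rightarrow> complex) \<Rightarrow> ('a \<Rightarrow> complex) set"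
  where "C_xi_functions G T N \<xi> = {\<psi>. continuous_map T euclidean \<psi> \<and>
    compactin (coset_topology G T N) ((\<lambda>x. x <#\<^bsub>G\<^esub> N) ` topological_support T \<psi>) \<and>
    (\<forall>x\<in>carrier G. \<forall>k\<in>N. \<psi> (x \<otimes>\<^bsub>G\<^esub> k) = \<xi> k * \<psi> x) \<and>
    (\<forall>x. x \<notin> topspace T \<longrightarrow> \<psi> x = 0)}"

definition C_xi ::
  "('a, 'm) monoid_scheme \<Rightarrow> 'a topology \<Rightarrow> 'a set \<Rightarrow> ('a \<Rightarrow> complex) \<Rightarrow> 'a set measure
    \<Rightarrow> ('a \<Rightarrow> complex) seminormed"
  where "C_xi G T N \<xi> \<mu>Q =
    function_space (C_xi_functions G T N \<xi>) (\<lambda>\<psi>. \<integral>C. on_cosets (\<lambda>y. norm (\<psi> y)) C \<partial>\<mu>Q)"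

definition L1_xi ::
  "('a, 'm) monoid_scheme \<Rightarrow> 'a topology \<Rightarrow> 'a set \<Rightarrow> ('a \<Rightarrow> complex) \<Rightarrow> 'a set measure
    \<Rightarrow> (nat \<Rightarrow> 'a \<Rightarrow> complex) set seminormed"
  where "L1_xi G T N \<xi> \<mu>Q = completion (C_xi G T N \<xi> \<mu>Q)"

definition T_xi ::
  "('a, 'm) monoid_scheme \<Rightarrow> ('a \<Rightarrow> complex) \<Rightarrow> 'a measure \<Rightarrow> ('a \<Rightarrow> complex) \<Rightarrow> 'a \<Rightarrow> complex"
  where "T_xi G \<xi> \<mu>N f x =
    (if x \<in> carrier G then \<integral>s. f (x \<otimes>\<^bsub>G\<^esub> s) * cnj (\<xi> s) \<partial>\<mu>N else 0)"

text \<open>The unique bounded linear extension of \<^const>\<open>T_xi\<close>; values off the carrier are fixed by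
  \<^const>\<open>extensional\<close> so that uniqueness holds for HOL functions.\<close>

definition T_xi_ext ::
  "('a, 'm) monoid_scheme \<Rightarrow> 'a topology \<Rightarrow> 'a set \<Rightarrow> ('a \<Rightarrow> complex) \<Rightarrow>
    'a measure \<Rightarrow> 'a measure \<Rightarrow> 'a set measure \<Rightarrow>
    ('a \<Rightarrow> complex) set \<Rightarrow> (nat \<Rightarrow> 'a \<Rightarrow> complex) set"
  where "T_xi_ext G T N \<xi> \<mu>G \<mu>N \<mu>Q =
    (THE S. S \<in> bounded_linear_maps (L1 \<mu>G) (L1_xi G T N \<xi> \<mu>Q) \<and>
      S \<in> extensional (carrier (L1 \<mu>G)) \<and>
      (\<forall>f\<in>C_c T. S (sep_class (L1_functions \<mu>G) f) =
        to_completion (C_xi G T N \<xi> \<mu>Q) (T_xi G \<xi> \<mu>N f)))"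

definition N1_xi ::
  "('a, 'm) monoid_scheme \<Rightarrow> 'a topology \<Rightarrow> 'a set \<Rightarrow> ('a \<Rightarrow> complex) \<Rightarrow>
    'a measure \<Rightarrow> 'a measure \<Rightarrow> 'a set measure \<Rightarrow> ('a \<Rightarrow> complex) set set"
  where "N1_xi G T N \<xi> \<mu>G \<mu>N \<mu>Q =
    {f \<in> carrier (L1 \<mu>G). T_xi_ext G T N \<xi> \<mu>G \<mu>N \<mu>Q f = \<zero>\<^bsub>L1_xi G T N \<xi> \<mu>Q\<^esub>}"

end

theory Submission
  imports Defs
begin

text \<open>
  The isomorphism sends \<open>w\<close> in \<open>L1_xi\<close> to its fibre \<open>{f \<in> L1. T_xi f = w}\<close>, a coset of the kernel
  \<open>N1_xi\<close>. This is an isometry for the quotient norm as soon as \<open>T_xi\<close> does not increase norms and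
  every \<open>w\<close> has preimages of norm at most \<open>\<parallel>w\<parallel> + e\<close> for each \<open>e > 0\<close>; this is
  \<open>isometrically_isomorphic_quotient_kernel\<close>. So everything rests on producing small preimages.

  On the dense subspace \<open>C_xi\<close> preimages exist without any loss of norm (\<open>T_xi_isometric_lift\<close>). Given
  \<open>\<psi>\<close> in \<open>C_xi\<close>, choose \<open>g \<ge> 0\<close> in \<open>C_c\<close> whose integral \<open>\<Phi>\<close> over the coset \<open>xN\<close> is nonzero
  for all \<open>x\<close> in the support of \<open>\<psi>\<close>, and put \<open>f = \<psi> g / \<Phi>\<close>. Since \<open>\<psi>\<close> is covariant and \<open>\<Phi>\<close> is constant
  on cosets, \<open>T_xi f = \<psi>\<close>, and \<open>\<bar>f\<bar>\<close> integrates to \<open>\<bar>\<psi>\<bar>\<close> over each coset, so that Weil's formula gives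
  \<open>\<parallel>f\<parallel> = \<parallel>\<psi>\<parallel>\<close>. Weil's formula for \<open>\<bar>f\<bar>\<close> also shows that \<open>T_xi\<close> is a contraction on \<open>C_c\<close>.

  Passing to the completion is the standard argument of the open mapping theorem
  (\<open>extension_lift\<close>): an element of the completion is the limit of a sequence in \<open>C_xi\<close> whose
  increments have summable norms; lifting the increments one by one with equal norms yields an
  absolutely convergent series in \<open>L1\<close>, whose sum is the preimage.

  The operator \<open>T_xi_ext\<close> is given by a definite description. That it denotes the continuous extension of
  \<open>T_xi\<close> (\<open>extension_unique\<close>) depends on the density of \<open>C_c\<close> in \<open>L1\<close>, which follows from
  Urysohn's lemma and the regularity of Haar measure (\<open>C_c_dense\<close>). That \<open>T_xi\<close> maps \<open>C_c\<close> into
  \<open>C_xi\<close> needs the continuity of fibre integrals, where the tube lemma replaces uniform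
  continuity (\<open>continuous_fibre_integral\<close>).
\<close>

section \<open>Seminormed spaces\<close>

locale seminormed_space = abelian_group V for V :: "'v seminormed" (structure) +
  assumes smult_closed [simp, intro]: "x \<in> carrier V \<Longrightarrow> c \<odot> x \<in> carrier V"
    and smult_r_distr: "\<lbrakk>x \<in> carrier V; y \<in> carrier V\<rbrakk> \<Longrightarrow> c \<odot> (x \<oplus> y) = c \<odot> x \<oplus> c \<odot> y"
    and smult_l_distr: "x \<in> carrier V \<Longrightarrow> (c + d) \<odot> x = c \<odot> x \<oplus> d \<odot> x"
    and smult_assoc: "x \<in> carrier V \<Longrightarrow> (c * d) \<odot> x = c \<odot> (d \<odot> x)"
    and smult_one [simp]: "x \<in> carrier V \<Longrightarrow> 1 \<odot> x = x"
    and seminorm_add_le: "\<lbrakk>x \<in> carrier V; y \<in> carrier V\<rbrakk> \<Longrightarrow> seminorm V (x \<oplus> y) \<le> seminorm V x + seminorm V y"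
    and seminorm_smult: "x \<in> carrier V \<Longrightarrow> seminorm V (c \<odot> x) = norm c * seminorm V x"
begin

lemma smult_0_left [simp]: "x \<in> carrier V \<Longrightarrow> 0 \<odot> x = \<zero>"
proof -
  assume x: "x \<in> carrier V"
  have "0 \<odot> x \<oplus> 0 \<odot> x = 0 \<odot> x"
    using smult_l_distr[OF x, of 0 0] by simp
  then show ?thesis
    using x by (metis add.r_cancel_one' smult_closed)
qed

lemma smult_minus_1: "x \<in> carrier V \<Longrightarrow> (-1) \<odot> x = \<ominus> x"
proof -
  assume x: "x \<in> carrier V"
  have "(-1) \<odot> x \<oplus> x = \<zero>"
    using smult_l_distr[OF x, of "-1" 1] x by simp
  then show ?thesis
    using x by (simp add: minus_equality)
qed

lemma smult_minus_right: "x \<in> carrier V \<Longrightarrow> c \<odot> (\<ominus> x) = \<ominus> (c \<odot> x)"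
  using smult_assoc[of x c "-1"] smult_assoc[of x "-1" c] by (simp add: smult_minus_1)

lemma smult_diff_right: "\<lbrakk>x \<in> carrier V; y \<in> carrier V\<rbrakk> \<Longrightarrow> c \<odot> (x \<ominus> y) = c \<odot> x \<ominus> c \<odot> y"
  by (simp add: minus_eq smult_r_distr smult_minus_right)

lemma smult_0_right [simp]: "c \<odot> \<zero> = \<zero>"
  using smult_assoc[of \<zero> c 0] by simp

lemma seminorm_zero [simp]: "seminorm V \<zero> = 0"
  using seminorm_smult[of \<zero> 0] by simp

lemma seminorm_minus [simp]: "x \<in> carrier V \<Longrightarrow> seminorm V (\<ominus> x) = seminorm V x"
  using seminorm_smult[of x "-1"] by (simp add: smult_minus_1)

lemma seminorm_nonneg [simp]: "x \<in> carrier V \<Longrightarrow> 0 \<le> seminorm V x"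
  using seminorm_add_le[of x "\<ominus> x"] by (simp add: r_neg)

lemma seminorm_diff_commute:
  assumes "x \<in> carrier V" "y \<in> carrier V"
  shows "seminorm V (x \<ominus> y) = seminorm V (y \<ominus> x)"
proof -
  have "\<ominus> (x \<ominus> y) = y \<ominus> x"
    using assms by (simp add: minus_eq minus_add a_comm)
  then show ?thesis
    using assms by (metis minus_closed seminorm_minus)
qed

lemma diff_self [simp]: "x \<in> carrier V \<Longrightarrow> x \<ominus> x = \<zero>"
  by (simp add: minus_eq r_neg)

lemma diff_zero [simp]: "x \<in> carrier V \<Longrightarrow> x \<ominus> \<zero> = x"
  using smult_minus_1[of \<zero>] by (simp add: minus_eq)

lemma diff_add_diff:
  "\<lbrakk>x \<in> carrier V; y \<in> carrier V; z \<in> carrier V\<rbrakk> \<Longrightarrow> (x \<ominus> y) \<oplus> (y \<ominus> z) = x \<ominus> z"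
  by (simp add: minus_eq a_assoc r_neg1)

lemma diff_add_distrib:
  "\<lbrakk>x \<in> carrier V; y \<in> carrier V; x' \<in> carrier V; y' \<in> carrier V\<rbrakk> \<Longrightarrow>
    (x \<oplus> y) \<ominus> (x' \<oplus> y') = (x \<ominus> x') \<oplus> (y \<ominus> y')"
  by (simp add: minus_eq a_ac minus_add)

lemma diff_add_cancel [simp]:
  "\<lbrakk>x \<in> carrier V; y \<in> carrier V\<rbrakk> \<Longrightarrow> (x \<ominus> y) \<oplus> y = x"
  by (simp add: minus_eq a_assoc l_neg)

lemma seminorm_diff_triangle:
  "\<lbrakk>x \<in> carrier V; y \<in> carrier V; z \<in> carrier V\<rbrakk> \<Longrightarrow>
    seminorm V (x \<ominus> z) \<le> seminorm V (x \<ominus> y) + seminorm V (y \<ominus> z)"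
  using seminorm_add_le[of "x \<ominus> y" "y \<ominus> z"] by (simp add: diff_add_diff)

lemma seminorm_diff_ge:
  assumes "x \<in> carrier V" "y \<in> carrier V"
  shows "\<bar>seminorm V x - seminorm V y\<bar> \<le> seminorm V (x \<ominus> y)"
  using seminorm_add_le[of "x \<ominus> y" y] seminorm_add_le[of "y \<ominus> x" x] seminorm_diff_commute[of x y] assms
  by simp

lemma seminorm_add_diff_le:
  "\<lbrakk>x \<in> carrier V; y \<in> carrier V; x' \<in> carrier V; y' \<in> carrier V\<rbrakk> \<Longrightarrow>
    seminorm V ((x \<oplus> y) \<ominus> (x' \<oplus> y')) \<le> seminorm V (x \<ominus> x') + seminorm V (y \<ominus> y')"
  by (simp add: diff_add_distrib seminorm_add_le)

end

section \<open>Quotients and separation\<close>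

definition linear_subspace :: "'v seminormed \<Rightarrow> 'v set \<Rightarrow> bool"
  where "linear_subspace V W \<longleftrightarrow> W \<subseteq> carrier V \<and> \<zero>\<^bsub>V\<^esub> \<in> W \<and>
    (\<forall>x\<in>W. \<forall>y\<in>W. x \<oplus>\<^bsub>V\<^esub> y \<in> W) \<and> (\<forall>c. \<forall>x\<in>W. c \<odot>\<^bsub>V\<^esub> x \<in> W)"

context seminormed_space
begin

lemma linear_subspace_abelian_subgroup:
  assumes "linear_subspace V W"
  shows "abelian_subgroup W V"
proof -
  have "additive_subgroup W V"
  proof (rule additive_subgroupI, rule add.subgroupI)
    show "W \<subseteq> carrier V" "W \<noteq> {}"
      using assms by (auto simp: linear_subspace_def)
    show "\<ominus> a \<in> W" if "a \<in> W" for a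
      using assms that smult_minus_1[of a] unfolding linear_subspace_def by (metis subsetD)
  qed (use assms in \<open>auto simp: linear_subspace_def\<close>)
  then show ?thesis
    using abelian_subgroupI3 abelian_group_axioms by blast
qed

context
  fixes W assumes W: "linear_subspace V W"
begin

interpretation W: abelian_subgroup W V
  by (rule linear_subspace_abelian_subgroup[OF W])

lemma coset_eq_iff:
  assumes "x \<in> carrier V" "y \<in> carrier V"
  shows "W +> x = W +> y \<longleftrightarrow> x \<ominus> y \<in> W"
  using assms W.a_rcos_module[of y x] W.a_rcos_self[of x] W.a_repr_independence'[of x y]
  by (auto simp: minus_eq)

lemma carrier_quotient_space: "carrier (quotient_space V W) = (\<lambda>x. W +> x) ` carrier V"
  by (auto simp: quotient_space_def A_RCOSETS_def')

lemma add_quotient_space: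
  "\<lbrakk>x \<in> carrier V; y \<in> carrier V\<rbrakk> \<Longrightarrow>
    (W +> x) \<oplus>\<^bsub>quotient_space V W\<^esub> (W +> y) = W +> (x \<oplus> y)"
  by (simp add: quotient_space_def W.a_rcos_sum)

lemma zero_quotient_space: "\<zero>\<^bsub>quotient_space V W\<^esub> = W +> \<zero>"
  by (simp add: quotient_space_def W.a_subset)

text \<open>
  The union in the definition of the scalar multiplication is needed for \<open>c = 0\<close>, where
  \<open>c \<cdot> A\<close> is a single point; adding \<open>W\<close> makes every summand of the union the same coset.
\<close>

lemma smult_quotient_space:
  assumes x: "x \<in> carrier V"
  shows "c \<odot>\<^bsub>quotient_space V W\<^esub> (W +> x) = W +> (c \<odot> x)"
proof -
  have "W +> (c \<odot> a) = W +> (c \<odot> x)" if "a \<in> W +> x" for a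
  proof -
    have a: "a \<in> carrier V"
      using that x W.a_elemrcos_carrier by blast
    have "a \<ominus> x \<in> W"
      using W.a_rcos_module[OF x a] that by (simp add: minus_eq)
    then have "c \<odot> a \<ominus> c \<odot> x \<in> W"
      using W a x by (simp add: linear_subspace_def flip: smult_diff_right)
    then show ?thesis
      using a x coset_eq_iff by simp
  qed
  moreover have "x \<in> W +> x"
    using x W.a_rcos_self by blast
  ultimately have "(\<Union>a\<in>W +> x. W +> (c \<odot> a)) = W +> (c \<odot> x)"
    by blast
  then show ?thesis
    by (simp add: quotient_space_def)
qed

lemma quotient_space_group: "abelian_group (quotient_space V W)"
proof (rule abelian_groupI)
  fix x y z
  assume "x \<in> carrier (quotient_space V W)" "y \<in> carrier (quotient_space V W)"
    "z \<in> carrier (quotient_space V W)"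
  then show "x \<oplus>\<^bsub>quotient_space V W\<^esub> y \<oplus>\<^bsub>quotient_space V W\<^esub> z =
      x \<oplus>\<^bsub>quotient_space V W\<^esub> (y \<oplus>\<^bsub>quotient_space V W\<^esub> z)"
    by (auto simp: carrier_quotient_space add_quotient_space a_assoc)
next
  fix x
  assume "x \<in> carrier (quotient_space V W)"
  then obtain a where "a \<in> carrier V" "x = W +> a"
    by (auto simp: carrier_quotient_space)
  then have "(W +> \<ominus> a) \<oplus>\<^bsub>quotient_space V W\<^esub> x = \<zero>\<^bsub>quotient_space V W\<^esub>"
    by (simp add: add_quotient_space zero_quotient_space l_neg)
  then show "\<exists>y\<in>carrier (quotient_space V W). y \<oplus>\<^bsub>quotient_space V W\<^esub> x = \<zero>\<^bsub>quotient_space V W\<^esub>"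
    using \<open>a \<in> carrier V\<close> by (auto simp: carrier_quotient_space)
qed (auto simp: carrier_quotient_space add_quotient_space zero_quotient_space a_comm simp del: a_coset_add_zero)

end

lemma linear_subspace_null_space: "linear_subspace V (null_space V)"
proof -
  have "seminorm V (x \<oplus> y) = 0" if "x \<in> null_space V" "y \<in> null_space V" for x y
    using that seminorm_add_le[of x y] seminorm_nonneg[of "x \<oplus> y"]
    by (force simp: null_space_def simp del: seminorm_nonneg)
  then show ?thesis
    by (auto simp: linear_subspace_def null_space_def seminorm_smult)
qed

lemma sep_class_eq_iff:
  "\<lbrakk>x \<in> carrier V; y \<in> carrier V\<rbrakk> \<Longrightarrow> sep_class V x = sep_class V y \<longleftrightarrow> seminorm V (x \<ominus> y) = 0"
  unfolding sep_class_def
  by (subst coset_eq_iff[OF linear_subspace_null_space]) (simp_all add: null_space_def)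

lemma carrier_separation: "carrier (separation V) = sep_class V ` carrier V"
  unfolding separation_def sep_class_def
  by (rule carrier_quotient_space[OF linear_subspace_null_space])

lemma add_separation:
  "\<lbrakk>x \<in> carrier V; y \<in> carrier V\<rbrakk> \<Longrightarrow>
    sep_class V x \<oplus>\<^bsub>separation V\<^esub> sep_class V y = sep_class V (x \<oplus> y)"
  unfolding separation_def sep_class_def
  by (rule add_quotient_space[OF linear_subspace_null_space])

lemma smult_separation:
  "x \<in> carrier V \<Longrightarrow> c \<odot>\<^bsub>separation V\<^esub> sep_class V x = sep_class V (c \<odot> x)"
  unfolding separation_def sep_class_def
  by (rule smult_quotient_space[OF linear_subspace_null_space])

lemma zero_separation: "\<zero>\<^bsub>separation V\<^esub> = sep_class V \<zero>"
  unfolding separation_def sep_class_def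
  by (rule zero_quotient_space[OF linear_subspace_null_space])

lemma sep_class_self: "x \<in> carrier V \<Longrightarrow> x \<in> sep_class V x"
  unfolding sep_class_def
  by (rule abelian_subgroup.a_rcos_self[OF linear_subspace_abelian_subgroup[OF linear_subspace_null_space]])

text \<open>
  The seminorm is constant on classes modulo the null space, so the infimum in the quotient
  seminorm is taken over a single value.
\<close>

lemma seminorm_separation:
  assumes x: "x \<in> carrier V"
  shows "seminorm (separation V) (sep_class V x) = seminorm V x"
proof -
  interpret N: abelian_subgroup "null_space V" V
    by (rule linear_subspace_abelian_subgroup[OF linear_subspace_null_space])
  have "seminorm V a = seminorm V x" if "a \<in> sep_class V x" for a
  proof -
    have a: "a \<in> carrier V"
      using N.a_elemrcos_carrier[OF x] that unfolding sep_class_def by blast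
    have "sep_class V a = sep_class V x"
      using N.a_repr_independence'[OF _ x] that unfolding sep_class_def by simp
    then have "seminorm V (a \<ominus> x) = 0"
      using a x sep_class_eq_iff by blast
    then show ?thesis
      using seminorm_diff_ge[OF a x] by simp
  qed
  moreover have "sep_class V x \<noteq> {}"
    using sep_class_self[OF x] by blast
  ultimately show ?thesis
    by (simp add: separation_def quotient_space_def cong: INF_cong)
qed

lemma seminormed_space_separation: "seminormed_space (separation V)"
proof -
  interpret Q: abelian_group "separation V"
    using quotient_space_group[OF linear_subspace_null_space] by (simp add: separation_def)
  show ?thesis
    by (intro seminormed_space.intro seminormed_space_axioms.intro Q.abelian_group_axioms)
      (auto simp: carrier_separation add_separation smult_separation seminorm_separation
        smult_r_distr smult_l_distr smult_assoc seminorm_add_le seminorm_smult)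
qed

lemma separation_definite:
  "\<lbrakk>x \<in> carrier (separation V); seminorm (separation V) x = 0\<rbrakk> \<Longrightarrow> x = \<zero>\<^bsub>separation V\<^esub>"
  unfolding carrier_separation zero_separation
  by (elim imageE) (simp add: seminorm_separation sep_class_eq_iff)

lemma separation_eqI:
  assumes "x \<in> carrier (separation V)" "y \<in> carrier (separation V)"
    "seminorm (separation V) (x \<ominus>\<^bsub>separation V\<^esub> y) = 0"
  shows "x = y"
proof -
  interpret Q: seminormed_space "separation V" by (rule seminormed_space_separation)
  show ?thesis
    using separation_definite[of "x \<ominus>\<^bsub>separation V\<^esub> y"] assms
    by (metis Q.diff_add_cancel Q.l_zero Q.minus_closed)
qed

end

section \<open>Function spaces and Cauchy sequences\<close>

lemma function_space_simps [simp]: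
  "carrier (function_space F p) = F" "\<zero>\<^bsub>function_space F p\<^esub> = (\<lambda>x. 0)"
  "f \<oplus>\<^bsub>function_space F p\<^esub> g = (\<lambda>x. f x + g x)" "c \<odot>\<^bsub>function_space F p\<^esub> f = (\<lambda>x. c * f x)"
  "seminorm (function_space F p) f = p f"
  by (simp_all add: function_space_def)

lemma seminormed_space_function_space:
  assumes zero: "(\<lambda>x. 0) \<in> F"
    and add: "\<And>f g. \<lbrakk>f \<in> F; g \<in> F\<rbrakk> \<Longrightarrow> (\<lambda>x. f x + g x) \<in> F"
    and smult: "\<And>c f. f \<in> F \<Longrightarrow> (\<lambda>x. c * f x) \<in> F"
    and add_le: "\<And>f g. \<lbrakk>f \<in> F; g \<in> F\<rbrakk> \<Longrightarrow> p (\<lambda>x. f x + g x) \<le> p f + p g"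
    and p_smult: "\<And>c f. f \<in> F \<Longrightarrow> p (\<lambda>x. c * f x) = norm c * p f"
  shows "seminormed_space (function_space F p)"
proof -
  have "abelian_group (function_space F p)"
  proof (rule abelian_groupI)
    fix f assume "f \<in> carrier (function_space F p)"
    then have "(\<lambda>x. - 1 * f x) \<in> F"
      by (intro smult) simp
    then show "\<exists>g\<in>carrier (function_space F p). g \<oplus>\<^bsub>function_space F p\<^esub> f = \<zero>\<^bsub>function_space F p\<^esub>"
      by (intro bexI[of _ "\<lambda>x. - 1 * f x"]) auto
  qed (use zero add in \<open>auto simp: add_ac\<close>)
  then show ?thesis
    by (intro seminormed_space.intro seminormed_space_axioms.intro)
      (auto simp: smult algebra_simps add_le p_smult)
qed

lemma function_space_minus:
  assumes "seminormed_space (function_space F p)" "f \<in> F" "g \<in> F"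
  shows "f \<ominus>\<^bsub>function_space F p\<^esub> g = (\<lambda>x. f x - g x)"
proof -
  interpret seminormed_space "function_space F p" by fact
  show ?thesis
    using assms(2,3) smult_minus_1[of g] by (simp add: minus_eq fun_eq_iff)
qed

lemma carrier_cauchy_space: "carrier (cauchy_space V) = {u. (\<forall>n. u n \<in> carrier V) \<and>
    (\<forall>e>0. \<exists>k. \<forall>m\<ge>k. \<forall>n\<ge>k. seminorm V (u m \<ominus>\<^bsub>V\<^esub> u n) < e)}"
  by (simp add: cauchy_space_def)

lemma seminorm_cauchy_space: "seminorm (cauchy_space V) u = lim (\<lambda>n. seminorm V (u n))"
  by (simp add: cauchy_space_def)

lemma cauchy_space_simps [simp]:
  "\<zero>\<^bsub>cauchy_space V\<^esub> = (\<lambda>n. \<zero>\<^bsub>V\<^esub>)"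
  "u \<oplus>\<^bsub>cauchy_space V\<^esub> v = (\<lambda>n. u n \<oplus>\<^bsub>V\<^esub> v n)"
  "c \<odot>\<^bsub>cauchy_space V\<^esub> u = (\<lambda>n. c \<odot>\<^bsub>V\<^esub> u n)"
  by (simp_all add: cauchy_space_def)

context seminormed_space
begin

lemma cauchy_spaceI:
  assumes "\<And>n. u n \<in> carrier V"
    "\<And>e. e > 0 \<Longrightarrow> \<exists>k. \<forall>m\<ge>k. \<forall>n\<ge>k. seminorm V (u m \<ominus> u n) < e"
  shows "u \<in> carrier (cauchy_space V)"
  using assms by (simp add: carrier_cauchy_space)

lemma cauchy_space_nth: "u \<in> carrier (cauchy_space V) \<Longrightarrow> u n \<in> carrier V"
  by (simp add: carrier_cauchy_space)

lemma cauchy_spaceD: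
  assumes "u \<in> carrier (cauchy_space V)" "e > 0"
  obtains k where "\<And>m n. \<lbrakk>m \<ge> k; n \<ge> k\<rbrakk> \<Longrightarrow> seminorm V (u m \<ominus> u n) < e"
  using assms unfolding carrier_cauchy_space by fastforce

lemma cauchy_space_add:
  assumes u: "u \<in> carrier (cauchy_space V)" and v: "v \<in> carrier (cauchy_space V)"
  shows "(\<lambda>n. u n \<oplus> v n) \<in> carrier (cauchy_space V)"
proof (rule cauchy_spaceI)
  note [simp] = cauchy_space_nth[OF u] cauchy_space_nth[OF v]
  fix e :: real assume "e > 0"
  then have "e / 2 > 0" by simp
  obtain k where k: "\<And>m n. \<lbrakk>m \<ge> k; n \<ge> k\<rbrakk> \<Longrightarrow> seminorm V (u m \<ominus> u n) < e / 2"
    using cauchy_spaceD[OF u \<open>e / 2 > 0\<close>] by metis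
  obtain l where l: "\<And>m n. \<lbrakk>m \<ge> l; n \<ge> l\<rbrakk> \<Longrightarrow> seminorm V (v m \<ominus> v n) < e / 2"
    using cauchy_spaceD[OF v \<open>e / 2 > 0\<close>] by metis
  have "seminorm V ((u m \<oplus> v m) \<ominus> (u n \<oplus> v n)) < e" if "m \<ge> max k l" "n \<ge> max k l" for m n
    using seminorm_add_diff_le[of "u m" "v m" "u n" "v n"] k[of m n] l[of m n] that u v
    by (simp add: field_simps)
  then show "\<exists>k. \<forall>m\<ge>k. \<forall>n\<ge>k. seminorm V ((u m \<oplus> v m) \<ominus> (u n \<oplus> v n)) < e"
    by blast
qed (simp add: cauchy_space_nth[OF u] cauchy_space_nth[OF v])

lemma cauchy_space_smult:
  assumes u: "u \<in> carrier (cauchy_space V)"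
  shows "(\<lambda>n. c \<odot> u n) \<in> carrier (cauchy_space V)"
proof (rule cauchy_spaceI)
  note [simp] = cauchy_space_nth[OF u]
  fix e :: real assume "e > 0"
  then have "e / (norm c + 1) > 0"
    by (intro divide_pos_pos add_nonneg_pos) auto
  then obtain k where k: "\<And>m n. \<lbrakk>m \<ge> k; n \<ge> k\<rbrakk> \<Longrightarrow> seminorm V (u m \<ominus> u n) < e / (norm c + 1)"
    using cauchy_spaceD[OF u] by metis
  have "seminorm V (c \<odot> u m \<ominus> c \<odot> u n) < e" if "m \<ge> k" "n \<ge> k" for m n
  proof -
    have "seminorm V (c \<odot> u m \<ominus> c \<odot> u n) = norm c * seminorm V (u m \<ominus> u n)"
      using u by (simp add: seminorm_smult flip: smult_diff_right)
    also have "\<dots> \<le> (norm c + 1) * seminorm V (u m \<ominus> u n)"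
      using u by (intro mult_right_mono) auto
    also have "\<dots> < e"
      using k[OF that] by (subst mult.commute, subst pos_less_divide_eq[symmetric])
        (auto intro: add_nonneg_pos)
    finally show ?thesis .
  qed
  then show "\<exists>k. \<forall>m\<ge>k. \<forall>n\<ge>k. seminorm V (c \<odot> u m \<ominus> c \<odot> u n) < e"
    by blast
qed (simp add: cauchy_space_nth[OF u])

lemma cauchy_space_const: "x \<in> carrier V \<Longrightarrow> (\<lambda>n. x) \<in> carrier (cauchy_space V)"
  by (simp add: carrier_cauchy_space)

lemma tendsto_seminorm_cauchy_space:
  assumes u: "u \<in> carrier (cauchy_space V)"
  shows "(\<lambda>n. seminorm V (u n)) \<longlonglongrightarrow> seminorm (cauchy_space V) u"
proof -
  have "Cauchy (\<lambda>n. seminorm V (u n))"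
  proof (rule CauchyI)
    fix e :: real assume "e > 0"
    obtain k where k: "\<And>m n. \<lbrakk>m \<ge> k; n \<ge> k\<rbrakk> \<Longrightarrow> seminorm V (u m \<ominus> u n) < e"
      using cauchy_spaceD[OF u \<open>e > 0\<close>] by metis
    have "norm (seminorm V (u m) - seminorm V (u n)) < e" if "m \<ge> k" "n \<ge> k" for m n
      using seminorm_diff_ge[of "u m" "u n"] k[OF that] cauchy_space_nth[OF u] by simp
    then show "\<exists>M. \<forall>m\<ge>M. \<forall>n\<ge>M. norm (seminorm V (u m) - seminorm V (u n)) < e"
      by blast
  qed
  then show ?thesis
    by (simp add: seminorm_cauchy_space Cauchy_convergent_iff convergent_LIMSEQ_iff)
qed

lemma seminorm_cauchy_spaceI:
  "\<lbrakk>u \<in> carrier (cauchy_space V); (\<lambda>n. seminorm V (u n)) \<longlonglongrightarrow> l\<rbrakk> \<Longrightarrow> seminorm (cauchy_space V) u = l"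
  by (rule LIMSEQ_unique[OF tendsto_seminorm_cauchy_space])

lemma seminormed_space_cauchy_space: "seminormed_space (cauchy_space V)"
proof -
  have "abelian_group (cauchy_space V)"
  proof (rule abelian_groupI)
    fix u assume u: "u \<in> carrier (cauchy_space V)"
    then have "(\<lambda>n. (-1) \<odot> u n) \<in> carrier (cauchy_space V)"
      by (rule cauchy_space_smult)
    then show "\<exists>v\<in>carrier (cauchy_space V). v \<oplus>\<^bsub>cauchy_space V\<^esub> u = \<zero>\<^bsub>cauchy_space V\<^esub>"
      using u cauchy_space_nth[OF u] by (intro bexI[of _ "\<lambda>n. (-1) \<odot> u n"]) (auto simp: smult_minus_1 l_neg)
  qed (auto simp: cauchy_space_add cauchy_space_const a_ac cauchy_space_nth fun_eq_iff)
  moreover have "seminorm (cauchy_space V) (\<lambda>n. u n \<oplus> v n) \<le>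
      seminorm (cauchy_space V) u + seminorm (cauchy_space V) v"
    if "u \<in> carrier (cauchy_space V)" "v \<in> carrier (cauchy_space V)" for u v
    using that cauchy_space_nth[OF that(1)] cauchy_space_nth[OF that(2)]
    by (intro LIMSEQ_le[OF tendsto_seminorm_cauchy_space[OF cauchy_space_add]
          tendsto_add[OF tendsto_seminorm_cauchy_space tendsto_seminorm_cauchy_space]])
      (auto simp: seminorm_add_le)
  moreover have "seminorm (cauchy_space V) (\<lambda>n. c \<odot> u n) = norm c * seminorm (cauchy_space V) u"
    if "u \<in> carrier (cauchy_space V)" for u c
    using that cauchy_space_nth[OF that] tendsto_mult_left[OF tendsto_seminorm_cauchy_space, of u "norm c"]
    by (intro seminorm_cauchy_spaceI) (auto simp: cauchy_space_smult seminorm_smult)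
  ultimately show ?thesis
    by (intro seminormed_space.intro seminormed_space_axioms.intro)
      (auto simp: cauchy_space_smult smult_r_distr smult_l_distr smult_assoc fun_eq_iff
        cauchy_space_nth)
qed

lemma minus_cauchy_space:
  assumes "u \<in> carrier (cauchy_space V)" "v \<in> carrier (cauchy_space V)"
  shows "u \<ominus>\<^bsub>cauchy_space V\<^esub> v = (\<lambda>n. u n \<ominus> v n)"
proof -
  interpret C: seminormed_space "cauchy_space V" by (rule seminormed_space_cauchy_space)
  show ?thesis
    using assms assms[THEN cauchy_space_nth] by (simp add: C.minus_eq minus_eq smult_minus_1 flip: C.smult_minus_1)
qed

text \<open>
  All computations in the completion go through this criterion: two Cauchy sequences represent
  the same point iff their difference tends to zero.
\<close>

lemma sep_class_cauchy_space_eq_iff: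
  assumes u: "u \<in> carrier (cauchy_space V)" and v: "v \<in> carrier (cauchy_space V)"
  shows "sep_class (cauchy_space V) u = sep_class (cauchy_space V) v \<longleftrightarrow>
    (\<lambda>n. seminorm V (u n \<ominus> v n)) \<longlonglongrightarrow> 0"
proof -
  interpret C: seminormed_space "cauchy_space V" by (rule seminormed_space_cauchy_space)
  have "u \<ominus>\<^bsub>cauchy_space V\<^esub> v \<in> carrier (cauchy_space V)"
    using u v by simp
  then have "(\<lambda>n. seminorm V (u n \<ominus> v n)) \<longlonglongrightarrow> seminorm (cauchy_space V) (u \<ominus>\<^bsub>cauchy_space V\<^esub> v)"
    using tendsto_seminorm_cauchy_space u v by (fastforce simp: minus_cauchy_space)
  then show ?thesis
    using u v LIMSEQ_unique by (auto simp: C.sep_class_eq_iff)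
qed

lemma seminormed_space_completion: "seminormed_space (completion V)"
  unfolding completion_def
  by (rule seminormed_space.seminormed_space_separation[OF seminormed_space_cauchy_space])

end

section \<open>Quotients by kernels\<close>

text \<open>
  The inverse of the map induced by \<open>S\<close> is written down directly: it sends \<open>y\<close> to its fibre under
  \<open>S\<close>. Then no choice of representatives is needed, and the quotient norm of the fibre is by
  definition the infimum of the norms of all preimages of \<open>y\<close>.
\<close>

lemma isometrically_isomorphic_quotient_kernel:
  assumes "seminormed_space X" "seminormed_space Y"
    and S: "S \<in> linear_maps X Y"
    and le: "\<And>x. x \<in> carrier X \<Longrightarrow> seminorm Y (S x) \<le> seminorm X x"
    and lift: "\<And>y e. \<lbrakk>y \<in> carrier Y; e > 0\<rbrakk> \<Longrightarrow> \<exists>x\<in>carrier X. S x = y \<and> seminorm X x \<le> seminorm Y y + e"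
  shows "isometrically_isomorphic Y (quotient_space X {x \<in> carrier X. S x = \<zero>\<^bsub>Y\<^esub>})"
proof -
  interpret X: seminormed_space X by fact
  interpret Y: seminormed_space Y by fact
  let ?K = "{x \<in> carrier X. S x = \<zero>\<^bsub>Y\<^esub>}"
  let ?Q = "quotient_space X ?K"
  define \<phi> where "\<phi> y = {x \<in> carrier X. S x = y}" for y
  have S_closed [simp]: "S x \<in> carrier Y" if "x \<in> carrier X" for x
    using S that by (auto simp: linear_maps_def)
  have S_add: "S (x \<oplus>\<^bsub>X\<^esub> x') = S x \<oplus>\<^bsub>Y\<^esub> S x'" if "x \<in> carrier X" "x' \<in> carrier X" for x x'
    using S that by (auto simp: linear_maps_def)
  have S_smult: "S (c \<odot>\<^bsub>X\<^esub> x) = c \<odot>\<^bsub>Y\<^esub> S x" if "x \<in> carrier X" for x c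
    using S that by (auto simp: linear_maps_def)
  have S_zero: "S \<zero>\<^bsub>X\<^esub> = \<zero>\<^bsub>Y\<^esub>"
    using S_smult[of "\<zero>\<^bsub>X\<^esub>" 0] by simp
  have S_diff: "S (x \<ominus>\<^bsub>X\<^esub> x') = S x \<ominus>\<^bsub>Y\<^esub> S x'" if "x \<in> carrier X" "x' \<in> carrier X" for x x'
    using that S_add[of x "(-1) \<odot>\<^bsub>X\<^esub> x'"] S_smult[of x' "-1"]
    by (simp add: X.minus_eq Y.minus_eq X.smult_minus_1 Y.smult_minus_1)
  have K: "linear_subspace X ?K"
    by (auto simp: linear_subspace_def S_zero S_add S_smult)
  note K' = X.linear_subspace_abelian_subgroup[OF K]
  have mem_coset: "z \<in> ?K +>\<^bsub>X\<^esub> x \<longleftrightarrow> z \<ominus>\<^bsub>X\<^esub> x \<in> ?K" if "x \<in> carrier X" "z \<in> carrier X" for x z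
    unfolding X.minus_eq by (rule abelian_subgroup.a_rcos_module[OF K' that])
  have fibre: "\<phi> (S x) = ?K +>\<^bsub>X\<^esub> x" if x: "x \<in> carrier X" for x
  proof (intro equalityI subsetI)
    fix z assume "z \<in> \<phi> (S x)"
    then have z: "z \<in> carrier X" "S z = S x"
      by (auto simp: \<phi>_def)
    then have "z \<ominus>\<^bsub>X\<^esub> x \<in> ?K"
      using x by (simp add: S_diff)
    then show "z \<in> ?K +>\<^bsub>X\<^esub> x"
      using mem_coset[OF x z(1)] by blast
  next
    fix z assume z: "z \<in> ?K +>\<^bsub>X\<^esub> x"
    then have zX: "z \<in> carrier X"
      using abelian_subgroup.a_elemrcos_carrier[OF K' x] by blast
    then have "z \<ominus>\<^bsub>X\<^esub> x \<in> ?K"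
      using mem_coset[OF x zX] z by blast
    then have "S z \<ominus>\<^bsub>Y\<^esub> S x = \<zero>\<^bsub>Y\<^esub>"
      using x zX by (simp add: S_diff)
    then have "S z = S x"
      using x zX Y.diff_add_cancel[of "S z" "S x"] by simp
    then show "z \<in> \<phi> (S x)"
      using zX by (simp add: \<phi>_def)
  qed
  have surj: "\<exists>x\<in>carrier X. y = S x" if "y \<in> carrier Y" for y
    using lift[OF that zero_less_one] by blast
  have carrier_Q: "carrier ?Q = \<phi> ` carrier Y"
    unfolding X.carrier_quotient_space[OF K] using surj by (force simp flip: fibre)
  have norm: "seminorm ?Q (\<phi> y) = seminorm Y y" if y: "y \<in> carrier Y" for y
  proof -
    have ne: "\<phi> y \<noteq> {}"
      using surj[OF y] by (auto simp: \<phi>_def)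
    have "(INF x\<in>\<phi> y. seminorm X x) = seminorm Y y"
    proof (rule antisym)
      show "seminorm Y y \<le> (INF x\<in>\<phi> y. seminorm X x)"
        using ne le by (intro cINF_greatest) (auto simp: \<phi>_def)
      show "(INF x\<in>\<phi> y. seminorm X x) \<le> seminorm Y y"
      proof (rule field_le_epsilon)
        fix e :: real assume "e > 0"
        then obtain x where x: "x \<in> carrier X" "S x = y" "seminorm X x \<le> seminorm Y y + e"
          using lift[OF y] by blast
        have "(INF x\<in>\<phi> y. seminorm X x) \<le> seminorm X x"
          using x by (intro cINF_lower bdd_belowI2[where m=0]) (auto simp: \<phi>_def)
        then show "(INF x\<in>\<phi> y. seminorm X x) \<le> seminorm Y y + e"
          using x(3) by simp
      qed
    qed
    then show ?thesis
      by (simp add: quotient_space_def)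
  qed
  have inj: "inj_on \<phi> (carrier Y)"
    using surj by (intro inj_onI) (fastforce simp: \<phi>_def)
  have linear: "\<phi> \<in> linear_maps Y ?Q"
  proof -
    have "\<phi> (y \<oplus>\<^bsub>Y\<^esub> y') = \<phi> y \<oplus>\<^bsub>?Q\<^esub> \<phi> y'" if y: "y \<in> carrier Y" "y' \<in> carrier Y" for y y'
    proof -
      obtain x x' where x: "x \<in> carrier X" "x' \<in> carrier X" "y = S x" "y' = S x'"
        using surj[OF y(1)] surj[OF y(2)] by blast
      have "\<phi> (y \<oplus>\<^bsub>Y\<^esub> y') = ?K +>\<^bsub>X\<^esub> (x \<oplus>\<^bsub>X\<^esub> x')"
        using x(1,2) fibre[of "x \<oplus>\<^bsub>X\<^esub> x'"] by (simp only: x(3,4) S_add X.a_closed)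
      then show ?thesis
        using X.add_quotient_space[OF K x(1,2)] fibre[OF x(1)] fibre[OF x(2)] by (simp only: x(3,4))
    qed
    moreover have "\<phi> (c \<odot>\<^bsub>Y\<^esub> y) = c \<odot>\<^bsub>?Q\<^esub> \<phi> y" if y: "y \<in> carrier Y" for y c
    proof -
      obtain x where x: "x \<in> carrier X" "y = S x"
        using surj[OF y] by blast
      have "\<phi> (c \<odot>\<^bsub>Y\<^esub> y) = ?K +>\<^bsub>X\<^esub> (c \<odot>\<^bsub>X\<^esub> x)"
        using x(1) fibre[of "c \<odot>\<^bsub>X\<^esub> x"] by (simp only: x(2) S_smult X.smult_closed)
      then show ?thesis
        using X.smult_quotient_space[OF K x(1)] fibre[OF x(1)] by (simp only: x(2))
    qed
    ultimately show ?thesis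
      by (simp add: linear_maps_def carrier_Q)
  qed
  show ?thesis
    unfolding isometrically_isomorphic_def
  proof (rule bexI[OF _ linear], intro conjI ballI)
    show "bij_betw \<phi> (carrier Y) (carrier ?Q)"
      unfolding bij_betw_def carrier_Q using inj by (rule conjI[OF _ refl])
  qed (rule norm)
qed

section \<open>Extending a contraction from a dense subspace\<close>

lemma tendsto_0_bounded:
  fixes f g :: "nat \<Rightarrow> real"
  assumes "\<And>n. 0 \<le> f n" "\<And>n. f n \<le> g n" "g \<longlonglongrightarrow> 0"
  shows "f \<longlonglongrightarrow> 0"
  using assms by (intro tendsto_sandwich[OF _ _ tendsto_const assms(3)]) auto

locale dense_contraction = V: seminormed_space V + W: seminormed_space W
  for V :: "'v seminormed" and W :: "'w seminormed" +
  fixes D :: "'v set" and t :: "'v \<Rightarrow> 'w"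
  assumes D: "linear_subspace V D"
    and dense: "\<lbrakk>v \<in> carrier V; e > 0\<rbrakk> \<Longrightarrow> \<exists>d\<in>D. seminorm V (v \<ominus>\<^bsub>V\<^esub> d) < e"
    and t_closed: "d \<in> D \<Longrightarrow> t d \<in> carrier W"
    and t_add: "\<lbrakk>d \<in> D; d' \<in> D\<rbrakk> \<Longrightarrow> t (d \<oplus>\<^bsub>V\<^esub> d') = t d \<oplus>\<^bsub>W\<^esub> t d'"
    and t_smult: "d \<in> D \<Longrightarrow> t (c \<odot>\<^bsub>V\<^esub> d) = c \<odot>\<^bsub>W\<^esub> t d"
    and t_le: "d \<in> D \<Longrightarrow> seminorm W (t d) \<le> seminorm V d"
begin

lemma D_carrier: "d \<in> D \<Longrightarrow> d \<in> carrier V"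
  using D by (auto simp: linear_subspace_def)

lemma D_add: "\<lbrakk>d \<in> D; d' \<in> D\<rbrakk> \<Longrightarrow> d \<oplus>\<^bsub>V\<^esub> d' \<in> D"
  using D by (simp add: linear_subspace_def)

lemma D_smult: "d \<in> D \<Longrightarrow> c \<odot>\<^bsub>V\<^esub> d \<in> D"
  using D by (simp add: linear_subspace_def)

lemma D_diff_t_diff:
  assumes "d \<in> D" "d' \<in> D"
  shows "d \<ominus>\<^bsub>V\<^esub> d' \<in> D" "t (d \<ominus>\<^bsub>V\<^esub> d') = t d \<ominus>\<^bsub>W\<^esub> t d'"
  using assms D_add[of d "(-1) \<odot>\<^bsub>V\<^esub> d'"] D_smult[of d' "-1"] t_add[of d "(-1) \<odot>\<^bsub>V\<^esub> d'"]
    t_smult[of d' "-1"] t_closed[of d']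
  by (simp_all add: D_carrier V.minus_eq W.minus_eq V.smult_minus_1 W.smult_minus_1)

definition approximates :: "(nat \<Rightarrow> 'v) \<Rightarrow> 'v \<Rightarrow> bool"
  where "approximates d v \<longleftrightarrow> range d \<subseteq> D \<and> (\<lambda>n. seminorm V (v \<ominus>\<^bsub>V\<^esub> d n)) \<longlonglongrightarrow> 0"

lemma approximates_D: "approximates d v \<Longrightarrow> d n \<in> D"
  by (auto simp: approximates_def)

lemma approximates_carrier: "approximates d v \<Longrightarrow> d n \<in> carrier V"
  by (intro D_carrier approximates_D)

lemma approximates_tendsto: "approximates d v \<Longrightarrow> (\<lambda>n. seminorm V (v \<ominus>\<^bsub>V\<^esub> d n)) \<longlonglongrightarrow> 0"
  by (simp add: approximates_def)

lemma approximates_const: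
  assumes "d \<in> D"
  shows "approximates (\<lambda>n. d) d"
  using assms by (simp add: approximates_def D_carrier)

lemma approximates_exists:
  assumes v: "v \<in> carrier V"
  shows "\<exists>d. approximates d v"
proof -
  have "\<exists>d\<in>D. seminorm V (v \<ominus>\<^bsub>V\<^esub> d) < inverse (real (Suc n))" for n
    using dense[OF v] by simp
  then obtain d where d: "\<And>n. d n \<in> D" "\<And>n. seminorm V (v \<ominus>\<^bsub>V\<^esub> d n) < inverse (real (Suc n))"
    by metis
  have "(\<lambda>n. seminorm V (v \<ominus>\<^bsub>V\<^esub> d n)) \<longlonglongrightarrow> 0"
  proof (rule tendsto_sandwich[OF _ _ tendsto_const LIMSEQ_inverse_real_of_nat])
    show "\<forall>\<^sub>F n in sequentially. 0 \<le> seminorm V (v \<ominus>\<^bsub>V\<^esub> d n)"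
      using d(1) v D_carrier by simp
    show "\<forall>\<^sub>F n in sequentially. seminorm V (v \<ominus>\<^bsub>V\<^esub> d n) \<le> inverse (real (Suc n))"
      by (intro always_eventually allI less_imp_le d(2))
  qed
  then show ?thesis
    using d(1) by (auto simp: approximates_def)
qed

lemma approximates_add:
  assumes "v \<in> carrier V" "v' \<in> carrier V" "approximates d v" "approximates d' v'"
  shows "approximates (\<lambda>n. d n \<oplus>\<^bsub>V\<^esub> d' n) (v \<oplus>\<^bsub>V\<^esub> v')"
proof -
  note car = approximates_carrier[OF assms(3)] approximates_carrier[OF assms(4)]
  have "(\<lambda>n. seminorm V ((v \<oplus>\<^bsub>V\<^esub> v') \<ominus>\<^bsub>V\<^esub> (d n \<oplus>\<^bsub>V\<^esub> d' n))) \<longlonglongrightarrow> 0"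
  proof (rule tendsto_0_bounded)
    show "(\<lambda>n. seminorm V (v \<ominus>\<^bsub>V\<^esub> d n) + seminorm V (v' \<ominus>\<^bsub>V\<^esub> d' n)) \<longlonglongrightarrow> 0"
      using tendsto_add[OF approximates_tendsto[OF assms(3)] approximates_tendsto[OF assms(4)]] by simp
  qed (use assms(1,2) car in \<open>auto intro: V.seminorm_add_diff_le\<close>)
  then show ?thesis
    using D_add approximates_D[OF assms(3)] approximates_D[OF assms(4)] by (auto simp: approximates_def)
qed

lemma approximates_smult:
  assumes "v \<in> carrier V" "approximates d v"
  shows "approximates (\<lambda>n. c \<odot>\<^bsub>V\<^esub> d n) (c \<odot>\<^bsub>V\<^esub> v)"
proof -
  have "(\<lambda>n. seminorm V (c \<odot>\<^bsub>V\<^esub> v \<ominus>\<^bsub>V\<^esub> c \<odot>\<^bsub>V\<^esub> d n)) = (\<lambda>n. norm c * seminorm V (v \<ominus>\<^bsub>V\<^esub> d n))"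
    using assms(1) approximates_carrier[OF assms(2)]
    by (simp add: V.seminorm_smult flip: V.smult_diff_right)
  then show ?thesis
    using tendsto_mult_right_zero[OF approximates_tendsto[OF assms(2)], of "norm c"]
      D_smult approximates_D[OF assms(2)]
    by (auto simp: approximates_def)
qed

lemma tendsto_seminorm_approximates:
  assumes "v \<in> carrier V" "approximates d v"
  shows "(\<lambda>n. seminorm V (d n)) \<longlonglongrightarrow> seminorm V v"
proof -
  have "(\<lambda>n. \<bar>seminorm V v - seminorm V (d n)\<bar>) \<longlonglongrightarrow> 0"
    using assms(1) approximates_carrier[OF assms(2)] V.seminorm_diff_ge
    by (intro tendsto_0_bounded[OF _ _ approximates_tendsto[OF assms(2)]]) auto
  then have "(\<lambda>n. \<bar>seminorm V (d n) - seminorm V v\<bar>) \<longlonglongrightarrow> 0"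
    by (simp add: abs_minus_commute)
  then show ?thesis
    by (rule LIM_zero_cancel[OF tendsto_rabs_zero_cancel])
qed

lemma seminorm_t_diff_le:
  "\<lbrakk>d \<in> D; d' \<in> D\<rbrakk> \<Longrightarrow> seminorm W (t d \<ominus>\<^bsub>W\<^esub> t d') \<le> seminorm V (d \<ominus>\<^bsub>V\<^esub> d')"
  using t_le[of "d \<ominus>\<^bsub>V\<^esub> d'"] by (simp add: D_diff_t_diff)

lemma t_approximates_cauchy:
  assumes v: "v \<in> carrier V" and d: "approximates d v"
  shows "(\<lambda>n. t (d n)) \<in> carrier (cauchy_space W)"
proof (rule W.cauchy_spaceI)
  fix e :: real assume "e > 0"
  then have "eventually (\<lambda>n. seminorm V (v \<ominus>\<^bsub>V\<^esub> d n) < e / 2) sequentially"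
    by (intro order_tendstoD(2)[OF approximates_tendsto[OF d]]) simp
  then obtain k where k: "\<And>n. n \<ge> k \<Longrightarrow> seminorm V (v \<ominus>\<^bsub>V\<^esub> d n) < e / 2"
    by (auto simp: eventually_sequentially)
  have "seminorm W (t (d m) \<ominus>\<^bsub>W\<^esub> t (d n)) < e" if "m \<ge> k" "n \<ge> k" for m n
    using seminorm_t_diff_le[OF approximates_D[OF d] approximates_D[OF d], of m n]
      V.seminorm_diff_triangle[OF approximates_carrier[OF d] v approximates_carrier[OF d], of m n]
      V.seminorm_diff_commute[OF approximates_carrier[OF d] v, of m] k[OF that(1)] k[OF that(2)]
    by simp
  then show "\<exists>k. \<forall>m\<ge>k. \<forall>n\<ge>k. seminorm W (t (d m) \<ominus>\<^bsub>W\<^esub> t (d n)) < e"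
    by blast
qed (use approximates_D[OF d] t_closed in simp)

text \<open>
  The value at a class is the limit of \<open>t\<close> along any sequence in \<open>D\<close> that converges to a
  representative; \<open>extension_sep_class\<close> shows that the choices do not matter. The function is made
  extensional so that it is unique as a function on the whole type.
\<close>

definition extension :: "'v set \<Rightarrow> (nat \<Rightarrow> 'w) set"
  where "extension = (\<lambda>A\<in>carrier (separation V). sep_class (cauchy_space W)
    (\<lambda>n. t ((SOME d. \<exists>v\<in>carrier V. A = sep_class V v \<and> approximates d v) n)))"

text \<open>
  Two sequences in \<open>D\<close> with limits at distance zero have differences tending to zero, and \<open>t\<close> does
  not increase norms, so their images are equivalent Cauchy sequences.
\<close>

lemma extension_sep_class:
  assumes v: "v \<in> carrier V" and d: "approximates d v"
  shows "extension (sep_class V v) = sep_class (cauchy_space W) (\<lambda>n. t (d n))"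
proof -
  define d' where "d' = (SOME d. \<exists>v'\<in>carrier V. sep_class V v = sep_class V v' \<and> approximates d v')"
  have "\<exists>d. \<exists>v'\<in>carrier V. sep_class V v = sep_class V v' \<and> approximates d v'"
    using v d by blast
  then have "\<exists>v'\<in>carrier V. sep_class V v = sep_class V v' \<and> approximates d' v'"
    unfolding d'_def by (rule someI_ex)
  then obtain v' where v': "v' \<in> carrier V" "sep_class V v = sep_class V v'" "approximates d' v'"
    by blast
  have vv': "seminorm V (v \<ominus>\<^bsub>V\<^esub> v') = 0"
    using V.sep_class_eq_iff v v'(1,2) by simp
  note car = approximates_carrier[OF d] approximates_carrier[OF v'(3)]
  have "(\<lambda>n. seminorm W (t (d' n) \<ominus>\<^bsub>W\<^esub> t (d n))) \<longlonglongrightarrow> 0"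
  proof (rule tendsto_0_bounded)
    show "(\<lambda>n. seminorm V (v' \<ominus>\<^bsub>V\<^esub> d' n) + seminorm V (v \<ominus>\<^bsub>V\<^esub> d n)) \<longlonglongrightarrow> 0"
      using tendsto_add[OF approximates_tendsto[OF v'(3)] approximates_tendsto[OF d]] by simp
    fix n
    show "seminorm W (t (d' n) \<ominus>\<^bsub>W\<^esub> t (d n)) \<le> seminorm V (v' \<ominus>\<^bsub>V\<^esub> d' n) + seminorm V (v \<ominus>\<^bsub>V\<^esub> d n)"
      using seminorm_t_diff_le[OF approximates_D[OF v'(3)] approximates_D[OF d], of n n]
        V.seminorm_diff_triangle[OF car(2) v'(1) car(1), of n n]
        V.seminorm_diff_triangle[OF v'(1) v car(1), of n]
        V.seminorm_diff_commute[OF car(2) v'(1), of n] V.seminorm_diff_commute[OF v v'(1)] vv'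
      by simp
  qed (use t_closed approximates_D[OF d] approximates_D[OF v'(3)] in simp)
  then have "sep_class (cauchy_space W) (\<lambda>n. t (d' n)) = sep_class (cauchy_space W) (\<lambda>n. t (d n))"
    using t_approximates_cauchy v v' d by (simp add: W.sep_class_cauchy_space_eq_iff)
  moreover have "sep_class V v \<in> carrier (separation V)"
    using v by (simp add: V.carrier_separation)
  ultimately show ?thesis
    by (simp add: extension_def flip: d'_def)
qed

lemma extension_to_completion: "d \<in> D \<Longrightarrow> extension (sep_class V d) = to_completion W (t d)"
  using extension_sep_class[OF _ approximates_const, of d] by (simp add: D_carrier to_completion_def)

sublocale CW: seminormed_space "cauchy_space W"
  by (rule W.seminormed_space_cauchy_space)

lemma extension_linear: "extension \<in> linear_maps (separation V) (completion W)"
proof -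
  have closed: "extension A \<in> carrier (completion W)" if A: "A \<in> carrier (separation V)" for A
  proof -
    obtain v where v: "v \<in> carrier V" "A = sep_class V v"
      using A by (auto simp: V.carrier_separation)
    obtain d where d: "approximates d v"
      using approximates_exists[OF v(1)] by blast
    show ?thesis
      unfolding v(2) extension_sep_class[OF v(1) d] completion_def CW.carrier_separation
      by (intro imageI t_approximates_cauchy[OF v(1) d])
  qed
  moreover have "extension (A \<oplus>\<^bsub>separation V\<^esub> B) = extension A \<oplus>\<^bsub>completion W\<^esub> extension B"
    if AB: "A \<in> carrier (separation V)" "B \<in> carrier (separation V)" for A B
  proof -
    obtain v v' where v: "v \<in> carrier V" "v' \<in> carrier V" "A = sep_class V v" "B = sep_class V v'"
      using AB by (auto simp: V.carrier_separation)
    obtain d d' where d: "approximates d v" "approximates d' v'"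
      using approximates_exists v(1,2) by metis
    have "(\<lambda>n. t (d n \<oplus>\<^bsub>V\<^esub> d' n)) = (\<lambda>n. t (d n)) \<oplus>\<^bsub>cauchy_space W\<^esub> (\<lambda>n. t (d' n))"
      using t_add approximates_D[OF d(1)] approximates_D[OF d(2)] by simp
    moreover have "extension (sep_class V v \<oplus>\<^bsub>separation V\<^esub> sep_class V v') =
        sep_class (cauchy_space W) (\<lambda>n. t (d n \<oplus>\<^bsub>V\<^esub> d' n))"
      unfolding V.add_separation[OF v(1,2)]
      by (intro extension_sep_class approximates_add v d V.a_closed)
    ultimately show ?thesis
      unfolding v(3,4) completion_def extension_sep_class[OF v(1) d(1)] extension_sep_class[OF v(2) d(2)]
      using CW.add_separation[OF t_approximates_cauchy[OF v(1) d(1)] t_approximates_cauchy[OF v(2) d(2)]]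
      by simp
  qed
  moreover have "extension (c \<odot>\<^bsub>separation V\<^esub> A) = c \<odot>\<^bsub>completion W\<^esub> extension A"
    if A: "A \<in> carrier (separation V)" for A c
  proof -
    obtain v where v: "v \<in> carrier V" "A = sep_class V v"
      using A by (auto simp: V.carrier_separation)
    obtain d where d: "approximates d v"
      using approximates_exists[OF v(1)] by blast
    have "(\<lambda>n. t (c \<odot>\<^bsub>V\<^esub> d n)) = c \<odot>\<^bsub>cauchy_space W\<^esub> (\<lambda>n. t (d n))"
      using t_smult approximates_D[OF d] by simp
    moreover have "extension (c \<odot>\<^bsub>separation V\<^esub> sep_class V v) =
        sep_class (cauchy_space W) (\<lambda>n. t (c \<odot>\<^bsub>V\<^esub> d n))"
      unfolding V.smult_separation[OF v(1)]
      by (intro extension_sep_class approximates_smult v d V.smult_closed)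
    ultimately show ?thesis
      unfolding v(2) completion_def extension_sep_class[OF v(1) d]
      using CW.smult_separation[OF t_approximates_cauchy[OF v(1) d]]
      by simp
  qed
  ultimately show ?thesis
    by (simp add: linear_maps_def)
qed

lemma extension_contraction:
  assumes A: "A \<in> carrier (separation V)"
  shows "seminorm (completion W) (extension A) \<le> seminorm (separation V) A"
proof -
  obtain v where v: "v \<in> carrier V" "A = sep_class V v"
    using A by (auto simp: V.carrier_separation)
  obtain d where d: "approximates d v"
    using approximates_exists[OF v(1)] by blast
  have "seminorm (cauchy_space W) (\<lambda>n. t (d n)) \<le> seminorm V v"
    using t_le approximates_D[OF d]
    by (intro LIMSEQ_le[OF W.tendsto_seminorm_cauchy_space[OF t_approximates_cauchy[OF v(1) d]]
          tendsto_seminorm_approximates[OF v(1) d]]) auto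
  then show ?thesis
    unfolding v(2) completion_def extension_sep_class[OF v(1) d]
      CW.seminorm_separation[OF t_approximates_cauchy[OF v(1) d]] V.seminorm_separation[OF v(1)] .
qed

lemma extension_bounded_linear: "extension \<in> bounded_linear_maps (separation V) (completion W)"
  unfolding bounded_linear_maps_def using extension_linear extension_contraction
  by (intro CollectI conjI exI[of _ 1]) simp_all

text \<open>
  A bounded \<open>S\<close> that agrees with the extension at a point \<open>d\<close> of \<open>D\<close> differs from it at \<open>v\<close> by at most
  \<open>(B + 1) \<parallel>v - d\<parallel>\<close>, and this can be made arbitrarily small.
\<close>

lemma extension_unique:
  assumes S: "S \<in> bounded_linear_maps (separation V) (completion W)"
    and ext: "S \<in> extensional (carrier (separation V))"
    and SD: "\<And>d. d \<in> D \<Longrightarrow> S (sep_class V d) = to_completion W (t d)"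
  shows "S = extension"
proof (rule extensionalityI[OF ext])
  show "extension \<in> extensional (carrier (separation V))"
    by (simp add: extension_def)
next
  fix A assume A: "A \<in> carrier (separation V)"
  interpret Q: seminormed_space "separation V" by (rule V.seminormed_space_separation)
  interpret C: seminormed_space "completion W" by (rule W.seminormed_space_completion)
  obtain B where B: "\<And>x. x \<in> carrier (separation V) \<Longrightarrow>
      seminorm (completion W) (S x) \<le> B * seminorm (separation V) x"
    using S by (auto simp: bounded_linear_maps_def)
  obtain v where v: "v \<in> carrier V" "A = sep_class V v"
    using A by (auto simp: V.carrier_separation)
  obtain d where d: "approximates d v"
    using approximates_exists[OF v(1)] by blast
  have diff: "F (X \<ominus>\<^bsub>separation V\<^esub> Y) = F X \<ominus>\<^bsub>completion W\<^esub> F Y"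
    if F: "F \<in> linear_maps (separation V) (completion W)"
      and XY: "X \<in> carrier (separation V)" "Y \<in> carrier (separation V)" for F X Y
  proof -
    have "F (X \<oplus>\<^bsub>separation V\<^esub> (-1) \<odot>\<^bsub>separation V\<^esub> Y) = F X \<oplus>\<^bsub>completion W\<^esub> (-1) \<odot>\<^bsub>completion W\<^esub> F Y"
      using F XY Q.smult_closed[of Y "-1"] by (simp add: linear_maps_def)
    moreover have "F Y \<in> carrier (completion W)"
      using F XY by (auto simp: linear_maps_def)
    ultimately show ?thesis
      using XY by (simp add: Q.minus_eq C.minus_eq Q.smult_minus_1 C.smult_minus_1)
  qed
  have SL: "S \<in> linear_maps (separation V) (completion W)"
    using S by (simp add: bounded_linear_maps_def)
  have car: "S A \<in> carrier (completion W)" "extension A \<in> carrier (completion W)"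
    using SL extension_linear A by (auto simp: linear_maps_def)
  have le: "seminorm (completion W) (S A \<ominus>\<^bsub>completion W\<^esub> extension A) \<le>
      (B + 1) * seminorm V (v \<ominus>\<^bsub>V\<^esub> d n)" for n
  proof -
    let ?X = "sep_class V (d n)"
    have X: "?X \<in> carrier (separation V)"
      using approximates_carrier[OF d] by (simp add: V.carrier_separation)
    have eq: "S ?X = extension ?X"
      using SD extension_to_completion approximates_D[OF d] by simp
    have Xc: "extension ?X \<in> carrier (completion W)"
      using extension_linear X by (auto simp: linear_maps_def)
    have AX: "A \<ominus>\<^bsub>separation V\<^esub> ?X \<in> carrier (separation V)"
      using A X by simp
    have AX_norm: "seminorm (separation V) (A \<ominus>\<^bsub>separation V\<^esub> ?X) = seminorm V (v \<ominus>\<^bsub>V\<^esub> d n)"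
    proof -
      have "A \<ominus>\<^bsub>separation V\<^esub> ?X = sep_class V v \<oplus>\<^bsub>separation V\<^esub> (-1) \<odot>\<^bsub>separation V\<^esub> ?X"
        using X by (simp add: Q.minus_eq Q.smult_minus_1 v(2))
      also have "\<dots> = sep_class V (v \<ominus>\<^bsub>V\<^esub> d n)"
        using v(1) approximates_carrier[OF d]
        by (simp add: V.smult_separation V.add_separation V.minus_eq V.smult_minus_1)
      finally show ?thesis
        using v(1) approximates_carrier[OF d] by (simp add: V.seminorm_separation)
    qed
    have "seminorm (completion W) (S A \<ominus>\<^bsub>completion W\<^esub> extension A) \<le>
        seminorm (completion W) (S A \<ominus>\<^bsub>completion W\<^esub> S ?X) +
        seminorm (completion W) (extension ?X \<ominus>\<^bsub>completion W\<^esub> extension A)"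
      using C.seminorm_diff_triangle[OF car(1) Xc car(2)] eq by simp
    also have "\<dots> = seminorm (completion W) (S (A \<ominus>\<^bsub>separation V\<^esub> ?X)) +
        seminorm (completion W) (extension (A \<ominus>\<^bsub>separation V\<^esub> ?X))"
      using diff[OF SL A X] diff[OF extension_linear A X] C.seminorm_diff_commute[OF Xc car(2)] by simp
    also have "\<dots> \<le> (B + 1) * seminorm V (v \<ominus>\<^bsub>V\<^esub> d n)"
      using B[OF AX] extension_contraction[OF AX] AX_norm by (simp add: algebra_simps)
    finally show ?thesis .
  qed
  have "(\<lambda>n. (B + 1) * seminorm V (v \<ominus>\<^bsub>V\<^esub> d n)) \<longlonglongrightarrow> 0"
    by (intro tendsto_mult_right_zero approximates_tendsto[OF d])
  then have "seminorm (completion W) (S A \<ominus>\<^bsub>completion W\<^esub> extension A) \<le> 0"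
    using le by (intro LIMSEQ_le_const) auto
  then have "seminorm (completion W) (S A \<ominus>\<^bsub>completion W\<^esub> extension A) = 0"
    using car by (intro antisym C.seminorm_nonneg C.minus_closed)
  then show "S A = extension A"
    using CW.separation_eqI car unfolding completion_def by blast
qed

end

section \<open>Lifting through the completion\<close>

text \<open>
  Completeness of the domain is only asked for in the form in which it is used: sequences with
  absolutely summable increments converge.
\<close>

locale norm_preserving_lift = dense_contraction +
  assumes lift: "w \<in> carrier W \<Longrightarrow> \<exists>d\<in>D. t d = w \<and> seminorm V d \<le> seminorm W w"
    and complete: "\<lbrakk>\<And>n. u n \<in> carrier V; summable (\<lambda>n. seminorm V (u (Suc n) \<ominus>\<^bsub>V\<^esub> u n))\<rbrakk> \<Longrightarrow>
      \<exists>v\<in>carrier V. (\<lambda>n. seminorm V (v \<ominus>\<^bsub>V\<^esub> u n)) \<longlonglongrightarrow> 0"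
begin

text \<open>
  The exponent \<open>n + 2\<close> makes all increments add up to at most \<open>e / 2\<close>, leaving the other half of
  \<open>e\<close> for the norm of the first term.
\<close>

lemma fast_subsequence:
  fixes u
  assumes u: "u \<in> carrier (cauchy_space W)" and e: "e > 0"
  obtains r :: "nat \<Rightarrow> nat" where "\<And>n. n \<le> r n"
    and "\<And>n. seminorm W (u (r (Suc n)) \<ominus>\<^bsub>W\<^esub> u (r n)) \<le> e * (1/2) ^ (n + 2)"
    and "seminorm W (u (r 0)) \<le> seminorm (cauchy_space W) u + e / 2"
proof -
  have "\<exists>k. \<forall>m\<ge>k. \<forall>l\<ge>k. seminorm W (u m \<ominus>\<^bsub>W\<^esub> u l) < e * (1/2) ^ (n + 2)" for n
    using W.cauchy_spaceD[OF u, of "e * (1/2) ^ (n + 2)"] e by (metis half_gt_zero_iff mult_pos_pos zero_less_one zero_less_power)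
  then obtain K where K: "\<And>n m l. \<lbrakk>m \<ge> K n; l \<ge> K n\<rbrakk> \<Longrightarrow> seminorm W (u m \<ominus>\<^bsub>W\<^esub> u l) < e * (1/2) ^ (n + 2)"
    by metis
  define r where "r n = n + (\<Sum>i\<le>n. K i)" for n
  have rK: "K n \<le> r n" for n
    unfolding r_def using member_le_sum[of n "{..n}" K] by simp
  have r_Suc: "r n \<le> r (Suc n)" for n
    by (simp add: r_def)
  show thesis
  proof
    show "n \<le> r n" for n
      by (simp add: r_def)
    show "seminorm W (u (r (Suc n)) \<ominus>\<^bsub>W\<^esub> u (r n)) \<le> e * (1/2) ^ (n + 2)" for n
      using rK[of n] r_Suc[of n] by (intro less_imp_le[OF K]) auto
    have "seminorm W (u (r 0)) \<le> seminorm W (u n) + e / 2" if "n \<ge> K 0" for n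
    proof -
      have "seminorm W (u (r 0) \<ominus>\<^bsub>W\<^esub> u n) < e * (1/2) ^ (0 + 2)"
        using rK[of 0] that by (intro K) auto
      moreover have "\<bar>seminorm W (u (r 0)) - seminorm W (u n)\<bar> \<le> seminorm W (u (r 0) \<ominus>\<^bsub>W\<^esub> u n)"
        using W.cauchy_space_nth[OF u] by (intro W.seminorm_diff_ge)
      moreover have "e * (1/2) ^ (0 + 2) \<le> e / 2"
        using e by (simp add: power2_eq_square)
      ultimately show ?thesis by linarith
    qed
    then show "seminorm W (u (r 0)) \<le> seminorm (cauchy_space W) u + e / 2"
      by (intro LIMSEQ_le_const[OF tendsto_add[OF W.tendsto_seminorm_cauchy_space[OF u] tendsto_const]]) auto
  qed
qed

text \<open>
  The terms and increments of a fast subsequence are lifted with control of the norm, and the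
  partial sums \<open>d n\<close> of the lifts satisfy \<open>t (d n) = u (r n)\<close>. They converge because their increments are
  summable, and the norm of the limit exceeds that of \<open>y\<close> by at most \<open>e\<close>.
\<close>

lemma extension_lift:
  assumes y: "y \<in> carrier (completion W)" and e: "e > 0"
  shows "\<exists>A\<in>carrier (separation V). extension A = y \<and>
    seminorm (separation V) A \<le> seminorm (completion W) y + e"
proof -
  obtain u where u: "u \<in> carrier (cauchy_space W)" and yu: "y = sep_class (cauchy_space W) u"
    using y by (auto simp: completion_def CW.carrier_separation)
  note u_nth = W.cauchy_space_nth[OF u]
  obtain r :: "nat \<Rightarrow> nat" where r: "\<And>n. n \<le> r n"
    "\<And>n. seminorm W (u (r (Suc n)) \<ominus>\<^bsub>W\<^esub> u (r n)) \<le> e * (1/2) ^ (n + 2)"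
    "seminorm W (u (r 0)) \<le> seminorm (cauchy_space W) u + e / 2"
    using fast_subsequence[OF u e] by metis
  obtain L where L: "\<And>w. w \<in> carrier W \<Longrightarrow> L w \<in> D" "\<And>w. w \<in> carrier W \<Longrightarrow> t (L w) = w"
    "\<And>w. w \<in> carrier W \<Longrightarrow> seminorm V (L w) \<le> seminorm W w"
    using lift by metis
  define d where "d = rec_nat (L (u (r 0))) (\<lambda>n x. x \<oplus>\<^bsub>V\<^esub> L (u (r (Suc n)) \<ominus>\<^bsub>W\<^esub> u (r n)))"
  have d_0: "d 0 = L (u (r 0))"
    and d_Suc: "d (Suc n) = d n \<oplus>\<^bsub>V\<^esub> L (u (r (Suc n)) \<ominus>\<^bsub>W\<^esub> u (r n))" for n
    by (simp_all add: d_def)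
  have step: "u (r (Suc n)) \<ominus>\<^bsub>W\<^esub> u (r n) \<in> carrier W" for n
    by (intro W.minus_closed u_nth)
  have dD: "d n \<in> D" for n
    by (induction n) (simp_all add: d_0 d_Suc D_add L(1) step u_nth)
  have td: "t (d n) = u (r n)" for n
  proof (induction n)
    case (Suc n)
    then show ?case
      unfolding d_Suc t_add[OF dD L(1)[OF step]] L(2)[OF step]
      by (simp add: W.a_comm[OF u_nth step] u_nth)
  qed (simp add: d_0 L(2) u_nth)
  have step_le: "seminorm V (L (u (r (Suc n)) \<ominus>\<^bsub>W\<^esub> u (r n))) \<le> e * (1/2) ^ (n + 2)" for n
    using L(3)[OF step] r(2) order_trans by blast
  have d_diff: "d (Suc n) \<ominus>\<^bsub>V\<^esub> d n = L (u (r (Suc n)) \<ominus>\<^bsub>W\<^esub> u (r n))" for n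
    using D_carrier[OF dD[of n]] D_carrier[OF L(1)[OF step[of n]]]
    by (simp add: d_Suc V.minus_eq V.a_assoc V.a_comm[of "L (u (r (Suc n)) \<ominus>\<^bsub>W\<^esub> u (r n))"] V.r_neg1 V.r_neg2)
  have "summable (\<lambda>n. seminorm V (d (Suc n) \<ominus>\<^bsub>V\<^esub> d n))"
  proof (rule summable_comparison_test'[where N=0])
    show "summable (\<lambda>n. e * (1/2) ^ (n + 2))"
      by (intro summable_mult summable_ignore_initial_segment summable_geometric) simp
    show "norm (seminorm V (d (Suc n) \<ominus>\<^bsub>V\<^esub> d n)) \<le> e * (1/2) ^ (n + 2)" for n
      using step_le D_carrier[OF L(1)[OF step]] by (simp add: d_diff)
  qed
  then obtain v where v: "v \<in> carrier V" and lim: "(\<lambda>n. seminorm V (v \<ominus>\<^bsub>V\<^esub> d n)) \<longlonglongrightarrow> 0"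
    using complete[of d] D_carrier[OF dD] by blast
  have approx: "approximates d v"
    using lim dD by (auto simp: approximates_def)
  have "extension (sep_class V v) = sep_class (cauchy_space W) (\<lambda>n. u (r n))"
    unfolding extension_sep_class[OF v approx] td ..
  also have "\<dots> = y"
  proof -
    have "(\<lambda>n. seminorm W (u (r n) \<ominus>\<^bsub>W\<^esub> u n)) \<longlonglongrightarrow> 0"
    proof (rule LIMSEQ_I)
      fix c :: real assume "c > 0"
      obtain k where k: "\<And>m n. \<lbrakk>m \<ge> k; n \<ge> k\<rbrakk> \<Longrightarrow> seminorm W (u m \<ominus>\<^bsub>W\<^esub> u n) < c"
        using W.cauchy_spaceD[OF u \<open>c > 0\<close>] by metis
      have "norm (seminorm W (u (r n) \<ominus>\<^bsub>W\<^esub> u n) - 0) < c" if "n \<ge> k" for n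
        using k[of "r n" n] r(1)[of n] that u_nth by simp
      then show "\<exists>k. \<forall>n\<ge>k. norm (seminorm W (u (r n) \<ominus>\<^bsub>W\<^esub> u n) - 0) < c"
        by blast
    qed
    then show ?thesis
      using t_approximates_cauchy[OF v approx] u unfolding yu td
      by (simp add: W.sep_class_cauchy_space_eq_iff)
  qed
  finally have Sv: "extension (sep_class V v) = y" .
  \<comment> \<open>The subtracted term is what is left of the geometric series after \<open>n\<close> steps.\<close>
  have bound: "seminorm V (d n) \<le> seminorm (cauchy_space W) u + e - e * (1/2) ^ (n + 1)" for n
  proof (induction n)
    case 0
    then show ?case
      using L(3)[OF u_nth, of "r 0"] r(3) by (simp add: d_0)
  next
    case (Suc n)
    have "seminorm V (d (Suc n)) \<le> seminorm V (d n) + e * (1/2) ^ (n + 2)"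
      using V.seminorm_add_le[OF D_carrier[OF dD[of n]] D_carrier[OF L(1)[OF step[of n]]]] step_le[of n]
      by (simp add: d_Suc)
    moreover have "e * (1/2) ^ (n + 1) = 2 * (e * (1/2) ^ (n + 2))"
      by simp
    ultimately show ?case
      using Suc by simp
  qed
  have "seminorm V (d n) \<le> seminorm (cauchy_space W) u + e" for n
  proof -
    have "0 \<le> e * (1/2) ^ (n + 1)"
      using e by (intro mult_nonneg_nonneg) auto
    then show ?thesis
      using bound[of n] by linarith
  qed
  then have "seminorm V v \<le> seminorm (cauchy_space W) u + e"
    by (intro LIMSEQ_le_const2[OF tendsto_seminorm_approximates[OF v approx]]) auto
  then have "seminorm (separation V) (sep_class V v) \<le> seminorm (completion W) y + e"
    unfolding yu completion_def CW.seminorm_separation[OF u] V.seminorm_separation[OF v] .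
  moreover have "sep_class V v \<in> carrier (separation V)"
    using v by (simp add: V.carrier_separation)
  ultimately show ?thesis
    using Sv by blast
qed

theorem completion_isometric_quotient:
  "isometrically_isomorphic (completion W)
    (quotient_space (separation V) {A \<in> carrier (separation V). extension A = \<zero>\<^bsub>completion W\<^esub>})"
  by (intro isometrically_isomorphic_quotient_kernel V.seminormed_space_separation
      W.seminormed_space_completion extension_linear extension_contraction extension_lift)

end

section \<open>Regular Borel measures and density of continuous functions\<close>

text \<open>
  What a Haar measure satisfies as a measure on a topological space. Stated without the group, it
  applies to \<open>G\<close>, \<open>N\<close> and \<open>G/N\<close> alike.
\<close>

locale regular_borel_measure =
  fixes T :: "'a topology" and M :: "'a measure"
  assumes sets_eq: "sets M = sets (sigma (topspace T) {U. openin T U})"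
    and finite_compact: "compactin T K \<Longrightarrow> emeasure M K < \<infinity>"
    and outer_regular: "A \<in> sets M \<Longrightarrow> emeasure M A = (INF U\<in>{U. openin T U \<and> A \<subseteq> U}. emeasure M U)"
    and inner_regular: "openin T U \<Longrightarrow> emeasure M U = (SUP K\<in>{K. compactin T K \<and> K \<subseteq> U}. emeasure M K)"
begin

lemma space_eq: "space M = topspace T"
  using sets_eq_imp_space_eq[OF sets_eq] by (simp add: space_measure_of_conv)

lemma openin_sets: "openin T U \<Longrightarrow> U \<in> sets M"
  unfolding sets_eq by (subst sets_measure_of) (auto dest: openin_subset)

lemma closedin_sets: "closedin T C \<Longrightarrow> C \<in> sets M"
proof -
  assume C: "closedin T C"
  then have "space M - (topspace T - C) \<in> sets M"
    by (intro sets.Diff sets.top openin_sets) auto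
  then show ?thesis
    using closedin_subset[OF C] by (simp add: space_eq double_diff)
qed

lemma measurable_continuous_map:
  assumes "continuous_map T' T f" "space M' = topspace T'" "\<And>U. openin T' U \<Longrightarrow> U \<in> sets M'"
  shows "f \<in> measurable M' M"
proof -
  have "f \<in> measurable M' (sigma (topspace T) {U. openin T U})"
  proof (rule measurable_sigma_sets)
    show "sets (sigma (topspace T) {U. openin T U}) = sigma_sets (topspace T) {U. openin T U}"
      by (rule sets_measure_of) (auto dest: openin_subset)
    show "f \<in> space M' \<rightarrow> topspace T"
      using assms(1,2) by (auto simp: continuous_map_def)
    show "f -` U \<inter> space M' \<in> sets M'" if "U \<in> {U. openin T U}" for U
    proof -
      have "{x \<in> topspace T'. f x \<in> U} \<in> sets M'"
        using assms(1) that by (intro assms(3)) (auto simp: continuous_map_def)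
      moreover have "{x \<in> topspace T'. f x \<in> U} = f -` U \<inter> space M'"
        using assms(2) by auto
      ultimately show ?thesis by simp
    qed
  qed (auto dest: openin_subset)
  then show ?thesis
    using measurable_cong_sets[OF refl sets_eq] by blast
qed

lemma borel_measurable_continuous_map:
  fixes f :: "'a \<Rightarrow> 'b::topological_space"
  assumes "continuous_map T euclidean f"
  shows "f \<in> borel_measurable M"
proof (rule borel_measurableI)
  fix S :: "'b set" assume "open S"
  then have "openin T {x \<in> topspace T. f x \<in> S}"
    using assms by (simp add: continuous_map_def)
  moreover have "{x \<in> topspace T. f x \<in> S} = f -` S \<inter> space M"
    by (auto simp: space_eq)
  ultimately show "f -` S \<inter> space M \<in> sets M"
    using openin_sets by simp
qed

text \<open>Compactness alone does not make \<open>K\<close> measurable, hence the separate hypothesis that \<open>K\<close> is closed.\<close>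

lemma integrable_continuous_compact_support:
  fixes f :: "'a \<Rightarrow> 'b::{banach, second_countable_topology}"
  assumes f: "continuous_map T euclidean f"
    and K: "compactin T K" "closedin T K" and zero: "\<And>x. \<lbrakk>x \<in> topspace T; x \<notin> K\<rbrakk> \<Longrightarrow> f x = 0"
  shows "integrable M f"
proof -
  have "compact (f ` K)"
    using image_compactin[OF K(1) f] by simp
  then obtain B where "\<And>x. x \<in> K \<Longrightarrow> norm (f x) \<le> B"
    using compact_imp_bounded bounded_iff by (metis image_eqI)
  then show ?thesis
    using zero finite_compact[OF K(1)]
    by (intro integrableI_bounded_set[where A=K and B=B] closedin_sets[OF K(2)]
        borel_measurable_continuous_map f) (auto simp: space_eq)
qed

end

lemma continuous_map_mult:
  fixes f g :: "'a \<Rightarrow> 'b::real_normed_algebra"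
  shows "\<lbrakk>continuous_map T euclidean f; continuous_map T euclidean g\<rbrakk> \<Longrightarrow>
    continuous_map T euclidean (\<lambda>x. f x * g x)"
  by (simp add: continuous_map_atin tendsto_mult)

lemma continuous_map_of_real:
  "continuous_map T euclideanreal f \<Longrightarrow> continuous_map T euclidean (\<lambda>x. complex_of_real (f x))"
  by (simp add: continuous_map_atin tendsto_of_real)

lemma topological_support_subset:
  "\<lbrakk>x \<in> topspace T; f x \<noteq> 0\<rbrakk> \<Longrightarrow> x \<in> topological_support T f"
  unfolding topological_support_def
  using closure_of_subset[of "{x \<in> topspace T. f x \<noteq> 0}" T] by auto

lemma closedin_topological_support: "closedin T (topological_support T f)"
  by (simp add: topological_support_def)

lemma topological_support_minimal:
  "\<lbrakk>closedin T C; \<And>x. \<lbrakk>x \<in> topspace T; f x \<noteq> 0\<rbrakk> \<Longrightarrow> x \<in> C\<rbrakk> \<Longrightarrow> topological_support T f \<subseteq> C"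
  unfolding topological_support_def by (rule closure_of_minimal) auto

lemma C_cI:
  assumes "continuous_map T euclidean f" "compactin T K" "closedin T K"
    and "\<And>x. x \<notin> K \<Longrightarrow> f x = 0"
  shows "f \<in> C_c T"
proof -
  have "topological_support T f \<subseteq> K"
    using assms(4) by (intro topological_support_minimal assms(3)) auto
  then have "compactin T (topological_support T f)"
    by (rule closed_compactin[OF assms(2) _ closedin_topological_support])
  moreover have "f x = 0" if "x \<notin> topspace T" for x
    using that assms(4) compactin_subset_topspace[OF assms(2)] by blast
  ultimately show ?thesis
    using assms(1) by (simp add: C_c_def)
qed

lemma C_c_continuous: "f \<in> C_c T \<Longrightarrow> continuous_map T euclidean f"
  by (simp add: C_c_def)

lemma C_c_outside: "\<lbrakk>f \<in> C_c T; x \<notin> topological_support T f\<rbrakk> \<Longrightarrow> f x = 0"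
  using topological_support_subset[of x T f] by (auto simp: C_c_def)

lemma C_c_support:
  "f \<in> C_c T \<Longrightarrow> compactin T (topological_support T f)"
  by (simp add: C_c_def)

lemma C_c_add:
  assumes "f \<in> C_c T" "g \<in> C_c T"
  shows "(\<lambda>x. f x + g x) \<in> C_c T"
  using assms
  by (intro C_cI[where K="topological_support T f \<union> topological_support T g"])
    (auto simp: continuous_map_add C_c_continuous C_c_support C_c_outside
      compactin_Un closedin_topological_support)

lemma C_c_mult:
  assumes "continuous_map T euclidean g" "f \<in> C_c T"
  shows "(\<lambda>x. g x * f x) \<in> C_c T"
  using assms
  by (intro C_cI[where K="topological_support T f"])
    (auto simp: continuous_map_mult C_c_continuous C_c_support C_c_outside closedin_topological_support)

lemma C_c_scale: "f \<in> C_c T \<Longrightarrow> (\<lambda>x. c * f x) \<in> C_c T"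
  by (rule C_c_mult) simp

lemma C_c_norm:
  assumes "f \<in> C_c T"
  shows "(\<lambda>x. complex_of_real (norm (f x))) \<in> C_c T"
  using assms
  by (intro C_cI[where K="topological_support T f"])
    (auto simp: continuous_map_of_real continuous_map_norm C_c_continuous C_c_support C_c_outside
      closedin_topological_support)

lemma C_c_zero: "(\<lambda>x. 0) \<in> C_c T"
  by (rule C_cI[where K="{}"]) auto

text \<open>
  Urysohn's lemma separates \<open>K\<close> from the complement of \<open>U \<inter> V\<close>, where \<open>V\<close> is a neighbourhood of \<open>K\<close>
  inside a compact set; this makes the support compact. The function is real valued for later
  estimates, but membership in \<open>C_c\<close> refers to its complex version.
\<close>

lemma Urysohn_compact_support:
  assumes T: "locally_compact_space T" "Hausdorff_space T"
    and K: "compactin T K" and U: "openin T U" "K \<subseteq> U"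
  obtains f :: "'a \<Rightarrow> real"
  where "(\<lambda>x. complex_of_real (f x)) \<in> C_c T" "\<And>x. 0 \<le> f x" "\<And>x. f x \<le> 1"
    "\<And>x. x \<in> K \<Longrightarrow> f x = 1" "\<And>x. x \<notin> U \<Longrightarrow> f x = 0"
proof -
  obtain V L where V: "openin T V" "compactin T L" "closedin T L" "K \<subseteq> V" "V \<subseteq> L"
    using T K locally_compact_space_compact_closed_compact[of T] by blast
  have "completely_regular_space T"
    using T by (simp add: locally_compact_Hausdorff_imp_regular_space
        locally_compact_regular_imp_completely_regular_space)
  moreover have "closedin T (topspace T - U \<inter> V)"
    using U V by auto
  moreover have "disjnt K (topspace T - U \<inter> V)"
    using U V by (auto simp: disjnt_def)
  ultimately obtain g where g: "continuous_map T (top_of_set {0..1::real}) g"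
    "g ` (topspace T - U \<inter> V) \<subseteq> {0}" "g ` K \<subseteq> {1}"
    using Urysohn_completely_regular_compact_closed[of 0 1 T K "topspace T - U \<inter> V"] K by auto
  define f where "f x = (if x \<in> topspace T then g x else 0)" for x
  have g01: "continuous_map T euclideanreal g" "\<And>x. x \<in> topspace T \<Longrightarrow> g x \<in> {0..1}"
    using g(1) by (auto simp: continuous_map_in_subtopology)
  show thesis
  proof
    have "continuous_map T euclideanreal f"
      by (rule continuous_map_eq[OF g01(1)]) (simp add: f_def)
    moreover have "f x = 0" if "x \<notin> L" for x
      using that g(2) V(5) by (auto simp: f_def)
    ultimately show "(\<lambda>x. complex_of_real (f x)) \<in> C_c T"
      by (intro C_cI[where K=L] V(2,3) continuous_map_of_real) auto
    show "0 \<le> f x" "f x \<le> 1" for x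
      using g01(2)[of x] by (auto simp: f_def)
    show "f x = 1" if "x \<in> K" for x
      using that g(3) K compactin_subset_topspace by (force simp: f_def)
    show "f x = 0" if "x \<notin> U" for x
      using that g(2) by (auto simp: f_def)
  qed
qed

locale locally_compact_measure = regular_borel_measure +
  assumes locally_compact_T: "locally_compact_space T" and Hausdorff_T: "Hausdorff_space T"
begin

lemma compactin_sets: "compactin T K \<Longrightarrow> K \<in> sets M"
  by (intro closedin_sets compactin_imp_closedin Hausdorff_T)

lemma integrable_C_c: "f \<in> C_c T \<Longrightarrow> integrable M f"
  by (rule integrable_continuous_compact_support[where K="topological_support T f"])
    (auto simp: C_c_continuous C_c_support C_c_outside closedin_topological_support)

text \<open>
  Outer regularity gives \<open>U\<close>. Then \<open>K\<close> comes from inner regularity, which is only postulated for open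
  sets and therefore applied to \<open>U\<close>; so \<open>K\<close> need not be contained in \<open>A\<close>.
\<close>

lemma compact_open_sandwich:
  assumes A: "A \<in> sets M" "emeasure M A < \<infinity>" and e: "e > 0"
  obtains K U where "compactin T K" "openin T U" "K \<subseteq> U" "A \<subseteq> U" "emeasure M U < \<infinity>"
    "measure M (U - K) < e" "measure M (U - A) < e"
proof -
  have "emeasure M A < emeasure M A + ennreal e"
    using A(2) e by (simp add: ennreal_zero_less_mult_iff less_top)
  then have "\<exists>U\<in>{U. openin T U \<and> A \<subseteq> U}. emeasure M U < emeasure M A + ennreal e"
    unfolding outer_regular[OF A(1)] by (simp only: INF_less_iff)
  then obtain U where U: "openin T U" "A \<subseteq> U" "emeasure M U < emeasure M A + ennreal e"
    by blast
  have fin: "emeasure M U < \<infinity>"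
    using U(3) A(2) by (metis ennreal_add_less_top ennreal_less_top infinity_ennreal_def less_trans)
  have MU: "U \<in> sets M"
    using U(1) by (rule openin_sets)
  have UA: "measure M (U - A) < e"
  proof -
    have "emeasure M U = ennreal (measure M U)" "emeasure M A = ennreal (measure M A)"
      using fin A(2) by (simp_all add: emeasure_eq_ennreal_measure)
    then have "ennreal (measure M U) < ennreal (measure M A + e)"
      using U(3) e by simp
    then have "measure M U < measure M A + e"
      by (simp add: ennreal_less_iff)
    then show ?thesis
      using fin A MU U(2) by (subst measure_Diff) auto
  qed
  have "\<exists>K. compactin T K \<and> K \<subseteq> U \<and> measure M U - e < measure M K"
  proof (rule ccontr)
    assume none: "\<not> (\<exists>K. compactin T K \<and> K \<subseteq> U \<and> measure M U - e < measure M K)"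
    have le: "measure M K \<le> measure M U - e" if "compactin T K" "K \<subseteq> U" for K
      using none that by (meson not_less)
    have nonneg: "0 \<le> measure M U - e"
      using le[of "{}"] by simp
    have "emeasure M K \<le> ennreal (measure M U - e)" if "compactin T K" "K \<subseteq> U" for K
      using le[OF that] finite_compact[OF that(1)] by (simp add: emeasure_eq_ennreal_measure ennreal_leI)
    then have "emeasure M U \<le> ennreal (measure M U - e)"
      unfolding inner_regular[OF U(1)] by (intro SUP_least) auto
    then have "measure M U \<le> measure M U - e"
      using fin nonneg by (simp add: emeasure_eq_ennreal_measure)
    then show False
      using e by simp
  qed
  then obtain K where K: "compactin T K" "K \<subseteq> U" "measure M U - e < measure M K"
    by blast
  then have "measure M (U - K) < e"
    using fin compactin_sets[OF K(1)] MU finite_compact[OF K(1)] by (subst measure_Diff) auto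
  then show thesis
    using that K U fin UA by blast
qed

text \<open>
  A Urysohn function \<open>f\<close> for \<open>K \<subseteq> U\<close> differs from the indicator of \<open>A\<close> at most on
  \<open>(U - K) \<union> (U - A)\<close>, and by at most \<open>1\<close> there.
\<close>

lemma C_c_approximates_indicator:
  assumes A: "A \<in> sets M" "emeasure M A < \<infinity>" and e: "e > 0"
  shows "\<exists>f\<in>C_c T. (\<integral>x. norm (indicator A x - f x) \<partial>M) < e"
proof -
  obtain K U where KU: "compactin T K" "openin T U" "K \<subseteq> U" "A \<subseteq> U" "emeasure M U < \<infinity>"
    "measure M (U - K) < e / 2" "measure M (U - A) < e / 2"
    using compact_open_sandwich[OF A, of "e / 2"] e by auto
  obtain f :: "'a \<Rightarrow> real" where f: "(\<lambda>x. complex_of_real (f x)) \<in> C_c T" "\<And>x. 0 \<le> f x" "\<And>x. f x \<le> 1"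
    "\<And>x. x \<in> K \<Longrightarrow> f x = 1" "\<And>x. x \<notin> U \<Longrightarrow> f x = 0"
    using Urysohn_compact_support[OF locally_compact_T Hausdorff_T KU(1-3)] by metis
  have sets: "U - K \<in> sets M" "U - A \<in> sets M"
    using KU A by (auto intro: openin_sets compactin_sets)
  have fin: "emeasure M (U - K) < \<infinity>" "emeasure M (U - A) < \<infinity>"
    using KU(5) emeasure_mono[of "U - K" U M] emeasure_mono[of "U - A" U M] openin_sets[OF KU(2)]
    by (auto intro: le_less_trans)
  have "norm (indicator A x - complex_of_real (f x)) \<le> indicator (U - K) x + indicator (U - A) x" for x
  proof -
    have "indicator A x - complex_of_real (f x) = complex_of_real (indicator A x - f x)"
      by (simp add: indicator_def)
    then have "norm (indicator A x - complex_of_real (f x)) = \<bar>indicator A x - f x\<bar>"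
      by (simp only: norm_of_real)
    also have "\<dots> \<le> indicator (U - K) x + indicator (U - A) x"
      using f(2,3)[of x] f(4,5)[of x] KU(3,4) by (auto simp: indicator_def)
    finally show ?thesis .
  qed
  moreover have "integrable M (\<lambda>x. complex_of_real (indicator A x))"
    using A by (intro integrable_of_real integrable_real_indicator)
  then have "integrable M (indicator A :: 'a \<Rightarrow> complex)"
    by (rule Bochner_Integration.integrable_cong[THEN iffD1, rotated 2]) (simp_all add: indicator_def)
  ultimately have "(\<integral>x. norm (indicator A x - complex_of_real (f x)) \<partial>M) \<le>
      (\<integral>x. indicator (U - K) x + indicator (U - A) x \<partial>M)"
    using A integrable_C_c[OF f(1)] sets fin
    by (intro integral_mono integrable_norm Bochner_Integration.integrable_diff integrable_add integrable_real_indicator)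
      (auto simp: integrable_indicator_iff)
  also have "\<dots> = measure M (U - K) + measure M (U - A)"
    using sets fin by (subst Bochner_Integration.integral_add) (auto simp: integrable_indicator_iff)
  also have "\<dots> < e"
    using KU by simp
  finally show ?thesis
    by (rule bexI[OF _ f(1)])
qed

lemma norm_integral_triangle:
  fixes f g h :: "'a \<Rightarrow> complex"
  assumes "integrable M f" "integrable M g" "integrable M h"
  shows "(\<integral>x. norm (f x - h x) \<partial>M) \<le> (\<integral>x. norm (f x - g x) \<partial>M) + (\<integral>x. norm (g x - h x) \<partial>M)"
proof -
  have "(\<integral>x. norm (f x - h x) \<partial>M) \<le> (\<integral>x. norm (f x - g x) + norm (g x - h x) \<partial>M)"
  proof (rule integral_mono)
    show "norm (f x - h x) \<le> norm (f x - g x) + norm (g x - h x)" for x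
      using norm_triangle_ineq[of "f x - g x" "g x - h x"] by simp
  qed (use assms in auto)
  also have "\<dots> = (\<integral>x. norm (f x - g x) \<partial>M) + (\<integral>x. norm (g x - h x) \<partial>M)"
    using assms by (intro Bochner_Integration.integral_add) auto
  finally show ?thesis .
qed

theorem C_c_dense:
  fixes f :: "'a \<Rightarrow> complex"
  assumes "integrable M f" "e > 0"
  shows "\<exists>g\<in>C_c T. (\<integral>x. norm (f x - g x) \<partial>M) < e"
  using assms
proof (induction arbitrary: e rule: integrable_induct)
  case (base A c)
  then have "e / (norm c + 1) > 0"
    by (intro divide_pos_pos add_nonneg_pos) auto
  then obtain g where g: "g \<in> C_c T" "(\<integral>x. norm (indicator A x - g x) \<partial>M) < e / (norm c + 1)"
    using C_c_approximates_indicator[OF base(1,2)] by blast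
  have "norm (indicator A x *\<^sub>R c - c * g x) = norm c * norm (indicator A x - g x)" for x
  proof -
    have "indicator A x *\<^sub>R c - c * g x = c * (indicator A x - g x)"
      by (simp add: indicator_def algebra_simps)
    then show ?thesis by (simp add: norm_mult)
  qed
  then have "(\<integral>x. norm (indicator A x *\<^sub>R c - c * g x) \<partial>M) = norm c * (\<integral>x. norm (indicator A x - g x) \<partial>M)"
    by simp
  also have "\<dots> \<le> (norm c + 1) * (\<integral>x. norm (indicator A x - g x) \<partial>M)"
    by (intro mult_right_mono) auto
  also have "\<dots> < e"
    using g(2) by (subst mult.commute, subst pos_less_divide_eq[symmetric]) (auto intro: add_nonneg_pos)
  finally show ?case
    by (rule bexI[OF _ C_c_scale[OF g(1)]])
next
  case (add f g)
  obtain f' where f': "f' \<in> C_c T" "(\<integral>x. norm (f x - f' x) \<partial>M) < e / 2"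
    using add.IH(1)[of "e / 2"] add.prems by auto
  obtain g' where g': "g' \<in> C_c T" "(\<integral>x. norm (g x - g' x) \<partial>M) < e / 2"
    using add.IH(2)[of "e / 2"] add.prems by auto
  have "(\<integral>x. norm (f x + g x - (f' x + g' x)) \<partial>M) \<le> (\<integral>x. norm (f x - f' x) + norm (g x - g' x) \<partial>M)"
    using add.hyps integrable_C_c[OF f'(1)] integrable_C_c[OF g'(1)]
    by (intro integral_mono) (auto intro: norm_diff_triangle_ineq)
  also have "\<dots> = (\<integral>x. norm (f x - f' x) \<partial>M) + (\<integral>x. norm (g x - g' x) \<partial>M)"
    using add.hyps integrable_C_c[OF f'(1)] integrable_C_c[OF g'(1)]
    by (intro Bochner_Integration.integral_add) auto
  also have "\<dots> < e"
    using f' g' by simp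
  finally show ?case
    by (rule bexI[OF _ C_c_add[OF f'(1) g'(1)]])
next
  case (lim f s)
  have "(\<lambda>i. \<integral>x. norm (f x - s i x) \<partial>M) \<longlonglongrightarrow> (\<integral>x. 0 \<partial>M)"
  proof (rule integral_dominated_convergence[where w="\<lambda>x. 3 * norm (f x)"])
    show "AE x in M. (\<lambda>i. norm (f x - s i x)) \<longlonglongrightarrow> 0"
    proof (rule AE_I2)
      fix x assume "x \<in> space M"
      then have "(\<lambda>i. norm (f x - s i x)) \<longlonglongrightarrow> norm (f x - f x)"
        using lim.hyps by (intro tendsto_intros) auto
      then show "(\<lambda>i. norm (f x - s i x)) \<longlonglongrightarrow> 0" by simp
    qed
    show "AE x in M. norm (norm (f x - s i x)) \<le> 3 * norm (f x)" for i
    proof (rule AE_I2)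
      fix x assume "x \<in> space M"
      then show "norm (norm (f x - s i x)) \<le> 3 * norm (f x)"
        using lim.hyps(3)[of x i] norm_triangle_ineq4[of "f x" "s i x"] by simp
    qed
  qed (use lim.hyps in \<open>auto intro!: borel_measurable_integrable\<close>)
  then have "\<forall>\<^sub>F i in sequentially. (\<integral>x. norm (f x - s i x) \<partial>M) < e / 2"
    using lim.prems by (intro order_tendstoD(2)) auto
  then obtain i where i: "(\<integral>x. norm (f x - s i x) \<partial>M) < e / 2"
    by (auto simp: eventually_sequentially)
  obtain g where g: "g \<in> C_c T" "(\<integral>x. norm (s i x - g x) \<partial>M) < e / 2"
    using lim.IH[of "e / 2" i] lim.prems by auto
  have "(\<integral>x. norm (f x - g x) \<partial>M) < e"
    using norm_integral_triangle[OF lim.hyps(4) lim.hyps(1)[of i] integrable_C_c[OF g(1)]] i g(2) by simp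
  then show ?case
    using g(1) by blast
qed

end

section \<open>Completeness of the space of integrable functions\<close>

lemma seminormed_space_L1_functions: "seminormed_space (L1_functions M)"
  unfolding L1_functions_def
proof (rule seminormed_space_function_space)
  fix f g :: "'a \<Rightarrow> complex" assume fg: "f \<in> {f. integrable M f}" "g \<in> {f. integrable M f}"
  have "(\<integral>x. norm (f x + g x) \<partial>M) \<le> (\<integral>x. norm (f x) + norm (g x) \<partial>M)"
    using fg by (intro integral_mono) (auto intro: norm_triangle_ineq)
  then show "(\<integral>x. norm (f x + g x) \<partial>M) \<le> (\<integral>x. norm (f x) \<partial>M) + (\<integral>x. norm (g x) \<partial>M)"
    using fg by simp
qed (auto simp: norm_mult)

text \<open>
  The series of increments converges absolutely almost everywhere, since the integral of the sum
  of their norms is finite; the limit is its pointwise sum.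
\<close>

lemma L1_functions_complete:
  fixes u :: "nat \<Rightarrow> 'a \<Rightarrow> complex"
  assumes u: "\<And>n. integrable M (u n)"
    and summable: "summable (\<lambda>n. \<integral>x. norm (u (Suc n) x - u n x) \<partial>M)"
  shows "\<exists>v. integrable M v \<and> (\<lambda>n. \<integral>x. norm (v x - u n x) \<partial>M) \<longlonglongrightarrow> 0"
proof -
  define d where "d n x = u (Suc n) x - u n x" for n x
  have d: "integrable M (d n)" for n
    unfolding d_def by (intro Bochner_Integration.integrable_diff u)
  note [measurable] = borel_measurable_integrable[OF d]
  have sum_d: "summable (\<lambda>n. \<integral>x. norm (d n x) \<partial>M)"
    using summable by (simp add: d_def)
  have AE_summable: "AE x in M. summable (\<lambda>n. norm (d n x))"
  proof -
    have "(\<integral>\<^sup>+x. (\<Sum>n. ennreal (norm (d n x))) \<partial>M) = (\<Sum>n. \<integral>\<^sup>+x. ennreal (norm (d n x)) \<partial>M)"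
      by (intro nn_integral_suminf) measurable
    also have "\<dots> = (\<Sum>n. ennreal (\<integral>x. norm (d n x) \<partial>M))"
      using d by (simp add: nn_integral_eq_integral)
    also have "\<dots> = ennreal (\<Sum>n. \<integral>x. norm (d n x) \<partial>M)"
      by (intro suminf_ennreal2 sum_d) simp
    also have "\<dots> < \<infinity>" by simp
    finally have "AE x in M. (\<Sum>n. ennreal (norm (d n x))) \<noteq> \<infinity>"
      by (intro nn_integral_PInf_AE) (auto simp: less_top)
    then show ?thesis
      by eventually_elim (intro summable_suminf_not_top, auto)
  qed
  define v where "v x = u 0 x + (\<Sum>n. d n x)" for x
  have tail: "integrable M (\<lambda>x. \<Sum>i. d (i + n) x)"
    and tail_le: "(\<integral>x. norm (\<Sum>i. d (i + n) x) \<partial>M) \<le> (\<Sum>i. \<integral>x. norm (d (i + n) x) \<partial>M)" for n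
  proof -
    have s1: "AE x in M. summable (\<lambda>i. norm (d (i + n) x))"
      using AE_summable by eventually_elim (rule summable_ignore_initial_segment)
    have s2: "summable (\<lambda>i. \<integral>x. norm (d (i + n) x) \<partial>M)"
      using sum_d by (rule summable_ignore_initial_segment)
    show int: "integrable M (\<lambda>x. \<Sum>i. d (i + n) x)"
      by (rule integrable_suminf[OF d s1 s2])
    have s1': "AE x in M. summable (\<lambda>i. norm (norm (d (i + n) x)))"
      using s1 by simp
    have s2': "summable (\<lambda>i. \<integral>x. norm (norm (d (i + n) x)) \<partial>M)"
      using s2 by simp
    have "(\<integral>x. norm (\<Sum>i. d (i + n) x) \<partial>M) \<le> (\<integral>x. (\<Sum>i. norm (d (i + n) x)) \<partial>M)"
    proof (rule integral_mono_AE)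
      show "integrable M (\<lambda>x. norm (\<Sum>i. d (i + n) x))"
        using int by simp
      show "integrable M (\<lambda>x. \<Sum>i. norm (d (i + n) x))"
        by (rule integrable_suminf[OF integrable_norm[OF d] s1' s2'])
      show "AE x in M. norm (\<Sum>i. d (i + n) x) \<le> (\<Sum>i. norm (d (i + n) x))"
        using s1 by eventually_elim (rule summable_norm)
    qed
    also have "\<dots> = (\<Sum>i. \<integral>x. norm (d (i + n) x) \<partial>M)"
      by (rule integral_suminf[OF integrable_norm[OF d] s1' s2'])
    finally show "(\<integral>x. norm (\<Sum>i. d (i + n) x) \<partial>M) \<le> (\<Sum>i. \<integral>x. norm (d (i + n) x) \<partial>M)" .
  qed
  have v: "integrable M v"
    unfolding v_def using tail[of 0] by (intro Bochner_Integration.integrable_add u) simp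
  have le: "(\<integral>x. norm (v x - u n x) \<partial>M) \<le> (\<Sum>i. \<integral>x. norm (d (i + n) x) \<partial>M)" for n
  proof -
    have "AE x in M. v x - u n x = (\<Sum>i. d (i + n) x)"
      using AE_summable
    proof eventually_elim
      fix x assume "summable (\<lambda>n. norm (d n x))"
      then have "summable (\<lambda>n. d n x)"
        by (rule summable_norm_cancel)
      then have "(\<Sum>i. d (i + n) x) = (\<Sum>i. d i x) - (\<Sum>i<n. d i x)"
        by (rule suminf_minus_initial_segment)
      also have "(\<Sum>i<n. d i x) = u n x - u 0 x"
        unfolding d_def by (rule sum_lessThan_telescope)
      finally show "v x - u n x = (\<Sum>i. d (i + n) x)"
        by (simp add: v_def)
    qed
    then have "AE x in M. norm (v x - u n x) = norm (\<Sum>i. d (i + n) x)"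
      by eventually_elim simp
    then have "(\<integral>x. norm (v x - u n x) \<partial>M) = (\<integral>x. norm (\<Sum>i. d (i + n) x) \<partial>M)"
    proof (intro integral_cong_AE)
      show "(\<lambda>x. norm (v x - u n x)) \<in> borel_measurable M"
        by (rule borel_measurable_integrable[OF integrable_norm[OF
                Bochner_Integration.integrable_diff[OF v u]]])
      show "(\<lambda>x. norm (\<Sum>i. d (i + n) x)) \<in> borel_measurable M"
        by (rule borel_measurable_integrable[OF integrable_norm[OF tail]])
    qed auto
    then show ?thesis
      using tail_le[of n] by simp
  qed
  have "(\<lambda>n. \<Sum>i. \<integral>x. norm (d (i + n) x) \<partial>M) \<longlonglongrightarrow> 0"
    using suminf_exist_split2[OF sum_d] by simp
  then have "(\<lambda>n. \<integral>x. norm (v x - u n x) \<partial>M) \<longlonglongrightarrow> 0"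
    by (rule tendsto_0_bounded[OF _ le, rotated]) simp
  then show ?thesis
    using v by blast
qed

section \<open>Topological groups and Haar measures\<close>

lemma left_haar_measure_regular: "left_haar_measure G T M \<Longrightarrow> regular_borel_measure T M"
  unfolding left_haar_measure_def regular_borel_measure_def by blast

context topological_group
begin

lemma continuous_map_group_mult:
  assumes "continuous_map X T f" "continuous_map X T g"
  shows "continuous_map X T (\<lambda>x. f x \<otimes> g x)"
  using continuous_map_compose[OF continuous_map_pairedI[OF assms] continuous_mult]
  by (simp add: o_def)

lemma continuous_map_group_inv:
  assumes "continuous_map X T f"
  shows "continuous_map X T (\<lambda>x. inv (f x))"
  using continuous_map_compose[OF assms continuous_inv] by (simp add: o_def)

lemma continuous_map_left_translation: "g \<in> carrier G \<Longrightarrow> continuous_map T T (\<lambda>x. g \<otimes> x)"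
  using continuous_map_group_mult[of T "\<lambda>x. g" "\<lambda>x. x"] by (simp add: topspace_eq)

lemma continuous_map_right_translation: "g \<in> carrier G \<Longrightarrow> continuous_map T T (\<lambda>x. x \<otimes> g)"
  using continuous_map_group_mult[of T "\<lambda>x. x" "\<lambda>x. g"] by (simp add: topspace_eq)

lemma l_coset_eq_vimage:
  assumes "g \<in> carrier G" "A \<subseteq> carrier G"
  shows "g <# A = {x \<in> carrier G. inv g \<otimes> x \<in> A}"
proof (intro equalityI subsetI)
  fix x assume "x \<in> g <# A"
  then obtain a where "a \<in> A" "x = g \<otimes> a"
    by (auto simp: l_coset_def)
  then show "x \<in> {x \<in> carrier G. inv g \<otimes> x \<in> A}"
    using assms by (auto simp flip: m_assoc)
next
  fix x assume x: "x \<in> {x \<in> carrier G. inv g \<otimes> x \<in> A}"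
  then have "x = g \<otimes> (inv g \<otimes> x)"
    using assms by (simp flip: m_assoc)
  then show "x \<in> g <# A"
    using x unfolding l_coset_def by blast
qed

lemma openin_l_coset:
  assumes "g \<in> carrier G" "openin T U"
  shows "openin T (g <# U)"
proof -
  have "openin T {x \<in> topspace T. inv g \<otimes> x \<in> U}"
    using continuous_map_left_translation[of "inv g"] assms
    by (simp add: openin_continuous_map_preimage)
  then show ?thesis
    using assms openin_subset[OF assms(2)] by (simp add: l_coset_eq_vimage topspace_eq)
qed

context
  fixes M assumes M: "left_haar_measure G T M"
begin

interpretation regular_borel_measure T M
  by (rule left_haar_measure_regular[OF M])

lemma space_haar: "space M = carrier G"
  by (simp add: space_eq topspace_eq)

lemma measurable_left_translation: "g \<in> carrier G \<Longrightarrow> (\<lambda>x. g \<otimes> x) \<in> measurable M M"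
  by (rule measurable_continuous_map[OF continuous_map_left_translation])
    (simp_all add: space_eq openin_sets)

lemma haar_left_invariant: "\<lbrakk>g \<in> carrier G; A \<in> sets M\<rbrakk> \<Longrightarrow> emeasure M (g <# A) = emeasure M A"
  using M by (simp add: left_haar_measure_def)

lemma haar_integral_left_translation:
  fixes f :: "'a \<Rightarrow> complex"
  assumes g: "g \<in> carrier G" and f: "f \<in> borel_measurable M"
  shows "(\<integral>x. f (g \<otimes> x) \<partial>M) = (\<integral>x. f x \<partial>M)"
proof -
  have "distr M M (\<lambda>x. g \<otimes> x) = M"
  proof (rule measure_eqI)
    fix A assume "A \<in> sets (distr M M (\<lambda>x. g \<otimes> x))"
    then have A: "A \<in> sets M" by simp
    then have "A \<subseteq> carrier G"
      using sets.sets_into_space space_haar by blast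
    then have "inv g <# A = (\<lambda>x. g \<otimes> x) -` A \<inter> space M"
      using g by (auto simp: l_coset_eq_vimage space_haar)
    then show "emeasure (distr M M (\<lambda>x. g \<otimes> x)) A = emeasure M A"
      using haar_left_invariant[of "inv g" A] g A
      by (simp add: emeasure_distr measurable_left_translation)
  qed simp
  then show ?thesis
    using integral_distr[OF measurable_left_translation[OF g] f] by simp
qed

text \<open>
  If an open set were null, finitely many of its translates would cover any given compact set,
  so all compact sets would be null, and by inner regularity the whole group as well.
\<close>

lemma haar_open_positive:
  assumes U: "openin T U" "U \<noteq> {}"
  shows "emeasure M U \<noteq> 0"
proof
  assume null: "emeasure M U = 0"
  have UG: "U \<subseteq> carrier G"
    using openin_subset[OF U(1)] by (simp add: topspace_eq)
  obtain u where u: "u \<in> U" "u \<in> carrier G"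
    using U(2) UG by blast
  have "emeasure M K = 0" if K: "compactin T K" for K
  proof -
    have KG: "K \<subseteq> carrier G"
      using compactin_subset_topspace[OF K] by (simp add: topspace_eq)
    let ?\<U> = "(\<lambda>g. g <# U) ` carrier G"
    have "K \<subseteq> \<Union>?\<U>"
    proof
      fix x assume "x \<in> K"
      then have x: "x \<in> carrier G" using KG by blast
      then have "x = (x \<otimes> inv u) \<otimes> u"
        using u by (simp add: m_assoc)
      then have "x \<in> (x \<otimes> inv u) <# U"
        using u unfolding l_coset_def by blast
      then show "x \<in> \<Union>?\<U>"
        using x u by (intro UN_I[of "x \<otimes> inv u"]) simp_all
    qed
    moreover have "\<forall>V\<in>?\<U>. openin T V"
      using openin_l_coset U(1) by blast
    ultimately obtain \<F> where \<F>: "finite \<F>" "\<F> \<subseteq> ?\<U>" "K \<subseteq> \<Union>\<F>"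
      using K unfolding compactin_def by meson
    have "V \<in> null_sets M" if V: "V \<in> \<F>" for V
    proof -
      obtain g where g: "g \<in> carrier G" "V = g <# U"
        using V \<F>(2) by blast
      show ?thesis
        unfolding g(2)
      proof (rule null_setsI)
        show "emeasure M (g <# U) = 0"
          using haar_left_invariant[OF g(1) openin_sets[OF U(1)]] null by simp
        show "g <# U \<in> sets M"
          by (rule openin_sets[OF openin_l_coset[OF g(1) U(1)]])
      qed
    qed
    then have "(\<Union>V\<in>\<F>. V) \<in> null_sets M"
      by (intro null_sets_UN' countable_finite \<F>(1))
    then have "emeasure M (\<Union>\<F>) = 0" "\<Union>\<F> \<in> sets M"
      by (simp_all add: null_setsD1 null_setsD2)
    then show ?thesis
      using emeasure_mono[OF \<F>(3), of M] by simp
  qed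
  then have "emeasure M (topspace T) \<le> 0"
    unfolding inner_regular[OF openin_topspace] by (intro SUP_least) auto
  then show False
    using M by (simp add: left_haar_measure_def space_eq)
qed

end

end

section \<open>Cosets and covariant functions\<close>

locale closed_normal_subgroup = locally_compact_group G T + normal N G
  for G :: "('a, 'm) monoid_scheme" (structure) and T :: "'a topology" and N :: "'a set" +
  assumes closed_N: "closedin T N"
begin

abbreviation coset :: "'a \<Rightarrow> 'a set"
  where "coset x \<equiv> x <# N"

abbreviation QT :: "'a set topology"
  where "QT \<equiv> coset_topology G T N"

lemma N_carrier: "k \<in> N \<Longrightarrow> k \<in> carrier G"
  by (rule mem_carrier)

lemma topological_group_N: "topological_group (G\<lparr>carrier := N\<rparr>) (subtopology T N)"
proof -
  have N: "subgroup N G"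
    by (rule subgroup_axioms)
  interpret H: group "G\<lparr>carrier := N\<rparr>"
    by (rule subgroup.subgroup_is_group[OF N is_group])
  show ?thesis
  proof
    show "topspace (subtopology T N) = carrier (G\<lparr>carrier := N\<rparr>)"
      using closedin_subset[OF closed_N] by auto
    have "continuous_map (subtopology (prod_topology T T) (N \<times> N)) T (\<lambda>(x, y). x \<otimes> y)"
      by (rule continuous_map_from_subtopology[OF continuous_mult])
    then show "continuous_map (prod_topology (subtopology T N) (subtopology T N)) (subtopology T N)
        (\<lambda>(x, y). x \<otimes>\<^bsub>G\<lparr>carrier := N\<rparr>\<^esub> y)"
      using subgroup.m_closed[OF N]
      by (auto simp: continuous_map_in_subtopology subtopology_Times)
    have "continuous_map (subtopology T N) (subtopology T N) (\<lambda>x. inv x)"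
      using subgroup.m_inv_closed[OF N] continuous_map_from_subtopology[OF continuous_inv]
      by (auto simp: continuous_map_in_subtopology)
    then show "continuous_map (subtopology T N) (subtopology T N) (\<lambda>x. inv\<^bsub>G\<lparr>carrier := N\<rparr>\<^esub> x)"
      by (rule continuous_map_eq) (simp add: m_inv_consistent[OF N])
  qed
qed

lemma topspace_N: "topspace (subtopology T N) = N"
  using closedin_subset[OF closed_N] by auto

lemma quotient_map_coset: "quotient_map T QT coset"
  using quotient_map_coset_topology topological_group_axioms normal_axioms by blast

lemma topspace_QT: "topspace QT = coset ` carrier G"
  using quotient_map_coset by (simp add: quotient_map_def topspace_eq)

lemma coset_eq_iff_ex:
  assumes "x \<in> carrier G" "y \<in> carrier G"
  shows "coset x = coset y \<longleftrightarrow> (\<exists>k\<in>N. y = x \<otimes> k)"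
proof
  assume "coset x = coset y"
  moreover have "y \<in> coset y"
    using assms(2) subgroup.one_closed[OF subgroup_axioms] unfolding l_coset_def by force
  ultimately show "\<exists>k\<in>N. y = x \<otimes> k"
    unfolding l_coset_def by blast
next
  assume "\<exists>k\<in>N. y = x \<otimes> k"
  then have "y \<in> coset x"
    unfolding l_coset_def by blast
  then show "coset x = coset y"
    by (rule l_repr_independence[OF _ assms(1) subgroup_axioms])
qed

lemma closedin_QT_iff:
  "U \<subseteq> topspace QT \<Longrightarrow> closedin QT U \<longleftrightarrow> closedin T {x \<in> topspace T. coset x \<in> U}"
  using quotient_map_coset by (simp add: quotient_map_closedin)

lemma closedin_coset_image:
  assumes "closedin T C" and "\<And>x k. \<lbrakk>x \<in> C; k \<in> N\<rbrakk> \<Longrightarrow> x \<otimes> k \<in> C"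
  shows "closedin QT (coset ` C)"
proof -
  have CG: "C \<subseteq> carrier G"
    using closedin_subset[OF assms(1)] by (simp add: topspace_eq)
  have "{x \<in> topspace T. coset x \<in> coset ` C} = C"
  proof (intro equalityI subsetI)
    fix x assume "x \<in> {x \<in> topspace T. coset x \<in> coset ` C}"
    then obtain c where c: "x \<in> carrier G" "c \<in> C" "coset c = coset x"
      by (auto simp: topspace_eq)
    then obtain k where "k \<in> N" "x = c \<otimes> k"
      using coset_eq_iff_ex[of c x] CG by blast
    then show "x \<in> C"
      using assms(2) c by blast
  qed (use CG in \<open>auto simp: topspace_eq\<close>)
  moreover have "coset ` C \<subseteq> topspace QT"
    using CG by (auto simp: topspace_QT)
  ultimately show ?thesis
    using assms(1) by (simp only: closedin_QT_iff)
qed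

text \<open>
  This replaces the Hausdorff property of the quotient. The condition \<open>coset x \<notin> coset ` K\<close> says that
  \<open>{x} \<times> K\<close> lies in the open set of pairs with \<open>inv x \<otimes> y \<notin> N\<close>, and by the tube lemma this remains true
  for all points near \<open>x\<close>.
\<close>

lemma closedin_coset_image_compact:
  assumes K: "compactin T K"
  shows "closedin QT (coset ` K)"
proof -
  have KG: "K \<subseteq> carrier G"
    using compactin_subset_topspace[OF K] by (simp add: topspace_eq)
  define C where "C = {x \<in> carrier G. coset x \<in> coset ` K}"
  have C_iff: "x \<in> C \<longleftrightarrow> (\<exists>y\<in>K. inv x \<otimes> y \<in> N)" if x: "x \<in> carrier G" for x
  proof -
    have "coset x = coset y \<longleftrightarrow> inv x \<otimes> y \<in> N" if "y \<in> K" for y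
    proof -
      have y: "y \<in> carrier G" using that KG by blast
      have "(\<exists>k\<in>N. y = x \<otimes> k) \<longleftrightarrow> inv x \<otimes> y \<in> N"
      proof
        assume "\<exists>k\<in>N. y = x \<otimes> k"
        then obtain k where "k \<in> N" "y = x \<otimes> k" by blast
        then show "inv x \<otimes> y \<in> N"
          using x N_carrier by (simp flip: m_assoc)
      next
        assume "inv x \<otimes> y \<in> N"
        moreover have "y = x \<otimes> (inv x \<otimes> y)"
          using x y by (simp flip: m_assoc)
        ultimately show "\<exists>k\<in>N. y = x \<otimes> k" by blast
      qed
      then show ?thesis
        using coset_eq_iff_ex[OF x y] by blast
    qed
    then show ?thesis
      using x by (auto simp: C_def)
  qed
  have "openin T (topspace T - C)"
  proof (subst openin_subopen, intro ballI)
    fix x assume "x \<in> topspace T - C"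
    then have x: "x \<in> carrier G" "x \<notin> C" by (auto simp: topspace_eq)
    let ?P = "prod_topology T T"
    have "continuous_map ?P T (\<lambda>p. inv (fst p) \<otimes> snd p)"
      by (intro continuous_map_group_mult continuous_map_group_inv continuous_map_fst continuous_map_snd)
    then have op: "openin ?P {p \<in> topspace ?P. inv (fst p) \<otimes> snd p \<in> topspace T - N}"
      using closed_N by (intro openin_continuous_map_preimage) auto
    have sub: "{x} \<times> K \<subseteq> {p \<in> topspace ?P. inv (fst p) \<otimes> snd p \<in> topspace T - N}"
      using x C_iff[OF x(1)] KG by (auto simp: topspace_eq)
    have "compactin T {x}"
      using x by (simp add: topspace_eq)
    from Wallace_theorem_prod_topology[OF this K op sub]
    obtain U V where UV: "openin T U" "openin T V" "{x} \<subseteq> U" "K \<subseteq> V"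
      "U \<times> V \<subseteq> {p \<in> topspace ?P. inv (fst p) \<otimes> snd p \<in> topspace T - N}" .
    have "U \<subseteq> topspace T - C"
    proof
      fix y assume y: "y \<in> U"
      then have yG: "y \<in> carrier G"
        using openin_subset[OF UV(1)] by (auto simp: topspace_eq)
      have "inv y \<otimes> z \<notin> N" if "z \<in> K" for z
      proof -
        have "(y, z) \<in> U \<times> V"
          using UV(4) y that by blast
        then show ?thesis
          using subsetD[OF UV(5)] by fastforce
      qed
      then show "y \<in> topspace T - C"
        using C_iff[OF yG] yG by (auto simp: topspace_eq)
    qed
    then show "\<exists>U. openin T U \<and> x \<in> U \<and> U \<subseteq> topspace T - C"
      using UV by blast
  qed
  then have "closedin T C"
    by (simp add: closedin_def C_def topspace_eq)
  moreover have "coset ` K \<subseteq> topspace QT"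
    using KG by (auto simp: topspace_QT)
  ultimately show ?thesis
    by (simp add: closedin_QT_iff C_def topspace_eq)
qed

lemma openin_coset_image:
  assumes U: "openin T U"
  shows "openin QT (coset ` U)"
proof -
  have UG: "U \<subseteq> carrier G"
    using openin_subset[OF U] by (simp add: topspace_eq)
  have "{x \<in> topspace T. coset x \<in> coset ` U} = (\<Union>k\<in>N. {x \<in> topspace T. x \<otimes> k \<in> U})"
  proof -
    have iff: "coset x \<in> coset ` U \<longleftrightarrow> (\<exists>k\<in>N. x \<otimes> k \<in> U)" if x: "x \<in> carrier G" for x
    proof
      assume "coset x \<in> coset ` U"
      then obtain y where y: "y \<in> U" "coset x = coset y" by blast
      then obtain k where "k \<in> N" "y = x \<otimes> k"
        using coset_eq_iff_ex[OF x, of y] UG by blast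
      then show "\<exists>k\<in>N. x \<otimes> k \<in> U"
        using y(1) by blast
    next
      assume "\<exists>k\<in>N. x \<otimes> k \<in> U"
      then obtain k where k: "k \<in> N" "x \<otimes> k \<in> U" by blast
      then have "coset x = coset (x \<otimes> k)"
        using coset_eq_iff_ex[OF x, of "x \<otimes> k"] UG by blast
      then show "coset x \<in> coset ` U"
        using k(2) by simp
    qed
    show ?thesis
      unfolding topspace_eq by (simp add: iff set_eq_iff cong: conj_cong)
  qed
  moreover have "openin T {x \<in> topspace T. x \<otimes> k \<in> U}" if "k \<in> N" for k
    using that by (intro openin_continuous_map_preimage[OF continuous_map_right_translation U] N_carrier)
  ultimately have "openin T {x \<in> topspace T. coset x \<in> coset ` U}"
    by auto
  moreover have "coset ` U \<subseteq> topspace QT"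
    using UG by (auto simp: topspace_QT)
  ultimately show ?thesis
    using quotient_map_coset by (simp add: quotient_map_def)
qed

text \<open>
  The images of relatively compact open sets form an open cover of the quotient, because the
  quotient map is open.
\<close>

lemma compact_coset_lift:
  assumes C: "compactin QT C"
  obtains K where "compactin T K" "C \<subseteq> coset ` K"
proof -
  define \<U> where "\<U> = {V. openin QT V \<and> (\<exists>L. compactin T L \<and> V \<subseteq> coset ` L)}"
  have cover: "C \<subseteq> \<Union>\<U>"
  proof
    fix c assume "c \<in> C"
    then obtain x where x: "x \<in> topspace T" "c = coset x"
      using compactin_subset_topspace[OF C] by (auto simp: topspace_QT topspace_eq)
    then obtain U L where "openin T U" "compactin T L" "x \<in> U" "U \<subseteq> L"
      using locally_compact unfolding locally_compact_space_def by blast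
    then have "coset ` U \<in> \<U>" "c \<in> coset ` U"
      unfolding \<U>_def x(2) using openin_coset_image by blast+
    then show "c \<in> \<Union>\<U>"
      by (rule UnionI)
  qed
  have op: "openin QT V" if "V \<in> \<U>" for V
    using that by (simp add: \<U>_def)
  obtain \<F> where \<F>: "finite \<F>" "\<F> \<subseteq> \<U>" "C \<subseteq> \<Union>\<F>"
    using compactinD[OF C op cover] by blast
  have "\<forall>V\<in>\<F>. \<exists>L. compactin T L \<and> V \<subseteq> coset ` L"
    using \<F>(2) unfolding \<U>_def by blast
  from bchoice[OF this] obtain L where L: "\<forall>V\<in>\<F>. compactin T (L V) \<and> V \<subseteq> coset ` L V"
    by blast
  have "compactin T (\<Union>(L ` \<F>))"
    by (rule compactin_Union) (use L \<F>(1) in auto)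
  moreover have "C \<subseteq> coset ` \<Union>(L ` \<F>)"
  proof
    fix c assume "c \<in> C"
    then obtain V where "V \<in> \<F>" "c \<in> V"
      using \<F>(3) by blast
    then show "c \<in> coset ` \<Union>(L ` \<F>)"
      using L by blast
  qed
  ultimately show thesis
    by (rule that)
qed

text \<open>
  The representative picked by Hilbert choice is irrelevant for functions that are constant on
  the coset.
\<close>

lemma on_cosets_coset:
  assumes x: "x \<in> carrier G" and inv: "\<And>k. k \<in> N \<Longrightarrow> g (x \<otimes> k) = g x"
  shows "on_cosets g (coset x) = g x"
proof -
  have "x \<otimes> \<one> \<in> coset x"
    unfolding l_coset_def using subgroup.one_closed[OF subgroup_axioms] by blast
  then have "(SOME y. y \<in> coset x) \<in> coset x"
    by (rule someI)
  then obtain k where "k \<in> N" "(SOME y. y \<in> coset x) = x \<otimes> k"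
    unfolding l_coset_def by blast
  then show ?thesis
    using inv by (simp add: on_cosets_def)
qed

abbreviation is_character :: "('a \<Rightarrow> complex) \<Rightarrow> bool"
  where "is_character \<xi> \<equiv> \<xi> \<in> characters (G\<lparr>carrier := N\<rparr>) (subtopology T N)"

lemma character_norm: "\<lbrakk>is_character \<xi>; k \<in> N\<rbrakk> \<Longrightarrow> norm (\<xi> k) = 1"
  by (auto simp: characters_def hom_def circle_group_def)

lemma character_mult: "\<lbrakk>is_character \<xi>; k \<in> N; l \<in> N\<rbrakk> \<Longrightarrow> \<xi> (k \<otimes> l) = \<xi> k * \<xi> l"
  by (auto simp: characters_def hom_def circle_group_def)

lemma character_continuous: "is_character \<xi> \<Longrightarrow> continuous_map (subtopology T N) euclidean \<xi>"
  by (simp add: characters_def)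

lemma character_cnj: "\<lbrakk>is_character \<xi>; k \<in> N\<rbrakk> \<Longrightarrow> \<xi> k * cnj (\<xi> k) = 1"
  using character_norm[of \<xi> k] by (simp add: complex_norm_square[symmetric])

lemma trivial_character: "is_character (\<lambda>_. 1)"
  by (auto simp: characters_def hom_def circle_group_def)

abbreviation C_\<xi> :: "('a \<Rightarrow> complex) \<Rightarrow> ('a \<Rightarrow> complex) set"
  where "C_\<xi> \<equiv> C_xi_functions G T N"

text \<open>
  The set where \<open>\<psi>\<close> does not vanish is a union of cosets, hence so is its closure, since right
  translations are continuous. Therefore the image of the support is closed, and it is contained
  in \<open>C\<close> because the preimage of \<open>C\<close> is closed.
\<close>

lemma C_xiI:
  assumes "continuous_map T euclidean \<psi>" "\<And>x k. \<lbrakk>x \<in> carrier G; k \<in> N\<rbrakk> \<Longrightarrow> \<psi> (x \<otimes> k) = \<xi> k * \<psi> x"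
    and "\<And>x. x \<notin> carrier G \<Longrightarrow> \<psi> x = 0"
    and C: "compactin QT C" "closedin QT C" "\<And>x. \<lbrakk>x \<in> carrier G; \<psi> x \<noteq> 0\<rbrakk> \<Longrightarrow> coset x \<in> C"
    and \<xi>: "is_character \<xi>"
  shows "\<psi> \<in> C_\<xi> \<xi>"
proof -
  have "closedin T {x \<in> topspace T. coset x \<in> C}"
    by (rule closedin_continuous_map_preimage[OF quotient_imp_continuous_map[OF quotient_map_coset] C(2)])
  then have "topological_support T \<psi> \<subseteq> {x \<in> topspace T. coset x \<in> C}"
    using C(3) by (intro topological_support_minimal) (auto simp: topspace_eq)
  then have sub: "coset ` topological_support T \<psi> \<subseteq> C" by blast
  have "closedin QT (coset ` topological_support T \<psi>)"
  proof (rule closedin_coset_image[OF closedin_topological_support])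
    fix x k assume x: "x \<in> topological_support T \<psi>" and k: "k \<in> N"
    let ?S = "{x \<in> topspace T. \<psi> x \<noteq> 0}"
    have "(\<lambda>x. x \<otimes> k) ` ?S \<subseteq> ?S"
      using k assms(2) character_norm[OF \<xi> k] by (auto simp: topspace_eq N_carrier)
    then have "(\<lambda>x. x \<otimes> k) ` (T closure_of ?S) \<subseteq> T closure_of ?S"
      using continuous_map_image_closure_subset[OF continuous_map_right_translation[OF N_carrier[OF k]], of ?S]
        closure_of_mono by blast
    then show "x \<otimes> k \<in> topological_support T \<psi>"
      using x unfolding topological_support_def by blast
  qed
  then have "compactin QT (coset ` topological_support T \<psi>)"
    by (rule closed_compactin[OF C(1) sub])
  then show ?thesis
    using assms(1-3) by (simp add: C_xi_functions_def topspace_eq)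
qed

lemma C_xiD:
  assumes "\<psi> \<in> C_\<xi> \<xi>"
  shows "continuous_map T euclidean \<psi>" "\<And>x k. \<lbrakk>x \<in> carrier G; k \<in> N\<rbrakk> \<Longrightarrow> \<psi> (x \<otimes> k) = \<xi> k * \<psi> x"
    and "\<And>x. x \<notin> carrier G \<Longrightarrow> \<psi> x = 0"
    and "compactin QT (coset ` topological_support T \<psi>)"
  using assms by (auto simp: C_xi_functions_def topspace_eq)

lemma C_xi_support:
  assumes \<psi>: "\<psi> \<in> C_\<xi> \<xi>" and \<xi>: "is_character \<xi>"
  obtains C where "compactin QT C" "closedin QT C" "\<And>x. \<lbrakk>x \<in> carrier G; \<psi> x \<noteq> 0\<rbrakk> \<Longrightarrow> coset x \<in> C"
proof -
  obtain K where K: "compactin T K" "coset ` topological_support T \<psi> \<subseteq> coset ` K"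
    using compact_coset_lift[OF C_xiD(4)[OF \<psi>]] by blast
  show thesis
  proof
    show "compactin QT (coset ` K)"
      by (rule image_compactin[OF K(1) quotient_imp_continuous_map[OF quotient_map_coset]])
    show "closedin QT (coset ` K)"
      by (rule closedin_coset_image_compact[OF K(1)])
    show "coset x \<in> coset ` K" if "x \<in> carrier G" "\<psi> x \<noteq> 0" for x
      using K(2) topological_support_subset[of x T \<psi>] that by (auto simp: topspace_eq)
  qed
qed

lemma C_xi_add:
  assumes "\<psi> \<in> C_\<xi> \<xi>" "\<phi> \<in> C_\<xi> \<xi>" and \<xi>: "is_character \<xi>"
  shows "(\<lambda>x. \<psi> x + \<phi> x) \<in> C_\<xi> \<xi>"
proof -
  obtain C where C: "compactin QT C" "closedin QT C" "\<And>x. \<lbrakk>x \<in> carrier G; \<psi> x \<noteq> 0\<rbrakk> \<Longrightarrow> coset x \<in> C"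
    using C_xi_support[OF assms(1) \<xi>] by blast
  obtain D where D: "compactin QT D" "closedin QT D" "\<And>x. \<lbrakk>x \<in> carrier G; \<phi> x \<noteq> 0\<rbrakk> \<Longrightarrow> coset x \<in> D"
    using C_xi_support[OF assms(2) \<xi>] by blast
  show ?thesis
  proof (rule C_xiI[OF _ _ _ _ _ _ \<xi>])
    show "compactin QT (C \<union> D)" "closedin QT (C \<union> D)"
      using C D by (auto intro: compactin_Un)
    show "coset x \<in> C \<union> D" if "x \<in> carrier G" "\<psi> x + \<phi> x \<noteq> 0" for x
      using C(3)[of x] D(3)[of x] that by (cases "\<psi> x = 0") auto
    show "continuous_map T euclidean (\<lambda>x. \<psi> x + \<phi> x)"
      by (intro continuous_map_add C_xiD(1)[OF assms(1)] C_xiD(1)[OF assms(2)])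
  qed (simp_all add: C_xiD(2,3)[OF assms(1)] C_xiD(2,3)[OF assms(2)] distrib_left)
qed

lemma C_xi_smult:
  assumes "\<psi> \<in> C_\<xi> \<xi>" and \<xi>: "is_character \<xi>"
  shows "(\<lambda>x. c * \<psi> x) \<in> C_\<xi> \<xi>"
proof -
  obtain C where C: "compactin QT C" "closedin QT C" "\<And>x. \<lbrakk>x \<in> carrier G; \<psi> x \<noteq> 0\<rbrakk> \<Longrightarrow> coset x \<in> C"
    using C_xi_support[OF assms(1) \<xi>] by blast
  show ?thesis
    by (rule C_xiI[OF _ _ _ C(1,2) _ \<xi>])
      (auto simp: C_xiD(2,3)[OF assms(1)] C continuous_map_mult C_xiD(1)[OF assms(1)])
qed

lemma C_xi_zero: "is_character \<xi> \<Longrightarrow> (\<lambda>x. 0) \<in> C_\<xi> \<xi>"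
  by (rule C_xiI[where C="{}"]) auto

lemma on_cosets_norm_C_xi:
  assumes "\<psi> \<in> C_\<xi> \<xi>" "is_character \<xi>" "x \<in> carrier G"
  shows "on_cosets (\<lambda>y. norm (\<psi> y)) (coset x) = norm (\<psi> x)"
  using assms by (intro on_cosets_coset) (auto simp: C_xiD(2) norm_mult character_norm)

end

section \<open>The operator on compactly supported functions\<close>

locale haar_quotient = closed_normal_subgroup G T N
  for G :: "('a, 'm) monoid_scheme" (structure) and T :: "'a topology" and N :: "'a set" +
  fixes \<mu>G \<mu>N :: "'a measure" and \<mu>Q :: "'a set measure"
  assumes haar_G: "left_haar_measure G T \<mu>G"
    and haar_N: "left_haar_measure (G\<lparr>carrier := N\<rparr>) (subtopology T N) \<mu>N"
    and haar_Q: "left_haar_measure (G Mod N) QT \<mu>Q"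
    and weil: "weil_formula G \<mu>G \<mu>N \<mu>Q"

sublocale haar_quotient \<subseteq> muG: locally_compact_measure T \<mu>G
  using left_haar_measure_regular[OF haar_G] locally_compact Hausdorff
  by (simp add: locally_compact_measure_def locally_compact_measure_axioms_def)

sublocale haar_quotient \<subseteq> muN: regular_borel_measure "subtopology T N" \<mu>N
  by (rule left_haar_measure_regular[OF haar_N])

sublocale haar_quotient \<subseteq> muQ: regular_borel_measure QT \<mu>Q
  by (rule left_haar_measure_regular[OF haar_Q])

context haar_quotient
begin

lemma space_N: "space \<mu>N = N"
  using muN.space_eq unfolding topspace_N .

lemma space_Q: "space \<mu>Q = coset ` carrier G"
  by (simp add: muQ.space_eq topspace_QT)

lemma continuous_fibre:
  assumes f: "continuous_map T euclidean f" and x: "x \<in> carrier G"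
  shows "continuous_map (subtopology T N) euclidean (\<lambda>s. f (x \<otimes> s))"
  using continuous_map_compose[OF continuous_map_from_subtopology[OF continuous_map_left_translation[OF x]] f]
  by (simp add: o_def)

lemma compact_closed_in_N:
  assumes "compactin T L"
  shows "compactin (subtopology T N) (L \<inter> N)" "closedin (subtopology T N) (L \<inter> N)"
proof -
  show *: "compactin (subtopology T N) (L \<inter> N)"
    using compact_Int_closedin[OF assms closed_N] by (simp add: compactin_subtopology)
  show "closedin (subtopology T N) (L \<inter> N)"
    by (rule compactin_imp_closedin[OF Hausdorff_space_subtopology[OF Hausdorff] *])
qed

lemma integrable_fibre:
  assumes f: "f \<in> C_c T" and x: "x \<in> carrier G" and c: "continuous_map (subtopology T N) euclidean c"
  shows "integrable \<mu>N (\<lambda>s. f (x \<otimes> s) * c s)"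
proof (rule muN.integrable_continuous_compact_support)
  let ?L = "(\<lambda>y. inv x \<otimes> y) ` topological_support T f"
  have L: "compactin T ?L"
    using x by (intro image_compactin[OF C_c_support[OF f] continuous_map_left_translation]) simp
  show "compactin (subtopology T N) (?L \<inter> N)" "closedin (subtopology T N) (?L \<inter> N)"
    by (rule compact_closed_in_N[OF L])+
  show "continuous_map (subtopology T N) euclidean (\<lambda>s. f (x \<otimes> s) * c s)"
    by (intro continuous_map_mult continuous_fibre C_c_continuous f x c)
  fix s assume s: "s \<in> topspace (subtopology T N)" "s \<notin> ?L \<inter> N"
  then have sN: "s \<in> N" by (simp add: topspace_N)
  have "x \<otimes> s \<notin> topological_support T f"
  proof
    assume "x \<otimes> s \<in> topological_support T f"
    then have "inv x \<otimes> (x \<otimes> s) \<in> ?L" by (rule imageI)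
    then show False
      using s sN x N_carrier[OF sN] by (simp flip: m_assoc)
  qed
  then show "f (x \<otimes> s) * c s = 0"
    using C_c_outside[OF f] by simp
qed

text \<open>
  For \<open>x\<close> in a compact neighbourhood \<open>C\<close> of \<open>x0\<close>, the function \<open>s \<mapsto> f (x \<otimes> s)\<close> on \<open>N\<close> vanishes off the
  compact set \<open>L\<close> formed by the elements \<open>inv c \<otimes> y\<close> of \<open>N\<close> with \<open>c \<in> C\<close> and \<open>y\<close> in the support of \<open>f\<close>. The
  tube lemma, applied to \<open>{x0} \<times> L\<close>, makes \<open>f (x \<otimes> s)\<close> uniformly close to \<open>f (x0 \<otimes> s)\<close> on \<open>L\<close>, and \<open>L\<close>
  has finite measure.
\<close>

lemma continuous_fibre_integral:
  fixes f c :: "'a \<Rightarrow> complex"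
  assumes f: "f \<in> C_c T" and c: "continuous_map (subtopology T N) euclidean c"
    and c_le: "\<And>s. s \<in> N \<Longrightarrow> norm (c s) \<le> 1"
  shows "continuous_map T euclidean (\<lambda>x. \<integral>s. f (x \<otimes> s) * c s \<partial>\<mu>N)"
  unfolding continuous_map_atin limitin_canonical_iff
proof (intro ballI tendstoI)
  fix x0 and e :: real assume "x0 \<in> topspace T" "e > 0"
  then have x0: "x0 \<in> carrier G" by (simp add: topspace_eq)
  obtain U C where U: "openin T U" "compactin T C" "x0 \<in> U" "U \<subseteq> C"
    using locally_compact \<open>x0 \<in> topspace T\<close> unfolding locally_compact_space_def by blast
  have UG: "U \<subseteq> carrier G"
    using openin_subset[OF U(1)] by (simp add: topspace_eq)
  let ?P = "prod_topology T T"
  let ?K = "topological_support T f"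
  define L where "L = (\<lambda>p. inv (fst p) \<otimes> snd p) ` (C \<times> ?K) \<inter> N"
  have "compactin T ((\<lambda>p. inv (fst p) \<otimes> snd p) ` (C \<times> ?K))"
  proof (rule image_compactin)
    show "compactin ?P (C \<times> ?K)"
      using U(2) C_c_support[OF f] by (simp add: compactin_Times)
    show "continuous_map ?P T (\<lambda>p. inv (fst p) \<otimes> snd p)"
      by (intro continuous_map_group_mult continuous_map_group_inv continuous_map_fst continuous_map_snd)
  qed
  then have LN: "compactin (subtopology T N) L" "closedin (subtopology T N) L"
    unfolding L_def by (rule compact_closed_in_N)+
  then have L: "compactin T L"
    by (simp add: compactin_subtopology)
  have L_sets: "L \<in> sets \<mu>N" and L_fin: "emeasure \<mu>N L < \<infinity>"
    using muN.closedin_sets[OF LN(2)] muN.finite_compact[OF LN(1)] by auto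
  have zero: "f (x \<otimes> s) = 0" if "x \<in> U" "s \<in> N" "s \<notin> L" for x s
  proof (rule C_c_outside[OF f], rule notI)
    assume xs: "x \<otimes> s \<in> ?K"
    have "(x, x \<otimes> s) \<in> C \<times> ?K"
      using xs that(1) U(4) by blast
    from imageI[OF this, of "\<lambda>p. inv (fst p) \<otimes> snd p"]
    have "inv x \<otimes> (x \<otimes> s) \<in> L"
      using that UG N_carrier[OF that(2)] by (auto simp: L_def simp flip: m_assoc)
    then show False
      using that UG N_carrier[OF that(2)] by (auto simp flip: m_assoc)
  qed
  \<comment> \<open>Adding \<open>1\<close> covers the case that \<open>L\<close> is a null set.\<close>
  define d where "d = e / (measure \<mu>N L + 1)"
  have d: "d > 0"
    using \<open>e > 0\<close> by (auto simp: d_def intro!: divide_pos_pos add_nonneg_pos)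
  define W where "W = {p \<in> topspace ?P. f (fst p \<otimes> snd p) - f (x0 \<otimes> snd p) \<in> ball 0 d}"
  have "continuous_map ?P euclidean (\<lambda>p. f (fst p \<otimes> snd p) - f (x0 \<otimes> snd p))"
  proof (rule continuous_map_diff)
    have "continuous_map ?P T (\<lambda>p. fst p \<otimes> snd p)"
      by (intro continuous_map_group_mult continuous_map_fst continuous_map_snd)
    from continuous_map_compose[OF this C_c_continuous[OF f]]
    show "continuous_map ?P euclidean (\<lambda>p. f (fst p \<otimes> snd p))"
      by (simp add: o_def)
    have "continuous_map ?P T (\<lambda>p. x0 \<otimes> snd p)"
      using x0 by (intro continuous_map_group_mult continuous_map_snd) (simp add: topspace_eq)
    from continuous_map_compose[OF this C_c_continuous[OF f]]
    show "continuous_map ?P euclidean (\<lambda>p. f (x0 \<otimes> snd p))"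
      by (simp add: o_def)
  qed
  then have W: "openin ?P W"
    unfolding W_def by (rule openin_continuous_map_preimage) simp
  have sub: "{x0} \<times> L \<subseteq> W"
    using x0 d compactin_subset_topspace[OF L] by (auto simp: W_def topspace_eq)
  have "compactin T {x0}"
    using x0 by (simp add: topspace_eq)
  from Wallace_theorem_prod_topology[OF this L W sub]
  obtain U' V where U': "openin T U'" "openin T V" "{x0} \<subseteq> U'" "L \<subseteq> V" "U' \<times> V \<subseteq> W" .
  have "dist (\<integral>s. f (x \<otimes> s) * c s \<partial>\<mu>N) (\<integral>s. f (x0 \<otimes> s) * c s \<partial>\<mu>N) < e"
    if x: "x \<in> U" "x \<in> U'" for x
  proof -
    have xG: "x \<in> carrier G" using x UG by blast
    have le: "norm (f (x \<otimes> s) * c s - f (x0 \<otimes> s) * c s) \<le> d * indicator L s" if "s \<in> N" for s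
    proof (cases "s \<in> L")
      case True
      then have "(x, s) \<in> W"
        using U'(4,5) x by blast
      then have "norm (f (x \<otimes> s) - f (x0 \<otimes> s)) < d"
        by (simp add: W_def)
      moreover have "norm (f (x \<otimes> s) * c s - f (x0 \<otimes> s) * c s) \<le> norm (f (x \<otimes> s) - f (x0 \<otimes> s)) * 1"
        unfolding left_diff_distrib[symmetric] norm_mult using c_le[OF that]
        by (intro mult_left_mono) auto
      ultimately show ?thesis
        using True by simp
    next
      case False
      then show ?thesis
        using zero[OF x(1) that] zero[OF U(3) that] by simp
    qed
    note int = integrable_fibre[OF f xG c] integrable_fibre[OF f x0 c]
    have "dist (\<integral>s. f (x \<otimes> s) * c s \<partial>\<mu>N) (\<integral>s. f (x0 \<otimes> s) * c s \<partial>\<mu>N) =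
        norm (\<integral>s. f (x \<otimes> s) * c s - f (x0 \<otimes> s) * c s \<partial>\<mu>N)"
      by (simp only: dist_norm Bochner_Integration.integral_diff[OF int])
    also have "\<dots> \<le> (\<integral>s. norm (f (x \<otimes> s) * c s - f (x0 \<otimes> s) * c s) \<partial>\<mu>N)"
      by (rule integral_norm_bound)
    also have "\<dots> \<le> (\<integral>s. d * indicator L s \<partial>\<mu>N)"
    proof (rule integral_mono)
      show "integrable \<mu>N (\<lambda>s. norm (f (x \<otimes> s) * c s - f (x0 \<otimes> s) * c s))"
        by (intro integrable_norm Bochner_Integration.integrable_diff int)
      show "integrable \<mu>N (\<lambda>s. d * indicator L s)"
        using L_sets L_fin by simp
    qed (use le in \<open>simp add: space_N\<close>)
    also have "\<dots> = d * measure \<mu>N L"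
      using L_sets L_fin by simp
    also have "\<dots> < d * (measure \<mu>N L + 1)"
      using d by simp
    also have "\<dots> = e"
      unfolding d_def by (simp add: add_nonneg_eq_0_iff)
    finally show ?thesis .
  qed
  then show "\<forall>\<^sub>F x in atin T x0. dist (\<integral>s. f (x \<otimes> s) * c s \<partial>\<mu>N) (\<integral>s. f (x0 \<otimes> s) * c s \<partial>\<mu>N) < e"
    unfolding eventually_atin using U U' by (intro disjI2 exI[of _ "U \<inter> U'"]) auto
qed

lemma T_xi_fibre: "x \<in> carrier G \<Longrightarrow> T_xi G \<xi> \<mu>N f x = (\<integral>s. f (x \<otimes> s) * cnj (\<xi> s) \<partial>\<mu>N)"
  by (simp add: T_xi_def)

lemma continuous_cnj_character:
  "is_character \<xi> \<Longrightarrow> continuous_map (subtopology T N) euclidean (\<lambda>s. cnj (\<xi> s))"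
  using character_continuous[of \<xi>] by (simp add: continuous_map_atin tendsto_cnj)

text \<open>
  The substitution \<open>s \<mapsto> k \<otimes> s\<close> and the left invariance of the measure on \<open>N\<close> give
  \<open>T_xi f x = cnj (\<xi> k) * T_xi f (x \<otimes> k)\<close>.
\<close>

lemma T_xi_covariant:
  assumes f: "f \<in> C_c T" and \<xi>: "is_character \<xi>" and x: "x \<in> carrier G" and k: "k \<in> N"
  shows "T_xi G \<xi> \<mu>N f (x \<otimes> k) = \<xi> k * T_xi G \<xi> \<mu>N f x"
proof -
  let ?h = "\<lambda>s. f (x \<otimes> s) * cnj (\<xi> s)"
  have "T_xi G \<xi> \<mu>N f x = (\<integral>s. ?h (k \<otimes> s) \<partial>\<mu>N)"
    using topological_group.haar_integral_left_translation[OF topological_group_N haar_N, of k ?h] k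
      borel_measurable_integrable[OF integrable_fibre[OF f x continuous_cnj_character[OF \<xi>]]]
    by (simp add: T_xi_fibre[OF x])
  also have "\<dots> = (\<integral>s. cnj (\<xi> k) * (f (x \<otimes> k \<otimes> s) * cnj (\<xi> s)) \<partial>\<mu>N)"
    using x k by (intro Bochner_Integration.integral_cong)
      (auto simp: space_N N_carrier m_assoc character_mult[OF \<xi>])
  also have "\<dots> = cnj (\<xi> k) * T_xi G \<xi> \<mu>N f (x \<otimes> k)"
    using x k by (simp add: T_xi_fibre N_carrier)
  finally have "\<xi> k * T_xi G \<xi> \<mu>N f x = (\<xi> k * cnj (\<xi> k)) * T_xi G \<xi> \<mu>N f (x \<otimes> k)"
    by (simp add: mult.assoc)
  then show ?thesis
    using character_cnj[OF \<xi> k] by simp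
qed

lemma T_xi_C_xi:
  assumes f: "f \<in> C_c T" and \<xi>: "is_character \<xi>"
  shows "T_xi G \<xi> \<mu>N f \<in> C_\<xi> \<xi>"
proof (rule C_xiI[OF _ _ _ _ _ _ \<xi>])
  have "continuous_map T euclidean (\<lambda>x. \<integral>s. f (x \<otimes> s) * cnj (\<xi> s) \<partial>\<mu>N)"
    using character_norm[OF \<xi>] by (intro continuous_fibre_integral f continuous_cnj_character \<xi>) simp
  then show "continuous_map T euclidean (T_xi G \<xi> \<mu>N f)"
    by (rule continuous_map_eq) (simp add: T_xi_fibre topspace_eq)
  show "compactin QT (coset ` topological_support T f)"
    by (rule image_compactin[OF C_c_support[OF f] quotient_imp_continuous_map[OF quotient_map_coset]])
  show "closedin QT (coset ` topological_support T f)"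
    by (rule closedin_coset_image_compact[OF C_c_support[OF f]])
  show "T_xi G \<xi> \<mu>N f x = 0" if "x \<notin> carrier G" for x
    using that by (simp add: T_xi_def)
  show "coset x \<in> coset ` topological_support T f" if x: "x \<in> carrier G" "T_xi G \<xi> \<mu>N f x \<noteq> 0" for x
  proof (rule ccontr)
    assume not: "coset x \<notin> coset ` topological_support T f"
    have "f (x \<otimes> s) * cnj (\<xi> s) = 0" if s: "s \<in> N" for s
    proof -
      have "coset x = coset (x \<otimes> s)"
        using coset_eq_iff_ex[OF x(1), of "x \<otimes> s"] s x(1) N_carrier by blast
      then have "x \<otimes> s \<notin> topological_support T f"
        using not by (metis imageI)
      then show ?thesis
        using C_c_outside[OF f] by simp
    qed
    then have "(\<integral>s. f (x \<otimes> s) * cnj (\<xi> s) \<partial>\<mu>N) = (\<integral>s. 0 \<partial>\<mu>N)"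
      by (intro Bochner_Integration.integral_cong) (simp_all add: space_N)
    then show False
      using x by (simp add: T_xi_fibre)
  qed
qed (rule T_xi_covariant[OF f \<xi>])

text \<open>
  Bochner integrals of nonintegrable functions are zero, so without this lemma no inequality
  between the norms on \<open>C_xi\<close> could be derived.
\<close>

lemma integrable_on_cosets_norm:
  assumes \<psi>: "\<psi> \<in> C_\<xi> \<xi>" and \<xi>: "is_character \<xi>"
  shows "integrable \<mu>Q (on_cosets (\<lambda>y. norm (\<psi> y)))"
proof -
  obtain C where C: "compactin QT C" "closedin QT C" "\<And>x. \<lbrakk>x \<in> carrier G; \<psi> x \<noteq> 0\<rbrakk> \<Longrightarrow> coset x \<in> C"
    using C_xi_support[OF \<psi> \<xi>] by blast
  show ?thesis
  proof (rule muQ.integrable_continuous_compact_support[OF _ C(1,2)])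
    have "continuous_map T euclidean (on_cosets (\<lambda>y. norm (\<psi> y)) \<circ> coset)"
      by (rule continuous_map_eq[OF continuous_map_norm[OF C_xiD(1)[OF \<psi>]]])
        (simp add: on_cosets_norm_C_xi[OF \<psi> \<xi>] topspace_eq)
    then show "continuous_map QT euclidean (on_cosets (\<lambda>y. norm (\<psi> y)))"
      by (rule continuous_compose_quotient_map[OF quotient_map_coset])
    show "on_cosets (\<lambda>y. norm (\<psi> y)) c = 0" if "c \<in> topspace QT" "c \<notin> C" for c
      using that C(3) on_cosets_norm_C_xi[OF \<psi> \<xi>] by (fastforce simp: topspace_QT)
  qed
qed

lemma seminormed_space_C_xi:
  assumes \<xi>: "is_character \<xi>"
  shows "seminormed_space (C_xi G T N \<xi> \<mu>Q)"
  unfolding C_xi_def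
proof (rule seminormed_space_function_space)
  fix \<psi> \<phi> assume \<psi>: "\<psi> \<in> C_\<xi> \<xi>" and \<phi>: "\<phi> \<in> C_\<xi> \<xi>"
  show sum: "(\<lambda>x. \<psi> x + \<phi> x) \<in> C_\<xi> \<xi>"
    by (rule C_xi_add[OF \<psi> \<phi> \<xi>])
  have "(\<integral>C. on_cosets (\<lambda>y. norm (\<psi> y + \<phi> y)) C \<partial>\<mu>Q) \<le>
      (\<integral>C. on_cosets (\<lambda>y. norm (\<psi> y)) C + on_cosets (\<lambda>y. norm (\<phi> y)) C \<partial>\<mu>Q)"
  proof (rule integral_mono)
    show "integrable \<mu>Q (on_cosets (\<lambda>y. norm (\<psi> y + \<phi> y)))"
      by (rule integrable_on_cosets_norm[OF sum \<xi>])
    show "integrable \<mu>Q (\<lambda>C. on_cosets (\<lambda>y. norm (\<psi> y)) C + on_cosets (\<lambda>y. norm (\<phi> y)) C)"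
      by (intro Bochner_Integration.integrable_add integrable_on_cosets_norm[OF _ \<xi>] \<psi> \<phi>)
  qed (simp add: on_cosets_def norm_triangle_ineq)
  also have "\<dots> = (\<integral>C. on_cosets (\<lambda>y. norm (\<psi> y)) C \<partial>\<mu>Q) + (\<integral>C. on_cosets (\<lambda>y. norm (\<phi> y)) C \<partial>\<mu>Q)"
    by (intro Bochner_Integration.integral_add integrable_on_cosets_norm[OF _ \<xi>] \<psi> \<phi>)
  finally show "(\<integral>C. on_cosets (\<lambda>y. norm (\<psi> y + \<phi> y)) C \<partial>\<mu>Q) \<le>
      (\<integral>C. on_cosets (\<lambda>y. norm (\<psi> y)) C \<partial>\<mu>Q) + (\<integral>C. on_cosets (\<lambda>y. norm (\<phi> y)) C \<partial>\<mu>Q)" .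
next
  fix c :: complex and \<psi> :: "'a \<Rightarrow> complex"
  have "on_cosets (\<lambda>y. norm (c * \<psi> y)) C = norm c * on_cosets (\<lambda>y. norm (\<psi> y)) C" for C :: "'a set"
    by (simp add: on_cosets_def norm_mult)
  then show "(\<integral>C. on_cosets (\<lambda>y. norm (c * \<psi> y)) C \<partial>\<mu>Q) =
      norm c * (\<integral>C. on_cosets (\<lambda>y. norm (\<psi> y)) C \<partial>\<mu>Q)"
    by (simp only: integral_mult_right_zero)
qed (simp_all add: C_xi_zero[OF \<xi>] C_xi_smult[OF _ \<xi>])

text \<open>
  The integral of \<open>\<bar>f\<bar>\<close> over cosets is \<open>T_xi \<bar>f\<bar>\<close> for the trivial character. In this way it inherits
  continuity, invariance and compact support on the quotient from the general case.
\<close>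

lemma norm_fibre_integral:
  assumes f: "f \<in> C_c T" and x: "x \<in> carrier G"
  shows "norm (T_xi G (\<lambda>_. 1) \<mu>N (\<lambda>x. complex_of_real (norm (f x))) x) = (\<integral>s. norm (f (x \<otimes> s)) \<partial>\<mu>N)"
  by (simp add: T_xi_fibre[OF x])

lemma integrable_on_cosets_fibre:
  assumes f: "f \<in> C_c T"
  shows "integrable \<mu>Q (on_cosets (\<lambda>x. \<integral>s. norm (f (x \<otimes> s)) \<partial>\<mu>N))"
proof -
  let ?\<psi> = "T_xi G (\<lambda>_. 1) \<mu>N (\<lambda>x. complex_of_real (norm (f x)))"
  have \<psi>: "?\<psi> \<in> C_\<xi> (\<lambda>_. 1)"
    by (rule T_xi_C_xi[OF C_c_norm[OF f] trivial_character])
  show ?thesis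
  proof (rule Bochner_Integration.integrable_cong[THEN iffD1, OF refl _ integrable_on_cosets_norm[OF \<psi> trivial_character]])
    fix C assume "C \<in> space \<mu>Q"
    then obtain x where x: "x \<in> carrier G" "C = coset x"
      by (auto simp: space_Q)
    have inv: "(\<integral>s. norm (f (x \<otimes> k \<otimes> s)) \<partial>\<mu>N) = (\<integral>s. norm (f (x \<otimes> s)) \<partial>\<mu>N)" if k: "k \<in> N" for k
      using norm_fibre_integral[OF f, of "x \<otimes> k"] norm_fibre_integral[OF f x(1)] C_xiD(2)[OF \<psi> x(1) k]
        x(1) N_carrier[OF k] by simp
    show "on_cosets (\<lambda>y. norm (?\<psi> y)) C = on_cosets (\<lambda>x. \<integral>s. norm (f (x \<otimes> s)) \<partial>\<mu>N) C"
      unfolding x(2) on_cosets_norm_C_xi[OF \<psi> trivial_character x(1)] norm_fibre_integral[OF f x(1)]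
      by (rule on_cosets_coset[OF x(1) inv, symmetric])
  qed
qed

lemma weil_norm:
  assumes f: "f \<in> C_c T"
  shows "(\<integral>C. on_cosets (\<lambda>x. \<integral>s. norm (f (x \<otimes> s)) \<partial>\<mu>N) C \<partial>\<mu>Q) = (\<integral>x. norm (f x) \<partial>\<mu>G)"
proof -
  have "integrable \<mu>G (\<lambda>x. complex_of_real (norm (f x)))"
    by (rule muG.integrable_C_c[OF C_c_norm[OF f]])
  then have "(\<integral>C. on_cosets (\<lambda>x. \<integral>s. complex_of_real (norm (f (x \<otimes> s))) \<partial>\<mu>N) C \<partial>\<mu>Q) =
      (\<integral>x. complex_of_real (norm (f x)) \<partial>\<mu>G)"
    using weil unfolding weil_formula_def by blast
  moreover have "on_cosets (\<lambda>x. \<integral>s. complex_of_real (norm (f (x \<otimes> s))) \<partial>\<mu>N) C =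
      complex_of_real (on_cosets (\<lambda>x. \<integral>s. norm (f (x \<otimes> s)) \<partial>\<mu>N) C)" for C
    by (simp add: on_cosets_def)
  ultimately show ?thesis
    by simp
qed

lemma T_xi_contraction:
  assumes f: "f \<in> C_c T" and \<xi>: "is_character \<xi>"
  shows "(\<integral>C. on_cosets (\<lambda>y. norm (T_xi G \<xi> \<mu>N f y)) C \<partial>\<mu>Q) \<le> (\<integral>x. norm (f x) \<partial>\<mu>G)"
proof -
  have le: "norm (T_xi G \<xi> \<mu>N f x) \<le> (\<integral>s. norm (f (x \<otimes> s)) \<partial>\<mu>N)" for x
  proof (cases "x \<in> carrier G")
    case True
    have "norm (\<integral>s. f (x \<otimes> s) * cnj (\<xi> s) \<partial>\<mu>N) \<le> (\<integral>s. norm (f (x \<otimes> s) * cnj (\<xi> s)) \<partial>\<mu>N)"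
      by (rule integral_norm_bound)
    also have "\<dots> = (\<integral>s. norm (f (x \<otimes> s)) \<partial>\<mu>N)"
      by (intro Bochner_Integration.integral_cong) (simp_all add: space_N norm_mult character_norm[OF \<xi>])
    finally show ?thesis
      using True by (simp add: T_xi_fibre)
  qed (simp add: T_xi_def)
  have "(\<integral>C. on_cosets (\<lambda>y. norm (T_xi G \<xi> \<mu>N f y)) C \<partial>\<mu>Q) \<le>
      (\<integral>C. on_cosets (\<lambda>x. \<integral>s. norm (f (x \<otimes> s)) \<partial>\<mu>N) C \<partial>\<mu>Q)"
    by (intro integral_mono integrable_on_cosets_norm[OF T_xi_C_xi[OF f \<xi>] \<xi>] integrable_on_cosets_fibre f)
      (simp add: on_cosets_def le)
  then show ?thesis
    by (simp add: weil_norm[OF f])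
qed

section \<open>Norm preserving lifts\<close>

text \<open>
  Take a compact \<open>K\<close> whose cosets cover \<open>C\<close> and a Urysohn function \<open>g\<close> equal to \<open>1\<close> on \<open>K\<close>. For \<open>x\<close> over
  \<open>C\<close>, the function \<open>s \<mapsto> g (x \<otimes> s)\<close> is continuous, nonnegative and equal to \<open>1\<close> somewhere on \<open>N\<close>, and
  nonempty open subsets of \<open>N\<close> are not null.
\<close>

lemma bump_positive_on_fibres:
  assumes C: "compactin QT C"
  obtains g :: "'a \<Rightarrow> real"
  where "(\<lambda>x. complex_of_real (g x)) \<in> C_c T" "\<And>x. 0 \<le> g x"
    "\<And>x. \<lbrakk>x \<in> carrier G; coset x \<in> C\<rbrakk> \<Longrightarrow> (\<integral>s. g (x \<otimes> s) \<partial>\<mu>N) \<noteq> 0"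
proof -
  obtain K where K: "compactin T K" "C \<subseteq> coset ` K"
    using compact_coset_lift[OF C] by blast
  obtain g :: "'a \<Rightarrow> real" where g: "(\<lambda>x. complex_of_real (g x)) \<in> C_c T" "\<And>x. 0 \<le> g x"
    "\<And>x. x \<in> K \<Longrightarrow> g x = 1"
    using Urysohn_compact_support[OF locally_compact Hausdorff K(1) openin_topspace
        compactin_subset_topspace[OF K(1)]] by metis
  have "(\<integral>s. g (x \<otimes> s) \<partial>\<mu>N) \<noteq> 0" if x: "x \<in> carrier G" "coset x \<in> C" for x
  proof
    assume zero: "(\<integral>s. g (x \<otimes> s) \<partial>\<mu>N) = 0"
    obtain y where y: "y \<in> K" "coset x = coset y"
      using K(2) x(2) by blast
    have "y \<in> carrier G"
      using y(1) compactin_subset_topspace[OF K(1)] by (auto simp: topspace_eq)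
    then obtain k where k: "k \<in> N" "y = x \<otimes> k"
      using coset_eq_iff_ex[OF x(1)] y(2) by blast
    have cont: "continuous_map (subtopology T N) euclidean (\<lambda>s. complex_of_real (g (x \<otimes> s)))"
      by (rule continuous_fibre[OF C_c_continuous[OF g(1)] x(1)])
    have "integrable \<mu>N (\<lambda>s. complex_of_real (g (x \<otimes> s)) * 1)"
      by (rule integrable_fibre[OF g(1) x(1)]) simp
    then have int: "integrable \<mu>N (\<lambda>s. g (x \<otimes> s))"
      using integrable_Re by fastforce
    have AE: "AE s in \<mu>N. g (x \<otimes> s) = 0"
      using zero integral_nonneg_eq_0_iff_AE[OF int] g(2) by simp
    define V where "V = {s \<in> topspace (subtopology T N). complex_of_real (g (x \<otimes> s)) \<in> - {0}}"
    have V: "openin (subtopology T N) V"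
      unfolding V_def by (rule openin_continuous_map_preimage[OF cont]) auto
    have "k \<in> V"
      using k y(1) g(3)[of y] by (simp add: V_def topspace_eq N_carrier)
    then have "emeasure \<mu>N V \<noteq> 0"
      using topological_group.haar_open_positive[OF topological_group_N haar_N V] by blast
    moreover have "AE s in \<mu>N. s \<notin> V"
      using AE by eventually_elim (simp add: V_def)
    then have "V \<in> null_sets \<mu>N"
      using AE_iff_null_sets[OF muN.openin_sets[OF V]] by simp
    ultimately show False
      by (simp add: null_setsD1)
  qed
  then show thesis
    using that g by blast
qed

text \<open>
  The lift is \<open>f = (\<psi> / \<Phi>) g\<close>, where \<open>\<Phi> x\<close> is the integral of \<open>g\<close> over the coset of \<open>x\<close>. The quotient \<open>\<theta>\<close> is
  continuous: \<open>\<Phi>\<close> is nonzero on the support of \<open>\<psi>\<close>, and off the support, which is closed, \<open>\<theta>\<close>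
  vanishes locally. With \<open>x / 0 = 0\<close>, no case distinction is needed in its definition.
\<close>

lemma T_xi_isometric_lift:
  assumes \<psi>: "\<psi> \<in> C_\<xi> \<xi>" and \<xi>: "is_character \<xi>"
  shows "\<exists>f\<in>C_c T. T_xi G \<xi> \<mu>N f = \<psi> \<and>
    (\<integral>x. norm (f x) \<partial>\<mu>G) = (\<integral>C. on_cosets (\<lambda>y. norm (\<psi> y)) C \<partial>\<mu>Q)"
proof -
  obtain g :: "'a \<Rightarrow> real" where g: "(\<lambda>x. complex_of_real (g x)) \<in> C_c T" "\<And>x. 0 \<le> g x"
    and pos: "\<And>x. \<lbrakk>x \<in> carrier G; coset x \<in> coset ` topological_support T \<psi>\<rbrakk> \<Longrightarrow>
      (\<integral>s. g (x \<otimes> s) \<partial>\<mu>N) \<noteq> 0"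
    using bump_positive_on_fibres[OF C_xiD(4)[OF \<psi>]] by metis
  define \<Phi> where "\<Phi> x = (\<integral>s. g (x \<otimes> s) \<partial>\<mu>N)" for x
  have \<Phi>_T: "complex_of_real (\<Phi> x) = T_xi G (\<lambda>_. 1) \<mu>N (\<lambda>x. complex_of_real (g x)) x"
    if "x \<in> carrier G" for x
    by (simp add: \<Phi>_def T_xi_fibre[OF that])
  note T1 = T_xi_C_xi[OF g(1) trivial_character]
  have \<Phi>_cont: "continuous_map T euclidean (\<lambda>x. complex_of_real (\<Phi> x))"
    by (rule continuous_map_eq[OF C_xiD(1)[OF T1]]) (simp add: \<Phi>_T topspace_eq)
  have \<Phi>_inv: "\<Phi> (x \<otimes> k) = \<Phi> x" if "x \<in> carrier G" "k \<in> N" for x k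
  proof -
    have "complex_of_real (\<Phi> (x \<otimes> k)) = complex_of_real (\<Phi> x)"
      using C_xiD(2)[OF T1 that] that by (simp add: \<Phi>_T N_carrier)
    then show ?thesis
      by (simp only: of_real_eq_iff)
  qed
  have \<Phi>_nonneg: "0 \<le> \<Phi> x" for x
    unfolding \<Phi>_def using g(2) by (intro integral_nonneg_AE) simp
  have \<psi>_zero: "\<psi> x = 0" if "x \<in> carrier G" "\<Phi> x = 0" for x
  proof (rule ccontr)
    assume "\<psi> x \<noteq> 0"
    then have "x \<in> topological_support T \<psi>"
      using topological_support_subset[of x T \<psi>] that(1) by (simp add: topspace_eq)
    then show False
      using pos[OF that(1)] that(2) by (simp add: \<Phi>_def)
  qed
  define \<theta> where "\<theta> x = \<psi> x / complex_of_real (\<Phi> x)" for x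
  have \<theta>_cont: "continuous_map T euclidean \<theta>"
    unfolding continuous_map_atin limitin_canonical_iff
  proof
    fix x assume x: "x \<in> topspace T"
    show "(\<theta> \<longlongrightarrow> \<theta> x) (atin T x)"
    proof (cases "\<Phi> x = 0")
      case False
      have "(\<psi> \<longlongrightarrow> \<psi> x) (atin T x)" "((\<lambda>x. complex_of_real (\<Phi> x)) \<longlongrightarrow> complex_of_real (\<Phi> x)) (atin T x)"
        using C_xiD(1)[OF \<psi>] \<Phi>_cont x by (simp_all add: continuous_map_atin)
      then show ?thesis
        unfolding \<theta>_def using False by (intro tendsto_divide) auto
    next
      case True
      let ?U = "topspace T - topological_support T \<psi>"
      have "x \<notin> topological_support T \<psi>"
        using True pos[of x] x by (auto simp: \<Phi>_def topspace_eq)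
      then have U: "openin T ?U" "x \<in> ?U"
        using x closedin_topological_support[of T \<psi>] by auto
      have zero: "\<theta> y = 0" if "y \<in> ?U" for y
        using that topological_support_subset[of y T \<psi>] by (auto simp: \<theta>_def)
      then have "\<forall>\<^sub>F y in atin T x. \<theta> y = \<theta> x"
        unfolding eventually_atin using U by (intro disjI2 exI[of _ ?U]) auto
      then show ?thesis
        by (rule tendsto_eventually)
    qed
  qed
  define f where "f x = \<theta> x * complex_of_real (g x)" for x
  have f: "f \<in> C_c T"
    unfolding f_def by (rule C_c_mult[OF \<theta>_cont g(1)])
  have f_fibre: "f (x \<otimes> s) = \<xi> s * \<theta> x * complex_of_real (g (x \<otimes> s))" if "x \<in> carrier G" "s \<in> N" for x s
    using that by (simp add: f_def \<theta>_def C_xiD(2)[OF \<psi>] \<Phi>_inv)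
  have "T_xi G \<xi> \<mu>N f x = \<psi> x" for x
  proof (cases "x \<in> carrier G")
    case True
    have "(\<integral>s. f (x \<otimes> s) * cnj (\<xi> s) \<partial>\<mu>N) = (\<integral>s. \<theta> x * complex_of_real (g (x \<otimes> s)) \<partial>\<mu>N)"
    proof (rule Bochner_Integration.integral_cong[OF refl])
      fix s assume "s \<in> space \<mu>N"
      then have s: "s \<in> N" by (simp add: space_N)
      have "f (x \<otimes> s) * cnj (\<xi> s) = (\<xi> s * cnj (\<xi> s)) * (\<theta> x * complex_of_real (g (x \<otimes> s)))"
        unfolding f_fibre[OF True s] by (simp only: ac_simps)
      then show "f (x \<otimes> s) * cnj (\<xi> s) = \<theta> x * complex_of_real (g (x \<otimes> s))"
        by (simp add: character_cnj[OF \<xi> s])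
    qed
    also have "\<dots> = \<theta> x * complex_of_real (\<Phi> x)"
      by (simp add: \<Phi>_def)
    also have "\<dots> = \<psi> x"
      using \<psi>_zero[OF True] by (simp add: \<theta>_def)
    finally show ?thesis
      using True by (simp add: T_xi_fibre)
  qed (simp add: T_xi_def C_xiD(3)[OF \<psi>])
  moreover have "(\<integral>x. norm (f x) \<partial>\<mu>G) = (\<integral>C. on_cosets (\<lambda>y. norm (\<psi> y)) C \<partial>\<mu>Q)"
    unfolding weil_norm[OF f, symmetric]
  proof (rule Bochner_Integration.integral_cong[OF refl])
    have fibre: "(\<integral>s. norm (f (x \<otimes> s)) \<partial>\<mu>N) = norm (\<psi> x)" if x: "x \<in> carrier G" for x
    proof -
      have "(\<integral>s. norm (f (x \<otimes> s)) \<partial>\<mu>N) = (\<integral>s. norm (\<theta> x) * g (x \<otimes> s) \<partial>\<mu>N)"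
        using g(2) by (intro Bochner_Integration.integral_cong)
          (simp_all add: space_N f_fibre[OF x] norm_mult character_norm[OF \<xi>])
      also have "\<dots> = norm (\<theta> x) * \<Phi> x"
        by (simp add: \<Phi>_def)
      also have "\<dots> = norm (\<psi> x)"
        using \<psi>_zero[OF x] \<Phi>_nonneg[of x] by (simp add: \<theta>_def norm_divide)
      finally show ?thesis .
    qed
    fix C assume "C \<in> space \<mu>Q"
    then obtain x where x: "x \<in> carrier G" "C = coset x"
      by (auto simp: space_Q)
    have "on_cosets (\<lambda>x. \<integral>s. norm (f (x \<otimes> s)) \<partial>\<mu>N) (coset x) = (\<integral>s. norm (f (x \<otimes> s)) \<partial>\<mu>N)"
      using x(1) C_xiD(2)[OF \<psi> x(1)]
      by (intro on_cosets_coset) (simp_all add: fibre N_carrier norm_mult character_norm[OF \<xi>])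
    then show "on_cosets (\<lambda>x. \<integral>s. norm (f (x \<otimes> s)) \<partial>\<mu>N) C = on_cosets (\<lambda>y. norm (\<psi> y)) C"
      unfolding x(2) by (simp add: fibre[OF x(1)] on_cosets_norm_C_xi[OF \<psi> \<xi> x(1)])
  qed
  ultimately show ?thesis
    using f by blast
qed

section \<open>The isometric isomorphism\<close>

lemma T_xi_norm_preserving_lift:
  assumes \<xi>: "is_character \<xi>"
  shows "norm_preserving_lift (L1_functions \<mu>G) (C_xi G T N \<xi> \<mu>Q) (C_c T) (T_xi G \<xi> \<mu>N)"
proof -
  let ?V = "L1_functions \<mu>G" and ?W = "C_xi G T N \<xi> \<mu>Q"
  interpret V: seminormed_space ?V by (rule seminormed_space_L1_functions)
  interpret W: seminormed_space ?W by (rule seminormed_space_C_xi[OF \<xi>])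
  have V_simps: "carrier ?V = {f. integrable \<mu>G f}" "seminorm ?V f = (\<integral>x. norm (f x) \<partial>\<mu>G)"
    "\<zero>\<^bsub>?V\<^esub> = (\<lambda>x. 0)" "f \<oplus>\<^bsub>?V\<^esub> g = (\<lambda>x. f x + g x)" "c \<odot>\<^bsub>?V\<^esub> f = (\<lambda>x. c * f x)" for f g c
    by (simp_all add: L1_functions_def)
  have W_simps: "carrier ?W = C_\<xi> \<xi>" "seminorm ?W f = (\<integral>C. on_cosets (\<lambda>y. norm (f y)) C \<partial>\<mu>Q)"
    "f \<oplus>\<^bsub>?W\<^esub> g = (\<lambda>x. f x + g x)" "c \<odot>\<^bsub>?W\<^esub> f = (\<lambda>x. c * f x)" for f g c
    by (simp_all add: C_xi_def)
  have V_minus: "f \<ominus>\<^bsub>?V\<^esub> g = (\<lambda>x. f x - g x)" if "integrable \<mu>G f" "integrable \<mu>G g" for f g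
    using function_space_minus[OF seminormed_space_L1_functions[of \<mu>G, unfolded L1_functions_def]] that
    by (simp add: L1_functions_def)
  show ?thesis
  proof (unfold_locales)
    show "linear_subspace ?V (C_c T)"
      unfolding linear_subspace_def V_simps
      by (auto intro: muG.integrable_C_c C_c_zero C_c_add C_c_scale)
    show "\<exists>d\<in>C_c T. seminorm ?V (v \<ominus>\<^bsub>?V\<^esub> d) < e" if vV: "v \<in> carrier ?V" and e: "e > 0" for v e
    proof -
      have v: "integrable \<mu>G v"
        using vV by (simp add: V_simps)
      obtain d where d: "d \<in> C_c T" "(\<integral>x. norm (v x - d x) \<partial>\<mu>G) < e"
        using muG.C_c_dense[OF v e] by blast
      have "seminorm ?V (v \<ominus>\<^bsub>?V\<^esub> d) < e"
        using d(2) unfolding V_minus[OF v muG.integrable_C_c[OF d(1)]] V_simps .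
      then show ?thesis
        using d(1) by blast
    qed
    show "T_xi G \<xi> \<mu>N d \<in> carrier ?W" if "d \<in> C_c T" for d
      unfolding W_simps by (rule T_xi_C_xi[OF that \<xi>])
    show "T_xi G \<xi> \<mu>N (d \<oplus>\<^bsub>?V\<^esub> d') = T_xi G \<xi> \<mu>N d \<oplus>\<^bsub>?W\<^esub> T_xi G \<xi> \<mu>N d'"
      if "d \<in> C_c T" "d' \<in> C_c T" for d d'
    proof -
      have "T_xi G \<xi> \<mu>N (\<lambda>x. d x + d' x) x = T_xi G \<xi> \<mu>N d x + T_xi G \<xi> \<mu>N d' x" for x
      proof (cases "x \<in> carrier G")
        case True
        show ?thesis
          unfolding T_xi_fibre[OF True] distrib_right
          by (intro Bochner_Integration.integral_add integrable_fibre that True continuous_cnj_character \<xi>)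
      qed (simp add: T_xi_def)
      then show ?thesis
        unfolding V_simps W_simps by blast
    qed
    show "T_xi G \<xi> \<mu>N (c \<odot>\<^bsub>?V\<^esub> d) = c \<odot>\<^bsub>?W\<^esub> T_xi G \<xi> \<mu>N d" if "d \<in> C_c T" for d c
      unfolding V_simps W_simps by (auto simp: T_xi_def mult.assoc)
    show "seminorm ?W (T_xi G \<xi> \<mu>N d) \<le> seminorm ?V d" if "d \<in> C_c T" for d
      unfolding V_simps W_simps by (rule T_xi_contraction[OF that \<xi>])
    show "\<exists>d\<in>C_c T. T_xi G \<xi> \<mu>N d = w \<and> seminorm ?V d \<le> seminorm ?W w" if "w \<in> carrier ?W" for w
    proof -
      have "w \<in> C_\<xi> \<xi>"
        using that by (simp add: W_simps)
      from T_xi_isometric_lift[OF this \<xi>] show ?thesis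
        unfolding V_simps W_simps by force
    qed
    show "\<exists>v\<in>carrier ?V. (\<lambda>n. seminorm ?V (v \<ominus>\<^bsub>?V\<^esub> u n)) \<longlonglongrightarrow> 0"
      if "\<And>n. u n \<in> carrier ?V" "summable (\<lambda>n. seminorm ?V (u (Suc n) \<ominus>\<^bsub>?V\<^esub> u n))" for u
    proof -
      have u: "integrable \<mu>G (u n)" for n
        using that(1) by (simp add: V_simps)
      have "summable (\<lambda>n. \<integral>x. norm (u (Suc n) x - u n x) \<partial>\<mu>G)"
        using that(2) unfolding V_minus[OF u u] V_simps .
      from L1_functions_complete[OF u this]
      obtain v where v: "integrable \<mu>G v" "(\<lambda>n. \<integral>x. norm (v x - u n x) \<partial>\<mu>G) \<longlonglongrightarrow> 0"
        by blast
      have "(\<lambda>n. seminorm ?V (v \<ominus>\<^bsub>?V\<^esub> u n)) \<longlonglongrightarrow> 0"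
        using v(2) unfolding V_minus[OF v(1) u] V_simps .
      then show ?thesis
        using v(1) by (auto simp: V_simps)
    qed
  qed
qed

text \<open>
  Existence and uniqueness of the bounded extension, which together identify the definite
  description.
\<close>

lemma T_xi_ext_eq_extension:
  assumes \<xi>: "is_character \<xi>"
  shows "T_xi_ext G T N \<xi> \<mu>G \<mu>N \<mu>Q =
    dense_contraction.extension (L1_functions \<mu>G) (C_xi G T N \<xi> \<mu>Q) (C_c T) (T_xi G \<xi> \<mu>N)"
proof -
  interpret norm_preserving_lift "L1_functions \<mu>G" "C_xi G T N \<xi> \<mu>Q" "C_c T" "T_xi G \<xi> \<mu>N"
    by (rule T_xi_norm_preserving_lift[OF \<xi>])
  show ?thesis
    unfolding T_xi_ext_def L1_def L1_xi_def
  proof (rule the_equality)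
    show "extension \<in> bounded_linear_maps (separation (L1_functions \<mu>G)) (completion (C_xi G T N \<xi> \<mu>Q)) \<and>
        extension \<in> extensional (carrier (separation (L1_functions \<mu>G))) \<and>
        (\<forall>f\<in>C_c T. extension (sep_class (L1_functions \<mu>G) f) = to_completion (C_xi G T N \<xi> \<mu>Q) (T_xi G \<xi> \<mu>N f))"
      using extension_bounded_linear extension_to_completion by (simp add: extension_def)
  qed (intro extension_unique, auto)
qed

end

theorem theorem5p5:
  fixes G :: "('a, 'm) monoid_scheme" and T :: "'a topology" and N :: "'a set"
    and \<xi> :: "'a \<Rightarrow> complex"
    and \<mu>G \<mu>N :: "'a measure" and \<mu>Q :: "'a set measure"
  assumes "locally_compact_group G T"
    and "N \<lhd> G"
    and "closedin T N"
    and "\<xi> \<in> characters (G\<lparr>carrier := N\<rparr>) (subtopology T N)"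
    and "left_haar_measure G T \<mu>G"
    and "left_haar_measure (G\<lparr>carrier := N\<rparr>) (subtopology T N) \<mu>N"
    and "left_haar_measure (G Mod N) (coset_topology G T N) \<mu>Q"
    and "weil_formula G \<mu>G \<mu>N \<mu>Q"
  shows "isometrically_isomorphic
    (L1_xi G T N \<xi> \<mu>Q)
    (quotient_space (L1 \<mu>G) (N1_xi G T N \<xi> \<mu>G \<mu>N \<mu>Q))"
proof -
  interpret haar_quotient G T N \<mu>G \<mu>N \<mu>Q
    using assms by (simp add: haar_quotient_def haar_quotient_axioms_def
        closed_normal_subgroup_def closed_normal_subgroup_axioms_def)
  interpret norm_preserving_lift "L1_functions \<mu>G" "C_xi G T N \<xi> \<mu>Q" "C_c T" "T_xi G \<xi> \<mu>N"
    by (rule T_xi_norm_preserving_lift[OF assms(4)])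
  show ?thesis
    using completion_isometric_quotient
    unfolding N1_xi_def L1_xi_def L1_def T_xi_ext_eq_extension[OF assms(4)] .
qed

end
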